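(* Let $n\ge1$ be an integer, $m\ge1$, $\sigma\ge1$ and $0\le\sigma_1<\sigma/2<\sigma_2\le\sigma$ be real numbers. Assume that $u_0\equiv0$ and that $u_1\in L^m(\mathbb{R}^n)$ satisfies $$\int_{\mathbb{R}^n}u_1(x)\,dx>0\ \text{ if } m=1,\qquad\text{or}\qquad u_1(x)\ge\langle x\rangle^{-\frac nm}\big(\log(e+|x|)\big)^{-1}\ \text{ if } m>1.$$ Moreover, assume that $$1<p\begin{cases}<\infty & \text{if } n\le 2m\sigma_1,\\ <1+\dfrac{2m\sigma}{n-2m\sigma_1} & \text{if } n>2m\sigma_1.\end{cases}$$ Put $$\gamma_m:=1-\frac{n}{2m(\sigma-\sigma_1)}(p-1)+\frac{p\sigma_1}{\sigma-\sigma_1},$$ and let $\delta>0$ be an arbitrarily small real number. Then there is $\varepsilon_0>0$ such that for all $\varepsilon\in(0,\varepsilon_0]$ the lifespan $T_m(\varepsilon)$ of solutions to the Cauchy problem $$\begin{cases} u_{tt}+(-\Delta)^\sigma u+(-\Delta)^{\sigma_1}u_t+(-\Delta)^{\sigma_2}u_t=|u|^p, & x\in\mathbb{R}^n,\ t>0,\\ u(0,x)=\varepsilon u_0(x),\quad u_t(0,x)=\varepsilon u_1(x), & x\in\mathbb{R}^n,\end{cases}$$ satisfies $$T_m(\varepsilon)\lesssim\begin{cases}\varepsilon^{-\frac{p-1}{\gamma_1}} & \text{if } m=1,\\ \varepsilon^{-\frac{p-1}{\gamma_m}-\delta} & \text{if } m>1.\end{cases}$$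
   Context: Here $\langle x\rangle=(1+|x|^2)^{1/2}$, and $(-\Delta)^{a}\psi=\mathfrak{F}^{-1}(|\xi|^{2a}\mathfrak{F}(\psi)(\xi))$ with $\mathfrak{F}$ the Fourier transform in $x$. The notation $f\lesssim g$ means $f\le Cg$ for some constant $C>0$ (independent of $\varepsilon$; it may depend on $\delta$). Weak solution (for $u_0\equiv 0$, $p>1$, $T>0$): $u\in\mathcal{C}([0,T),L^2)$ is a local weak solution if for all test functions $\phi(t,x)=\eta(t)\varphi(x)$, with $\eta\in\mathcal{C}_0^\infty([0,T))$ and $\varphi\in\mathcal{C}^\infty(\mathbb{R}^n)$ having all derivatives in $L^1\cap L^\infty$, it holds $$\int_0^T\!\!\int_{\mathbb{R}^n}|u(t,x)|^p\phi(t,x)\,dx\,dt+\varepsilon\int_{\mathbb{R}^n}u_1(x)\phi(0,x)\,dx=\int_0^T\!\!\int_{\mathbb{R}^n}u(t,x)\Big(\partial_t^2-\partial_t(-\Delta)^{\sigma_1}-\partial_t(-\Delta)^{\sigma_2}+(-\Delta)^\sigma\Big)\phi(t,x)\,dx\,dt.$$ The lifespan $T_m(\varepsilon)$ is the maximal existence time of local solutions, i.e. the supremum of all $T>0$ for which a local weak solution $u\in\mathcal{C}([0,T),L^2)$ exists. *)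

theory Defs
  imports "HOL-Analysis.Analysis"
begin

definition in_Lp :: "real \<Rightarrow> ('a::euclidean_space \<Rightarrow> real) \<Rightarrow> bool" where
  "in_Lp q f \<longleftrightarrow> f \<in> borel_measurable lborel \<and> integrable lborel (\<lambda>x. \<bar>f x\<bar> powr q)"

definition Lp_norm :: "real \<Rightarrow> ('a::euclidean_space \<Rightarrow> real) \<Rightarrow> real" where
  "Lp_norm q f = (LINT x|lborel. \<bar>f x\<bar> powr q) powr (1 / q)"

definition japanese_bracket :: "'a::euclidean_space \<Rightarrow> real" where
  "japanese_bracket x = sqrt (1 + (norm x)\<^sup>2)"

(* The exponent carries no factor 2 pi, so that - Laplace has symbol |xi|^2. *)
definition fourier :: "('a::euclidean_space \<Rightarrow> complex) \<Rightarrow> 'a \<Rightarrow> complex" where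
  "fourier \<psi> \<xi> = of_real ((2 * pi) powr (- real DIM('a) / 2)) *
     (LINT x|lborel. exp (- \<i> * of_real (x \<bullet> \<xi>)) * \<psi> x)"

definition inv_fourier :: "('a::euclidean_space \<Rightarrow> complex) \<Rightarrow> 'a \<Rightarrow> complex" where
  "inv_fourier g x = of_real ((2 * pi) powr (- real DIM('a) / 2)) *
     (LINT \<xi>|lborel. exp (\<i> * of_real (x \<bullet> \<xi>)) * g \<xi>)"

(* (- Laplace)^a on real functions. If psi is smooth with all derivatives in L^1, its Fourier
   transform is continuous and rapidly decreasing, so for a >= 0 the inverse transform is an
   absolutely convergent integral; its value is real because the symbol is real and even.
   For a = 0 the convention 0 powr 0 = 0 affects the single point xi = 0 only. *)
definition frac_laplacian :: "real \<Rightarrow> ('a::euclidean_space \<Rightarrow> real) \<Rightarrow> 'a \<Rightarrow> real" where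
  "frac_laplacian a \<psi> x =
     Re (inv_fourier (\<lambda>\<xi>. of_real (norm \<xi> powr (2 * a)) * fourier (\<lambda>y. of_real (\<psi> y)) \<xi>) x)"

primrec iter_partial :: "'a::euclidean_space list \<Rightarrow> ('a \<Rightarrow> real) \<Rightarrow> 'a \<Rightarrow> real" where
  "iter_partial [] f = f"
| "iter_partial (b # bs) f = (\<lambda>x. frechet_derivative (iter_partial bs f) (at x) b)"

definition smooth :: "('a::euclidean_space \<Rightarrow> real) \<Rightarrow> bool" where
  "smooth f \<longleftrightarrow> (\<forall>bs x. set bs \<subseteq> Basis \<longrightarrow> iter_partial bs f differentiable (at x))"

(* The class C_0^infinity([0,T)): the support is compact in [0,T) but may contain 0. A function
   smooth up to t = 0 extends smoothly to the real line; the extension is arbitrary for t < 0. *)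
definition time_test :: "real \<Rightarrow> (real \<Rightarrow> real) \<Rightarrow> bool" where
  "time_test T \<eta> \<longleftrightarrow> smooth \<eta> \<and> (\<exists>T'<T. \<forall>t\<ge>T'. \<eta> t = 0)"

(* The derivatives are continuous, so being in L^infinity means being bounded. *)
definition space_test :: "('a::euclidean_space \<Rightarrow> real) \<Rightarrow> bool" where
  "space_test \<phi> \<longleftrightarrow> smooth \<phi> \<and>
     (\<forall>bs. set bs \<subseteq> Basis \<longrightarrow>
        integrable lborel (iter_partial bs \<phi>) \<and> bounded (range (iter_partial bs \<phi>)))"

(* The operator d_t^2 - d_t (- Laplace)^sigma1 - d_t (- Laplace)^sigma2 + (- Laplace)^sigma. *)
definition adjoint_op ::
  "real \<Rightarrow> real \<Rightarrow> real \<Rightarrow> (real \<Rightarrow> 'a::euclidean_space \<Rightarrow> real) \<Rightarrow> real \<Rightarrow> 'a \<Rightarrow> real" where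
  "adjoint_op \<sigma> \<sigma>1 \<sigma>2 \<Phi> t x =
     deriv (deriv (\<lambda>s. \<Phi> s x)) t
     - deriv (\<lambda>s. frac_laplacian \<sigma>1 (\<Phi> s) x) t
     - deriv (\<lambda>s. frac_laplacian \<sigma>2 (\<Phi> s) x) t
     + frac_laplacian \<sigma> (\<Phi> t) x"

(* u in C([0,T), L^2), given by a jointly measurable representative; every continuous curve
   in L^2 has one. *)
definition cont_L2 :: "real \<Rightarrow> (real \<Rightarrow> 'a::euclidean_space \<Rightarrow> real) \<Rightarrow> bool" where
  "cont_L2 T u \<longleftrightarrow>
     set_borel_measurable lborel ({0..<T} \<times> UNIV) (\<lambda>(t, x). u t x) \<and>
     (\<forall>t\<in>{0..<T}. in_Lp 2 (u t)) \<and>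
     (\<forall>t\<in>{0..<T}. ((\<lambda>s. Lp_norm 2 (\<lambda>x. u s x - u t x)) \<longlongrightarrow> 0) (at t within {0..<T}))"

(* Local weak solutions for u_0 = 0. The identity presupposes that |u|^p phi is integrable, which
   is required explicitly because divergent integrals have the value 0 in HOL. The other integrals
   converge automatically: u_1 is in some L^m with m >= 1, u is bounded in L^2 on the support of
   eta, and the powers (- Laplace)^a phi are in L^2. *)
definition weak_solution ::
  "real \<Rightarrow> real \<Rightarrow> real \<Rightarrow> real \<Rightarrow> ('a::euclidean_space \<Rightarrow> real) \<Rightarrow> real \<Rightarrow> real
     \<Rightarrow> (real \<Rightarrow> 'a \<Rightarrow> real) \<Rightarrow> bool" where
  "weak_solution \<sigma> \<sigma>1 \<sigma>2 p u1 \<epsilon> T u \<longleftrightarrow>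
     cont_L2 T u \<and>
     (\<forall>\<eta> \<phi>. time_test T \<eta> \<and> space_test \<phi> \<longrightarrow>
        set_integrable lborel ({0..<T} \<times> UNIV) (\<lambda>(t, x). \<bar>u t x\<bar> powr p * (\<eta> t * \<phi> x)) \<and>
        (LINT t:{0..<T}|lborel. LINT x|lborel. \<bar>u t x\<bar> powr p * (\<eta> t * \<phi> x))
          + \<epsilon> * (LINT x|lborel. u1 x * (\<eta> 0 * \<phi> x))
        = (LINT t:{0..<T}|lborel. LINT x|lborel.
             u t x * adjoint_op \<sigma> \<sigma>1 \<sigma>2 (\<lambda>s y. \<eta> s * \<phi> y) t x))"

(* Possibly infinite; equal to 0 if there is no local solution. *)
definition lifespan ::
  "real \<Rightarrow> real \<Rightarrow> real \<Rightarrow> real \<Rightarrow> ('a::euclidean_space \<Rightarrow> real) \<Rightarrow> real \<Rightarrow> ennreal" where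
  "lifespan \<sigma> \<sigma>1 \<sigma>2 p u1 \<epsilon> =
     Sup (ennreal ` {T. 0 < T \<and> (\<exists>u. weak_solution \<sigma> \<sigma>1 \<sigma>2 p u1 \<epsilon> T u)})"

definition gamma_exponent :: "nat \<Rightarrow> real \<Rightarrow> real \<Rightarrow> real \<Rightarrow> real \<Rightarrow> real" where
  "gamma_exponent n m \<sigma> \<sigma>1 p =
     1 - real n / (2 * m * (\<sigma> - \<sigma>1)) * (p - 1) + p * \<sigma>1 / (\<sigma> - \<sigma>1)"

end

theory Submission
  imports Defs "HOL-Probability.Characteristic_Functions"
begin

text \<open>
  Test function method. Testing the equation with \<open>\<eta>(t/\<tau>) \<phi>(x/R)\<close>, where \<open>\<tau> = R powr (2(\<sigma> - \<sigma>1))\<close>,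
  and absorbing the nonlinear term by Young's inequality gives
  \<open>\<epsilon> \<integral> u1 \<phi>(x/R) dx \<le> K R powr (2(\<sigma> - \<sigma>1) + n - 2\<sigma>p/(p-1))\<close> for every \<open>R \<ge> 1\<close> with \<open>\<tau> < T\<close>.
  Since \<open>u0 = 0\<close>, the cut-off \<open>\<eta>\<close> needs no plateau at \<open>t = 0\<close>: \<open>\<eta>(t) = exp(-1/(1-t))\<close> works for all
  \<open>p > 1\<close>, because \<open>\<eta>'\<close> and \<open>\<eta>''\<close> are \<open>O(\<eta> powr (1/p))\<close>.

  What is required of \<open>\<phi> > 0\<close> is \<open>\<bar>(-\<Delta>)\<^sup>a \<phi>\<bar> \<le> C \<phi>\<close> for the three exponents at once. Instead of estimating
  \<open>(-\<Delta>)\<^sup>a\<close> of an explicit function pointwise, take \<open>\<phi> = f * \<psi>\<close>, where \<open>f\<close> has Fourier transform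
  \<open>exp(-\<bar>\<xi>\<bar>\<^sup>2) (1 + \<bar>\<xi>\<bar>\<^sup>2) powr (-M)\<close>. Then \<open>(-\<Delta>)\<^sup>a \<phi> = k\<^sub>a * \<psi>\<close> with \<open>k\<^sub>a\<close> an integrable superposition
  of heat kernels, and \<open>\<psi>\<close> is chosen as a Neumann series in \<open>\<kappa> = \<Sum> \<bar>k\<^sub>a\<bar>\<close>, so that
  \<open>\<kappa> * \<psi> \<le> L \<psi>\<close>. A Harnack inequality for \<open>\<psi>\<close> yields \<open>\<psi> \<le> C' (f * \<psi>)\<close>.
\<close>

section \<open>Gaussian integrals\<close>

text \<open>The obstacle is nonlocality. For non-integer \<open>a\<close> the function (-Laplace)^a
  \<phi> decays only polynomially even if \<phi> is a Gaussian or has compact support, so such a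
  \<phi> cannot dominate it, and explicit decay rates would have to be compared for three exponents.
  The Neumann series needs no rate: it adapts \<psi> to whatever integrable kernels occur.
  Integrability of the kernels is what the factor with exponent -M is for. The symbol |\<xi>|^(2a)
  is not smooth at the origin, but for 0 \<le> a < M the function l^a (1 + l)^(-M) is the Laplace
  transform of an integrable signed weight; put l = |\<xi>|^2. The Gaussian factor supplies the
  smoothness of \<phi>. The exponent of the lifespan comes from comparing powers of R. The tested
  data are at least a constant if m = 1, and at least R^(n - n/m) / log R up to a constant if m > 1.
  What is left is \<epsilon> \<le> C R^(-\<kappa>), with \<kappa> = 2 (\<sigma> - \<sigma>1)
  \<gamma>_m / (p - 1) up to the logarithm, while time is R^(2 (\<sigma> - \<sigma>1)). The loss
  \<delta> pays for the logarithm.\<close>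

lemma lborel_euclidean_affine:
  fixes t :: "'a::euclidean_space" and c :: real
  assumes "c \<noteq> 0"
  shows "lborel = density (distr lborel borel (\<lambda>x. t + c *\<^sub>R x)) (\<lambda>_. ennreal (\<bar>c\<bar> ^ DIM('a)))"
  using lborel_affine[OF assms, of t] by (simp add: ennreal_power)

lemma nn_integral_euclidean_affine:
  fixes f :: "'a::euclidean_space \<Rightarrow> ennreal"
  assumes [measurable]: "f \<in> borel_measurable borel" and c: "c \<noteq> 0"
  shows "(\<integral>\<^sup>+x. f x \<partial>lborel) = ennreal (\<bar>c\<bar> ^ DIM('a)) * (\<integral>\<^sup>+x. f (t + c *\<^sub>R x) \<partial>lborel)"
  by (subst lborel_euclidean_affine[OF c, of t])
     (simp add: nn_integral_density nn_integral_distr nn_integral_cmult)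

lemma integral_euclidean_affine:
  fixes f :: "'a::euclidean_space \<Rightarrow> 'b::{banach, second_countable_topology}"
  assumes [measurable]: "f \<in> borel_measurable borel" and c: "c \<noteq> 0"
  shows "(\<integral>x. f x \<partial>lborel) = (\<bar>c\<bar> ^ DIM('a)) *\<^sub>R (\<integral>x. f (t + c *\<^sub>R x) \<partial>lborel)"
  by (subst lborel_euclidean_affine[OF c, of t])
     (simp add: integral_density integral_distr)

lemma integrable_euclidean_affine:
  fixes f :: "'a::euclidean_space \<Rightarrow> 'b::{banach, second_countable_topology}"
  assumes f: "integrable lborel f" and c: "c \<noteq> 0"
  shows "integrable lborel (\<lambda>x. f (t + c *\<^sub>R x))"
proof -
  have [measurable]: "f \<in> borel_measurable borel" using f by auto
  show ?thesis
    using f c nn_integral_euclidean_affine[of "\<lambda>x. ennreal (norm (f x))" c t]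
    by (auto simp: integrable_iff_bounded ennreal_mult_less_top)
qed

lemma nn_integral_reflect:
  fixes f :: "'a::euclidean_space \<Rightarrow> ennreal"
  assumes "f \<in> borel_measurable borel"
  shows "(\<integral>\<^sup>+y. f (x - y) \<partial>lborel) = (\<integral>\<^sup>+y. f y \<partial>lborel)"
  using nn_integral_euclidean_affine[OF assms, of "-1" x] by simp

lemma nn_integral_shift:
  fixes f :: "'a::euclidean_space \<Rightarrow> ennreal"
  assumes "f \<in> borel_measurable borel"
  shows "(\<integral>\<^sup>+y. f (y - x) \<partial>lborel) = (\<integral>\<^sup>+y. f y \<partial>lborel)"
  using nn_integral_euclidean_affine[OF assms, of "1" "-x"] by simp

lemma integral_reflect:
  fixes f :: "'a::euclidean_space \<Rightarrow> 'b::{banach, second_countable_topology}"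
  assumes "f \<in> borel_measurable borel"
  shows "(\<integral>y. f (x - y) \<partial>lborel) = (\<integral>y. f y \<partial>lborel)"
  using integral_euclidean_affine[OF assms, of "-1" x] by simp

lemma integrable_lborel_pairI:
  fixes F :: "'a::euclidean_space \<Rightarrow> 'b::euclidean_space \<Rightarrow> 'c::{banach, second_countable_topology}"
  assumes [measurable]: "case_prod F \<in> borel_measurable (lborel \<Otimes>\<^sub>M lborel)"
    and fin: "(\<integral>\<^sup>+x. \<integral>\<^sup>+y. norm (F x y) \<partial>lborel \<partial>lborel) < \<infinity>"
  shows "integrable (lborel \<Otimes>\<^sub>M lborel) (case_prod F)"
proof (rule integrableI_bounded)
  have "(\<integral>\<^sup>+p. norm (case_prod F p) \<partial>(lborel \<Otimes>\<^sub>M lborel))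
    = (\<integral>\<^sup>+x. \<integral>\<^sup>+y. norm (case_prod F (x, y)) \<partial>lborel \<partial>lborel)"
    by (rule lborel.nn_integral_fst[symmetric]) measurable
  with fin show "(\<integral>\<^sup>+p. norm (case_prod F p) \<partial>(lborel \<Otimes>\<^sub>M lborel)) < \<infinity>" by simp
qed simp

text \<open>\<open>lborel_eq\<close> presents the measure as the image of a product of real lines,
  where integrals of products of one-variable functions factorize. This reduces Gaussian integrals
  to dimension one.\<close>

lemma
  fixes g :: "'a::euclidean_space \<Rightarrow> real \<Rightarrow> complex"
  assumes g: "\<And>b. b \<in> Basis \<Longrightarrow> integrable lborel (g b)"
  shows integral_lborel_prod:
      "(\<integral>x. (\<Prod>b\<in>Basis. g b (x \<bullet> b)) \<partial>lborel) = (\<Prod>b\<in>Basis. \<integral>t. g b t \<partial>lborel)"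
    and integrable_lborel_prod: "integrable lborel (\<lambda>x. \<Prod>b\<in>Basis. g b (x \<bullet> b))"
proof -
  have [measurable]: "\<And>b. b \<in> Basis \<Longrightarrow> g b \<in> borel_measurable borel"
    using g by auto
  interpret product_sigma_finite "\<lambda>b::'a. lborel :: real measure" ..
  have eq: "(\<Prod>b\<in>Basis. g b ((\<Sum>c\<in>Basis. f c *\<^sub>R c) \<bullet> b)) = (\<Prod>b\<in>Basis. g b (f b))" for f :: "'a \<Rightarrow> real"
    by (rule prod.cong) auto
  have *: "(\<lambda>f. \<Sum>b\<in>Basis. f b *\<^sub>R b) \<in> (\<Pi>\<^sub>M b\<in>(Basis::'a set). (lborel::real measure)) \<rightarrow>\<^sub>M borel"
    by measurable
  have m: "(\<lambda>x::'a. \<Prod>b\<in>Basis. g b (x \<bullet> b)) \<in> borel_measurable borel" by measurable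
  show "(\<integral>x. (\<Prod>b\<in>Basis. g b (x \<bullet> b)) \<partial>lborel) = (\<Prod>b\<in>Basis. \<integral>t. g b t \<partial>lborel)"
    by (subst lborel_eq, subst integral_distr[OF * m], unfold eq,
        rule product_integral_prod[OF finite_Basis g])
  show "integrable lborel (\<lambda>x. \<Prod>b\<in>Basis. g b (x \<bullet> b))"
    by (subst lborel_eq, subst integrable_distr_eq[OF * m], unfold eq,
        rule product_integrable_prod[OF finite_Basis g])
qed

text \<open>Read off from the characteristic function of the standard normal distribution: with
  \<open>c = sqrt (2 * s)\<close> the substitution x = c t turns exp(-x^2/2) into exp(-s
  t^2).\<close>

lemma exp_sq_fourier_real:
  fixes s k :: real
  assumes "s > 0"
  shows "integrable lborel (\<lambda>t. exp (\<i> * of_real (t * k)) * of_real (exp (- s * t\<^sup>2)))"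
    and "(\<integral>t. exp (\<i> * of_real (t * k)) * of_real (exp (- s * t\<^sup>2)) \<partial>lborel)
      = of_real (sqrt (pi / s) * exp (- k\<^sup>2 / (4 * s)))"
proof -
  define c where "c = sqrt (2 * s)"
  have c: "c > 0" "c\<^sup>2 = 2 * s" using assms by (auto simp: c_def)
  let ?g = "\<lambda>x. std_normal_density x *\<^sub>R iexp (k / c * x)"
  have ig: "integrable lborel ?g"
  proof (rule Bochner_Integration.integrable_bound)
    show "integrable lborel std_normal_density" by simp
  qed auto
  have "(\<integral>x. ?g x \<partial>lborel) = char std_normal_distribution (k / c)"
    unfolding char_def by (subst integral_density) auto
  also have "\<dots> = of_real (exp (- (k / c)\<^sup>2 / 2))"
    by (simp add: char_std_normal_distribution)
  finally have I: "(\<integral>x. ?g x \<partial>lborel) = of_real (exp (- k\<^sup>2 / (4 * s)))"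
    using c by (simp add: power_divide)
  have eq: "exp (\<i> * of_real (t * k)) * of_real (exp (- s * t\<^sup>2)) = of_real (sqrt (2 * pi)) * ?g (0 + c * t)" for t
    using c by (simp add: std_normal_density_def power_mult_distrib scaleR_conv_of_real mult_ac)
  have "has_bochner_integral lborel (\<lambda>t. ?g (0 + c * t)) ((\<integral>x. ?g x \<partial>lborel) /\<^sub>R \<bar>c\<bar>)"
    using ig c by (intro lborel_has_bochner_integral_real_affine_iff[THEN iffD1])
      (auto simp: has_bochner_integral_iff)
  then have "has_bochner_integral lborel (\<lambda>t. of_real (sqrt (2 * pi)) * ?g (0 + c * t))
     (of_real (sqrt (2 * pi)) * ((\<integral>x. ?g x \<partial>lborel) /\<^sub>R \<bar>c\<bar>))"
    by (intro has_bochner_integral_mult_right) auto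
  moreover have "of_real (sqrt (2 * pi)) * ((\<integral>x. ?g x \<partial>lborel) /\<^sub>R \<bar>c\<bar>)
     = (of_real (sqrt (pi / s) * exp (- k\<^sup>2 / (4 * s))) :: complex)"
    using c assms unfolding I
    by (simp add: c_def real_sqrt_mult real_sqrt_divide scaleR_conv_of_real field_simps)
  ultimately show "integrable lborel (\<lambda>t. exp (\<i> * of_real (t * k)) * of_real (exp (- s * t\<^sup>2)))"
    and "(\<integral>t. exp (\<i> * of_real (t * k)) * of_real (exp (- s * t\<^sup>2)) \<partial>lborel)
      = of_real (sqrt (pi / s) * exp (- k\<^sup>2 / (4 * s)))"
    unfolding eq has_bochner_integral_iff by auto
qed

section \<open>The heat kernel and its Fourier transform\<close>

definition heat_kernel :: "real \<Rightarrow> 'a::euclidean_space \<Rightarrow> real" where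
  "heat_kernel s x = (4 * pi * s) powr (- real DIM('a) / 2) * exp (- (norm x)\<^sup>2 / (4 * s))"

lemma heat_kernel_nonneg: "heat_kernel s x \<ge> 0"
  by (simp add: heat_kernel_def)

lemma heat_kernel_measurable [measurable]:
  "(\<lambda>(s, x). heat_kernel s (x::'a::euclidean_space)) \<in> borel_measurable (borel \<Otimes>\<^sub>M borel)"
  unfolding heat_kernel_def by measurable

lemma
  fixes x :: "'a::euclidean_space"
  assumes "s > 0"
  shows exp_sq_fourier_integrable:
      "integrable lborel (\<lambda>\<xi>. exp (\<i> * of_real (x \<bullet> \<xi>)) * of_real (exp (- s * (norm \<xi>)\<^sup>2)))"
    and exp_sq_fourier:
      "(\<integral>\<xi>. exp (\<i> * of_real (x \<bullet> \<xi>)) * of_real (exp (- s * (norm \<xi>)\<^sup>2)) \<partial>lborel)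
        = of_real ((2 * pi) ^ DIM('a) * heat_kernel s x)"
proof -
  let ?g = "\<lambda>b t. exp (\<i> * of_real (t * (x \<bullet> b))) * of_real (exp (- s * t\<^sup>2)) :: complex"
  have eq: "(\<Prod>b\<in>Basis. ?g b (\<xi> \<bullet> b)) = exp (\<i> * of_real (x \<bullet> \<xi>)) * of_real (exp (- s * (norm \<xi>)\<^sup>2))" for \<xi>
    unfolding power2_norm_eq_inner
    by (simp add: prod.distrib euclidean_inner[of x \<xi>] euclidean_inner[of \<xi> \<xi>] sum_distrib_left
        power2_eq_square mult_ac flip: exp_sum exp_of_real)
  have P: "(sqrt (pi / s)) ^ DIM('a) = (2 * pi) ^ DIM('a) * (4 * pi * s) powr (- real DIM('a) / 2)"
  proof -
    have "sqrt (pi / s) = 2 * pi * (4 * pi * s) powr (-1/2)"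
      using assms by (simp add: powr_minus powr_half_sqrt real_sqrt_divide real_sqrt_mult field_simps)
    moreover have "((4 * pi * s) powr (-1/2)) ^ DIM('a) = (4 * pi * s) powr (- real DIM('a) / 2)"
      using assms by (simp add: powr_powr flip: powr_realpow)
    ultimately show ?thesis by (simp add: power_mult_distrib)
  qed
  have Q: "(\<Prod>b\<in>Basis. sqrt (pi / s) * exp (- (x \<bullet> b)\<^sup>2 / (4 * s)))
     = (2 * pi) ^ DIM('a) * heat_kernel s x"
  proof -
    have "(\<Prod>b\<in>Basis. exp (- (x \<bullet> b)\<^sup>2 / (4 * s))) = exp (- (norm x)\<^sup>2 / (4 * s))"
      unfolding power2_norm_eq_inner euclidean_inner[of x x]
      by (simp add: power2_eq_square sum_divide_distrib sum_negf flip: exp_sum)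
    then show ?thesis by (simp add: prod.distrib P heat_kernel_def)
  qed
  show "integrable lborel (\<lambda>\<xi>. exp (\<i> * of_real (x \<bullet> \<xi>)) * of_real (exp (- s * (norm \<xi>)\<^sup>2)))"
    using integrable_lborel_prod[of ?g] exp_sq_fourier_real[OF assms] unfolding eq by simp
  show "(\<integral>\<xi>. exp (\<i> * of_real (x \<bullet> \<xi>)) * of_real (exp (- s * (norm \<xi>)\<^sup>2)) \<partial>lborel)
        = of_real ((2 * pi) ^ DIM('a) * heat_kernel s x)"
    using integral_lborel_prod[of ?g] exp_sq_fourier_real[OF assms]
    unfolding eq Q[symmetric] of_real_prod by simp
qed

lemma
  fixes \<xi> :: "'a::euclidean_space"
  assumes s: "s > 0"
  shows heat_kernel_fourier:
    "(\<integral>x. exp (\<i> * of_real (\<xi> \<bullet> x)) * of_real (heat_kernel s x) \<partial>lborel) = of_real (exp (- s * (norm \<xi>)\<^sup>2))"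
   and heat_kernel_integrable: "integrable lborel (heat_kernel s :: 'a \<Rightarrow> real)"
   and heat_kernel_integral: "(\<integral>x. heat_kernel s (x::'a) \<partial>lborel) = 1"
proof -
  \<comment> \<open>Gaussians are self-dual: \<open>heat_kernel s\<close> is a multiple of exp(-r
    |x|^2), so \<open>exp_sq_fourier\<close> applies with \<open>r\<close> in place of
    \<open>s\<close>, and only the constants have to be matched.\<close>
  define r where "r = 1 / (4 * s)"
  have r: "r > 0" using s by (simp add: r_def)
  define C where "C = (4 * pi * s) powr (- real DIM('a) / 2)"
  have e: "exp (\<i> * of_real (\<xi> \<bullet> x)) * of_real (heat_kernel s x)
     = of_real C * (exp (\<i> * of_real (\<xi> \<bullet> x)) * of_real (exp (- r * (norm x)\<^sup>2)))" for x \<xi> :: 'a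
    by (simp add: heat_kernel_def C_def r_def)
  have C: "C * ((2 * pi) ^ DIM('a) * heat_kernel r \<xi>) = exp (- s * (norm \<xi>)\<^sup>2)" for \<xi> :: 'a
  proof -
    have "(4 * pi * s) powr (- real DIM('a) / 2) * (4 * pi * r) powr (- real DIM('a) / 2)
        = (4 * pi * s * (4 * pi * r)) powr (- real DIM('a) / 2)"
      using s r by (subst powr_mult) auto
    also have "4 * pi * s * (4 * pi * r) = (2 * pi) powr 2"
      using s by (simp add: r_def power2_eq_square)
    also have "((2 * pi) powr 2) powr (- real DIM('a) / 2) = inverse ((2 * pi) ^ DIM('a))"
      unfolding powr_powr by (simp add: powr_minus powr_realpow del: powr_numeral)
    finally have "C * (4 * pi * r) powr (- real DIM('a) / 2) * (2 * pi) ^ DIM('a) = 1"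
      by (simp add: C_def field_simps)
    moreover have "- (norm \<xi>)\<^sup>2 / (4 * r) = - s * (norm \<xi>)\<^sup>2" using s by (simp add: r_def)
    ultimately show ?thesis by (simp add: heat_kernel_def mult_ac)
  qed
  have F: "(\<integral>x. exp (\<i> * of_real (\<xi> \<bullet> x)) * of_real (heat_kernel s x) \<partial>lborel) = of_real (exp (- s * (norm \<xi>)\<^sup>2))"
    for \<xi> :: 'a
    unfolding e using exp_sq_fourier[OF r, of \<xi>] C[of \<xi>]
    by (subst integral_mult_right_zero) (simp only: of_real_mult[symmetric])
  show "(\<integral>x. exp (\<i> * of_real (\<xi> \<bullet> x)) * of_real (heat_kernel s x) \<partial>lborel) = of_real (exp (- s * (norm \<xi>)\<^sup>2))"
    by (rule F)
  have "integrable lborel (\<lambda>x. of_real C * (exp (\<i> * of_real (0 \<bullet> x)) * of_real (exp (- r * (norm (x::'a))\<^sup>2))))"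
    using exp_sq_fourier_integrable[OF r, of 0] by (intro integrable_mult_right) auto
  then have "integrable lborel (\<lambda>x::'a. complex_of_real (heat_kernel s x))"
    unfolding e[symmetric] by simp
  then show I: "integrable lborel (heat_kernel s :: 'a \<Rightarrow> real)"
    using complex_of_real_integrable_eq by blast
  show "(\<integral>x. heat_kernel s (x::'a) \<partial>lborel) = 1"
    using F[of 0] by simp
qed

section \<open>Symbols of fractional powers as Laplace transforms\<close>

text \<open>By \<open>gbinomial_asymptotic\<close> the coefficients are O(n^(-a-1)), which is
  summable for a > 0. At a = 0 this rate would not suffice, but then the series has a single nonzero
  term.\<close>

lemma gbinomial_abs_summable:
  fixes a :: real
  assumes "a \<ge> 0"
  shows "summable (\<lambda>j. \<bar>a gchoose j\<bar>)"
proof (cases "a = 0")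
  case True
  then show ?thesis
    by (intro summable_finite[of "{0}"]) (auto simp: gbinomial_0_left)
next
  case False
  with assms have a: "a > 0" by simp
  let ?q = "\<lambda>n. (a gchoose n) / ((-1)^n / exp ((a+1) * of_real (ln (real n))))"
  have "Bseq ?q"
    using gbinomial_asymptotic[of a] convergent_imp_Bseq convergentI by blast
  then obtain K where K: "\<And>n. norm (?q n) \<le> K" by (auto simp: Bseq_def)
  have "\<bar>a gchoose n\<bar> \<le> K * real n powr (- (a + 1))" if "n > 0" for n
  proof -
    have "norm (?q n) = \<bar>a gchoose n\<bar> * real n powr (a + 1)"
      using that by (simp add: abs_mult powr_def power_abs)
    with K[of n] have "\<bar>a gchoose n\<bar> * real n powr (a + 1) \<le> K" by simp
    then have "\<bar>a gchoose n\<bar> \<le> K / real n powr (a + 1)"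
      using that by (simp add: pos_le_divide_eq)
    then show ?thesis by (simp only: powr_minus divide_inverse)
  qed
  moreover have "summable (\<lambda>n. K * real n powr (- (a + 1)))"
    using a by (intro summable_mult) (simp add: summable_real_powr_iff)
  ultimately show ?thesis
    using summable_comparison_test'[of "\<lambda>n. K * real n powr (- (a + 1))" 1 "\<lambda>j. \<bar>a gchoose j\<bar>"]
    by (simp only: real_norm_def abs_idempotent Suc_le_eq One_nat_def)
qed

text \<open>The density of the Gamma distribution with shape \<open>s\<close> and rate 1. Its
  Laplace transform (1 + l)^(-s) makes it the building block for symbols in l = |\<xi>|^2.\<close>

definition gamma_weight :: "real \<Rightarrow> real \<Rightarrow> real" where
  "gamma_weight s t = (if t > 0 then t powr (s - 1) * exp (- t) / Gamma s else 0)"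

lemma gamma_weight_nonneg: "s > 0 \<Longrightarrow> gamma_weight s t \<ge> 0"
  using Gamma_real_pos[of s] by (auto simp: gamma_weight_def)

lemma gamma_weight_measurable [measurable]: "gamma_weight s \<in> borel_measurable borel"
  unfolding gamma_weight_def[abs_def] by measurable

lemma nn_integral_gamma_weight:
  assumes s: "s > 0" and l: "l \<ge> 0"
  shows "(\<integral>\<^sup>+t. ennreal (gamma_weight s t * exp (- l * t)) \<partial>lborel) = ennreal ((1 + l) powr (- s))"
proof -
  define c where "c = 1 + l"
  have c: "c > 0" using l by (simp add: c_def)
  have G: "Gamma s > 0" using s by (rule Gamma_real_pos)
  let ?f = "\<lambda>t. ennreal (indicator {0..} t * t powr (s - 1) / exp t)"
  have "ennreal (Gamma s) = (\<integral>\<^sup>+t. ?f t \<partial>lborel)"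
    using Gamma_conv_nn_integral_real[OF s] by simp
  also have "\<dots> = ennreal c * (\<integral>\<^sup>+t. ?f (0 + c * t) \<partial>lborel)"
    using c by (subst nn_integral_real_affine[of _ c 0]) auto
  also have "(\<integral>\<^sup>+t. ?f (0 + c * t) \<partial>lborel)
      = (\<integral>\<^sup>+t. ennreal (c powr (s - 1) * Gamma s) * ennreal (gamma_weight s t * exp (- l * t)) \<partial>lborel)"
  proof (intro nn_integral_cong)
    fix t :: real
    consider "t < 0" | "t = 0" | "t > 0" by linarith
    then show "?f (0 + c * t) = ennreal (c powr (s - 1) * Gamma s) * ennreal (gamma_weight s t * exp (- l * t))"
    proof cases
      case 1
      then have "c * t < 0" using c by (simp add: mult_pos_neg)
      then show ?thesis using 1 by (simp add: gamma_weight_def)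
    next
      case 3
      have "exp (- t) * exp (- l * t) = inverse (exp (c * t))"
        unfolding exp_add[symmetric] exp_minus[symmetric] by (simp add: c_def distrib_right)
      then have "indicator {0..} (0 + c * t) * (0 + c * t) powr (s - 1) / exp (0 + c * t)
          = (c powr (s - 1) * t powr (s - 1)) * (exp (- t) * exp (- l * t))"
        using 3 c by (simp only: divide_inverse) (simp add: powr_mult)
      also have "\<dots> = c powr (s - 1) * Gamma s * (gamma_weight s t * exp (- l * t))"
      proof -
        have *: "u * v * (e * e') = u * \<Gamma> * (v * e / \<Gamma> * e')" if "\<Gamma> > 0" for u v e e' \<Gamma> :: real
          using that by (simp add: field_simps)
        show ?thesis
          using *[OF G, of "c powr (s - 1)" "t powr (s - 1)" "exp (- t)" "exp (- l * t)"] 3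
          by (simp only: gamma_weight_def if_True)
      qed
      finally have "indicator {0..} (0 + c * t) * (0 + c * t) powr (s - 1) / exp (0 + c * t)
          = c powr (s - 1) * Gamma s * (gamma_weight s t * exp (- l * t))" .
      then show ?thesis using G 3 by (simp add: ennreal_mult')
    qed (simp add: gamma_weight_def)
  qed
  also have "\<dots> = ennreal (c powr (s - 1) * Gamma s) * (\<integral>\<^sup>+t. ennreal (gamma_weight s t * exp (- l * t)) \<partial>lborel)"
    by (intro nn_integral_cmult) measurable
  also have "ennreal c * \<dots> = ennreal (c powr s * Gamma s) * (\<integral>\<^sup>+t. ennreal (gamma_weight s t * exp (- l * t)) \<partial>lborel)"
  proof -
    have "c * (c powr (s - 1) * Gamma s) = c powr s * Gamma s" using c by (simp add: powr_diff)
    then have "ennreal c * ennreal (c powr (s - 1) * Gamma s) = ennreal (c powr s * Gamma s)"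
      by (metis c ennreal_mult' less_imp_le)
    then show ?thesis by (simp only: mult.assoc[symmetric])
  qed
  finally have *: "ennreal (Gamma s) = ennreal (c powr s * Gamma s) * (\<integral>\<^sup>+t. ennreal (gamma_weight s t * exp (- l * t)) \<partial>lborel)" .
  define I where "I = (\<integral>\<^sup>+t. ennreal (gamma_weight s t * exp (- l * t)) \<partial>lborel)"
  \<comment> \<open>In \<open>ennreal\<close> the factor in front of \<open>I\<close> can be divided
    out only once \<open>I\<close> is known to be finite.\<close>
  have "I \<noteq> \<infinity>"
    using * c G unfolding I_def[symmetric] by (auto simp: ennreal_mult_top)
  then obtain r where r: "r \<ge> 0" "I = ennreal r" by (cases I) auto
  have "ennreal (Gamma s) = ennreal (c powr s * Gamma s * r)"
    using * c G r unfolding I_def[symmetric] by (simp add: ennreal_mult)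
  then have "Gamma s = c powr s * Gamma s * r"
    using c G r by (subst (asm) ennreal_inj) auto
  then have "r = c powr (- s)" using G c by (simp add: powr_minus field_simps)
  then show ?thesis using r by (simp add: I_def c_def)
qed

lemma
  assumes s: "s > 0" and l: "l \<ge> 0"
  shows gamma_weight_integrable: "integrable lborel (\<lambda>t. gamma_weight s t * exp (- l * t))"
    and gamma_weight_laplace: "(\<integral>t. gamma_weight s t * exp (- l * t) \<partial>lborel) = (1 + l) powr (- s)"
proof -
  show I: "integrable lborel (\<lambda>t. gamma_weight s t * exp (- l * t))"
    using nn_integral_gamma_weight[OF assms] gamma_weight_nonneg[OF s]
    by (intro integrableI_nonneg) auto
  show "(\<integral>t. gamma_weight s t * exp (- l * t) \<partial>lborel) = (1 + l) powr (- s)"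
    using nn_integral_gamma_weight[OF assms] gamma_weight_nonneg[OF s]
    by (intro integral_eq_nn_integral[THEN trans]) auto
qed

text \<open>The symbol is expanded as
  \<open>l powr a * (1 + l) powr (-M) = (1 + l) powr (a - M) * (1 - 1 / (1 + l)) powr a\<close>; the binomial series has absolutely summable
  coefficients up to the boundary of the unit disc, and each term is the Laplace transform of a
  Gamma density.\<close>

lemma symbol_laplace_weight:
  fixes a M :: real
  assumes a: "0 \<le> a" "a < M"
  obtains w where "integrable lborel w" "\<And>t. t \<le> 0 \<Longrightarrow> w t = 0"
    "\<And>l. l > 0 \<Longrightarrow> (\<integral>t. w t * exp (- l * t) \<partial>lborel) = l powr a * (1 + l) powr (- M)"
proof -
  define c where "c j = (a gchoose j) * (- 1) ^ j" for j
  define g where "g j = gamma_weight (M - a + real j)" for j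
  define w where "w t = (\<Sum>j. c j * g j t)" for t
  have pos: "M - a + real j > 0" for j using a by simp
  have g0: "g j t \<ge> 0" for j t unfolding g_def by (rule gamma_weight_nonneg[OF pos])
  have [measurable]: "g j \<in> borel_measurable borel" for j by (simp add: g_def)
  have csum: "summable (\<lambda>j. \<bar>c j\<bar>)"
    using gbinomial_abs_summable[OF a(1)] by (simp add: c_def abs_mult power_abs)
  have gI: "(\<integral>t. g j t * exp (- l * t) \<partial>lborel) = (1 + l) powr (- (M - a + real j))" 
    "integrable lborel (\<lambda>t. g j t * exp (- l * t))" if "l \<ge> 0" for j l
    unfolding g_def using gamma_weight_laplace[OF pos that] gamma_weight_integrable[OF pos that] by auto
  \<comment> \<open>Each \<open>g j\<close> has mass 1 and the \<open>c j\<close> are absolutely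
    summable, so the sum of the |c j| g j has a finite integral and hence is finite almost
    everywhere. At exceptional points \<open>w\<close> has whatever value \<open>suminf\<close>
    assigns to a divergent series.\<close>
  have AEs: "AE t in lborel. summable (\<lambda>j. \<bar>c j\<bar> * g j t)"
  proof -
    have "(\<integral>\<^sup>+t. (\<Sum>j. ennreal (\<bar>c j\<bar> * g j t)) \<partial>lborel) = (\<Sum>j. \<integral>\<^sup>+t. ennreal (\<bar>c j\<bar> * g j t) \<partial>lborel)"
      by (intro nn_integral_suminf) measurable
    also have "\<dots> = (\<Sum>j. ennreal \<bar>c j\<bar>)"
    proof (intro suminf_cong)
      fix j
      have "(\<integral>\<^sup>+t. ennreal (\<bar>c j\<bar> * g j t) \<partial>lborel) = ennreal \<bar>c j\<bar> * (\<integral>\<^sup>+t. ennreal (g j t) \<partial>lborel)"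
        by (simp add: ennreal_mult' nn_integral_cmult)
      then show "(\<integral>\<^sup>+t. ennreal (\<bar>c j\<bar> * g j t) \<partial>lborel) = ennreal \<bar>c j\<bar>"
        using nn_integral_gamma_weight[OF pos[of j], of 0] by (simp add: g_def)
    qed
    also have "\<dots> \<noteq> \<infinity>"
      using csum by (simp add: ennreal_suminf_neq_top)
    finally have "AE t in lborel. (\<Sum>j. ennreal (\<bar>c j\<bar> * g j t)) \<noteq> \<infinity>"
      by (intro nn_integral_noteq_infinite) auto
    then show ?thesis
      by eventually_elim (intro summable_suminf_not_top, use g0 in auto)
  qed
  have key: "integrable lborel (\<lambda>t. \<Sum>j. c j * (g j t * exp (- l * t)))"
    "(\<integral>t. (\<Sum>j. c j * (g j t * exp (- l * t))) \<partial>lborel) = (\<Sum>j. c j * (1 + l) powr (- (M - a + real j)))"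
    if l: "l \<ge> 0" for l
  proof -
    have i: "integrable lborel (\<lambda>t. c j * (g j t * exp (- l * t)))" for j
      using gI(2)[OF l] by (intro integrable_mult_right) auto
    have s1: "AE t in lborel. summable (\<lambda>j. norm (c j * (g j t * exp (- l * t))))"
      using AEs
    proof eventually_elim
      fix t assume "summable (\<lambda>j. \<bar>c j\<bar> * g j t)"
      from summable_mult2[OF this, of "exp (- l * t)"]
      show "summable (\<lambda>j. norm (c j * (g j t * exp (- l * t))))"
        using g0 by (simp add: abs_mult mult.assoc)
    qed
    have s2: "summable (\<lambda>j. \<integral>t. norm (c j * (g j t * exp (- l * t))) \<partial>lborel)"
    proof (rule summable_comparison_test'[where N=0 and g="\<lambda>j. \<bar>c j\<bar>"])
      fix j
      have "(\<integral>t. norm (c j * (g j t * exp (- l * t))) \<partial>lborel) = \<bar>c j\<bar> * (1 + l) powr (- (M - a + real j))"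
        using g0 gI(1)[OF l, of j] by (simp add: abs_mult)
      moreover have "(1 + l) powr (- (M - a + real j)) \<le> 1"
        unfolding powr_minus using ge_one_powr_ge_zero[of "1 + l" "M - a + real j"] l pos[of j]
        by (intro inverse_le_1_iff[THEN iffD2]) auto
      ultimately have "\<bar>\<integral>t. norm (c j * (g j t * exp (- l * t))) \<partial>lborel\<bar> \<le> \<bar>c j\<bar> * 1"
        by (simp only: abs_mult abs_idempotent abs_of_nonneg[OF powr_ge_zero]) (intro mult_left_mono, auto)
      then show "norm (\<integral>t. norm (c j * (g j t * exp (- l * t))) \<partial>lborel) \<le> \<bar>c j\<bar>"
        by (simp only: real_norm_def mult_1_right)
    qed (fact csum)
    show "integrable lborel (\<lambda>t. \<Sum>j. c j * (g j t * exp (- l * t)))"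
      by (rule integrable_suminf[OF i s1 s2])
    show "(\<integral>t. (\<Sum>j. c j * (g j t * exp (- l * t))) \<partial>lborel) = (\<Sum>j. c j * (1 + l) powr (- (M - a + real j)))"
      using integral_suminf[OF i s1 s2] gI(1)[OF l] by simp
  qed
  have [measurable]: "w \<in> borel_measurable borel"
    unfolding w_def[abs_def] by measurable
  show thesis
  proof (rule that)
    show "integrable lborel w" using key(1)[of 0] by (simp add: w_def[abs_def])
    have "g j t = 0" if "t \<le> 0" for j t using that by (simp add: g_def gamma_weight_def)
    then show "w t = 0" if "t \<le> 0" for t
      unfolding w_def using that by (simp only: mult_zero_right suminf_zero)
    fix l :: real assume l: "l > 0"
    have "(\<integral>t. w t * exp (- l * t) \<partial>lborel) = (\<integral>t. (\<Sum>j. c j * (g j t * exp (- l * t))) \<partial>lborel)"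
    proof (rule integral_cong_AE)
      show "AE t in lborel. w t * exp (- l * t) = (\<Sum>j. c j * (g j t * exp (- l * t)))"
        using AEs
      proof eventually_elim
        fix t assume *: "summable (\<lambda>j. \<bar>c j\<bar> * g j t)"
        have "summable (\<lambda>j. \<bar>c j * g j t\<bar>)"
          unfolding abs_mult abs_of_nonneg[OF g0] by (rule *)
        then have s: "summable (\<lambda>j. c j * g j t)"
          by (rule summable_rabs_cancel)
        show "w t * exp (- l * t) = (\<Sum>j. c j * (g j t * exp (- l * t)))"
          unfolding w_def suminf_mult2[OF s] mult.assoc ..
      qed
    qed measurable
    also have "\<dots> = (\<Sum>j. c j * (1 + l) powr (- (M - a + real j)))"
      using key(2)[of l] l by simp
    also have "\<dots> = (\<Sum>j. (1 + l) powr (- (M - a)) * ((a gchoose j) * (- 1 / (1 + l)) ^ j))"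
    proof (intro suminf_cong)
      fix j
      have "(1 + l) powr (- (M - a + real j)) = (1 + l) powr (- (M - a)) * inverse ((1 + l) ^ j)"
      proof -
        have "(1 + l) powr (- (M - a + real j)) = (1 + l) powr (- (M - a)) * (1 + l) powr (- real j)"
          unfolding powr_add[symmetric] by simp
        also have "(1 + l) powr (- real j) = inverse ((1 + l) ^ j)"
          unfolding powr_minus using l by (subst powr_realpow) auto
        finally show ?thesis .
      qed
      moreover have "(- 1 / (1 + l)) ^ j = (- 1) ^ j * inverse ((1 + l) ^ j)"
        by (simp only: divide_inverse power_mult_distrib power_inverse)
      ultimately show "c j * (1 + l) powr (- (M - a + real j))
          = (1 + l) powr (- (M - a)) * ((a gchoose j) * (- 1 / (1 + l)) ^ j)"
        by (simp only: c_def mult_ac)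
    qed
    also have "\<dots> = (1 + l) powr (- (M - a)) * (1 + - 1 / (1 + l)) powr a"
    proof -
      have "(\<lambda>j. (a gchoose j) * (- 1 / (1 + l)) ^ j) sums (1 + - 1 / (1 + l)) powr a"
        using l by (intro gen_binomial_real) auto
      from sums_mult[OF this, of "(1 + l) powr (- (M - a))"] show ?thesis
        by (rule sums_unique[symmetric])
    qed
    also have "1 + - 1 / (1 + l) = l / (1 + l)" using l by (simp add: field_simps)
    also have "(1 + l) powr (- (M - a)) * (l / (1 + l)) powr a = l powr a * (1 + l) powr (- M)"
    proof -
      have "(1 + l) powr (- (M - a)) = (1 + l) powr a * (1 + l) powr (- M)"
        unfolding powr_add[symmetric] by simp
      moreover have "(l / (1 + l)) powr a = l powr a / (1 + l) powr a"
        by (rule powr_divide)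
      moreover have "x * y * (z / x) = z * y" if "x \<noteq> 0" for x y z :: real
        using that by simp
      moreover have "(1 + l) powr a \<noteq> 0" using l by simp
      ultimately show ?thesis by (simp only:)
    qed
    finally show "(\<integral>t. w t * exp (- l * t) \<partial>lborel) = l powr a * (1 + l) powr (- M)" .
  qed
qed

section \<open>Convolutions and Fourier transforms\<close>

definition convolve :: "('a::euclidean_space \<Rightarrow> real) \<Rightarrow> ('a \<Rightarrow> real) \<Rightarrow> 'a \<Rightarrow> real" where
  "convolve f g x = (\<integral>y. f (x - y) * g y \<partial>lborel)"

text \<open>The Fourier integral without the normalizing power of \<open>2 * pi\<close>, so that
  convolutions become plain products in \<open>ft_convolve\<close>.\<close>

definition ft :: "('a::euclidean_space \<Rightarrow> real) \<Rightarrow> 'a \<Rightarrow> complex" where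
  "ft f \<xi> = (\<integral>x. exp (- \<i> * of_real (x \<bullet> \<xi>)) * of_real (f x) \<partial>lborel)"

lemma fourier_of_real:
  "fourier (\<lambda>y. of_real (f y)) \<xi> = of_real ((2 * pi) powr (- real DIM('a) / 2)) * ft (f :: 'a::euclidean_space \<Rightarrow> real) \<xi>"
  by (simp add: fourier_def ft_def)

lemma norm_exp_i [simp]:
  "norm (exp (\<i> * complex_of_real r)) = 1" "norm (exp (- (\<i> * complex_of_real r))) = 1"
  by (simp_all add: norm_exp_eq_Re)

lemma ft_measurable [measurable]:
  fixes f :: "'a::euclidean_space \<Rightarrow> real"
  assumes [measurable]: "f \<in> borel_measurable borel"
  shows "ft f \<in> borel_measurable borel"
  unfolding ft_def[abs_def] by measurable

lemma convolve_measurable [measurable]: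
  fixes f g :: "'a::euclidean_space \<Rightarrow> real"
  assumes [measurable]: "f \<in> borel_measurable borel" "g \<in> borel_measurable borel"
  shows "convolve f g \<in> borel_measurable borel"
  unfolding convolve_def[abs_def] by measurable

lemma convolve_alt:
  fixes f g :: "'a::euclidean_space \<Rightarrow> real"
  assumes [measurable]: "f \<in> borel_measurable borel" "g \<in> borel_measurable borel"
  shows "convolve f g x = (\<integral>y. f y * g (x - y) \<partial>lborel)"
  using integral_reflect[of "\<lambda>y. f y * g (x - y)" x] by (simp add: convolve_def)

text \<open>The factor \<open>e\<close> leaves room for a phase: e = 1 gives the integrability of a
  convolution, and an exponential gives the Fubini step for its transform.\<close>

lemma convolve_pair_integrable:
  fixes f g :: "'a::euclidean_space \<Rightarrow> real" and e :: "'a \<Rightarrow> 'a \<Rightarrow> complex"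
  assumes f: "integrable lborel f" and g: "integrable lborel g"
    and [measurable]: "case_prod e \<in> borel_measurable (lborel \<Otimes>\<^sub>M lborel)" and e: "\<And>x y. norm (e x y) \<le> 1"
  shows "integrable (lborel \<Otimes>\<^sub>M lborel) (\<lambda>(y, x). e y x * of_real (f (x - y) * g y))"
proof (rule integrable_lborel_pairI)
  have [measurable]: "f \<in> borel_measurable borel" "g \<in> borel_measurable borel" using f g by auto
  show "(\<lambda>(y, x). e y x * of_real (f (x - y) * g y)) \<in> borel_measurable (lborel \<Otimes>\<^sub>M lborel)"
    by measurable
  have "(\<integral>\<^sup>+y. \<integral>\<^sup>+x. norm (e y x * of_real (f (x - y) * g y)) \<partial>lborel \<partial>lborel)
      \<le> (\<integral>\<^sup>+y. \<integral>\<^sup>+x. ennreal \<bar>g y\<bar> * ennreal \<bar>f (x - y)\<bar> \<partial>lborel \<partial>lborel)"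
  proof (intro nn_integral_mono)
    fix x y
    have "norm (e y x * of_real (f (x - y) * g y)) \<le> 1 * \<bar>f (x - y) * g y\<bar>"
      unfolding norm_mult norm_of_real by (intro mult_right_mono e) simp_all
    then show "ennreal (norm (e y x * of_real (f (x - y) * g y))) \<le> ennreal \<bar>g y\<bar> * ennreal \<bar>f (x - y)\<bar>"
      by (simp add: abs_mult mult.commute flip: ennreal_mult')
  qed
  also have "\<dots> = (\<integral>\<^sup>+y. ennreal \<bar>g y\<bar> * (\<integral>\<^sup>+x. ennreal \<bar>f x\<bar> \<partial>lborel) \<partial>lborel)"
  proof (intro nn_integral_cong)
    fix y :: 'a
    have "(\<integral>\<^sup>+x. ennreal \<bar>f (x - y)\<bar> \<partial>lborel) = (\<integral>\<^sup>+x. ennreal \<bar>f x\<bar> \<partial>lborel)"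
      by (rule nn_integral_shift) measurable
    then show "(\<integral>\<^sup>+x. ennreal \<bar>g y\<bar> * ennreal \<bar>f (x - y)\<bar> \<partial>lborel) = ennreal \<bar>g y\<bar> * (\<integral>\<^sup>+x. ennreal \<bar>f x\<bar> \<partial>lborel)"
      by (subst nn_integral_cmult) simp_all
  qed
  also have "\<dots> = (\<integral>\<^sup>+y. ennreal \<bar>g y\<bar> \<partial>lborel) * (\<integral>\<^sup>+x. ennreal \<bar>f x\<bar> \<partial>lborel)"
    by (simp add: nn_integral_multc)
  also have "\<dots> < \<infinity>"
    using f g by (auto simp: integrable_iff_bounded ennreal_mult_less_top)
  finally show "(\<integral>\<^sup>+y. \<integral>\<^sup>+x. norm (e y x * of_real (f (x - y) * g y)) \<partial>lborel \<partial>lborel) < \<infinity>" .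
qed

lemma convolve_integrable:
  fixes f g :: "'a::euclidean_space \<Rightarrow> real"
  assumes f: "integrable lborel f" and g: "integrable lborel g"
  shows "integrable lborel (convolve f g)"
proof -
  have "integrable (lborel \<Otimes>\<^sub>M lborel) (\<lambda>(y, x). 1 * complex_of_real (f (x - y) * g y))"
    using convolve_pair_integrable[OF f g, of "\<lambda>_ _. 1"] by simp
  from lborel_pair.integrable_snd[OF this]
  have "integrable lborel (\<lambda>x. complex_of_real (\<integral>y. f (x - y) * g y \<partial>lborel))"
    by (simp del: of_real_mult)
  then show ?thesis
    unfolding convolve_def[abs_def] using complex_of_real_integrable_eq by blast
qed

lemma ft_convolve:
  fixes f g :: "'a::euclidean_space \<Rightarrow> real"
  assumes f: "integrable lborel f" and g: "integrable lborel g"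
  shows "ft (convolve f g) \<xi> = ft f \<xi> * ft g \<xi>"
proof -
  have [measurable]: "f \<in> borel_measurable borel" "g \<in> borel_measurable borel" using f g by auto
  let ?e = "\<lambda>x. exp (- \<i> * complex_of_real (x \<bullet> \<xi>))"
  have "ft (convolve f g) \<xi> = (\<integral>x. \<integral>y. ?e x * of_real (f (x - y) * g y) \<partial>lborel \<partial>lborel)"
    unfolding ft_def convolve_def by (simp del: of_real_mult)
  also have "\<dots> = (\<integral>y. \<integral>x. ?e x * of_real (f (x - y) * g y) \<partial>lborel \<partial>lborel)"
    using convolve_pair_integrable[OF f g, of "\<lambda>y x. ?e x"]
    by (intro lborel_pair.Fubini_integral) simp
  also have "\<dots> = (\<integral>y. ft f \<xi> * (?e y * of_real (g y)) \<partial>lborel)"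
  proof (intro Bochner_Integration.integral_cong refl)
    fix y
    have "(\<integral>x. ?e x * of_real (f (x - y) * g y) \<partial>lborel)
      = (\<integral>x. ?e (y + 1 *\<^sub>R x) * of_real (f ((y + 1 *\<^sub>R x) - y) * g y) \<partial>lborel)"
      by (subst integral_euclidean_affine[of _ 1 y]) simp_all
    also have "\<dots> = (\<integral>x. (?e x * of_real (f x)) * (?e y * of_real (g y)) \<partial>lborel)"
      by (intro Bochner_Integration.integral_cong refl)
        (simp add: inner_add_left exp_add distrib_left exp_diff exp_minus divide_inverse mult_ac)
    also have "\<dots> = ft f \<xi> * (?e y * of_real (g y))"
      by (simp only: integral_mult_left_zero ft_def)
    finally show "(\<integral>x. ?e x * of_real (f (x - y) * g y) \<partial>lborel) = ft f \<xi> * (?e y * of_real (g y))" .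
  qed
  also have "\<dots> = ft f \<xi> * ft g \<xi>"
    by (simp only: integral_mult_right_zero ft_def)
  finally show ?thesis .
qed

text \<open>Fubini turns multiplication by an integrable symbol \<open>g\<close> on the Fourier side
  into convolution with the inverse transform of \<open>g\<close>. This is how the fractional
  Laplacian becomes a convolution operator acting on \<psi>.\<close>

lemma inverse_transform_mult_ft:
  fixes g :: "'a::euclidean_space \<Rightarrow> complex" and \<psi> :: "'a \<Rightarrow> real"
  assumes g: "integrable lborel g" and \<psi>: "integrable lborel \<psi>"
  shows "(\<integral>\<xi>. exp (\<i> * of_real (x \<bullet> \<xi>)) * (g \<xi> * ft \<psi> \<xi>) \<partial>lborel)
    = (\<integral>y. (\<integral>\<xi>. exp (\<i> * of_real ((x - y) \<bullet> \<xi>)) * g \<xi> \<partial>lborel) * of_real (\<psi> y) \<partial>lborel)"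
proof -
  have [measurable]: "g \<in> borel_measurable borel" "\<psi> \<in> borel_measurable borel" using g \<psi> by auto
  let ?F = "\<lambda>y \<xi>. exp (\<i> * of_real ((x - y) \<bullet> \<xi>)) * g \<xi> * complex_of_real (\<psi> y)"
  have I: "integrable (lborel \<Otimes>\<^sub>M lborel) (case_prod ?F)"
  proof (rule integrable_lborel_pairI)
    have "(\<integral>\<^sup>+y. \<integral>\<^sup>+\<xi>. ennreal (norm (?F y \<xi>)) \<partial>lborel \<partial>lborel)
       = (\<integral>\<^sup>+\<xi>. ennreal (norm (g \<xi>)) \<partial>lborel) * (\<integral>\<^sup>+y. ennreal \<bar>\<psi> y\<bar> \<partial>lborel)"
      by (simp add: norm_mult ennreal_mult' nn_integral_multc nn_integral_cmult)
    also have "\<dots> < \<infinity>"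
      using g \<psi> by (auto simp: integrable_iff_bounded ennreal_mult_less_top)
    finally show "(\<integral>\<^sup>+y. \<integral>\<^sup>+\<xi>. ennreal (norm (?F y \<xi>)) \<partial>lborel \<partial>lborel) < \<infinity>" .
  qed measurable
  have "(\<integral>\<xi>. exp (\<i> * of_real (x \<bullet> \<xi>)) * (g \<xi> * ft \<psi> \<xi>) \<partial>lborel) = (\<integral>\<xi>. \<integral>y. ?F y \<xi> \<partial>lborel \<partial>lborel)"
  proof (intro Bochner_Integration.integral_cong refl)
    fix \<xi>
    have "exp (\<i> * of_real (x \<bullet> \<xi>)) * (g \<xi> * ft \<psi> \<xi>)
      = (\<integral>y. exp (\<i> * of_real (x \<bullet> \<xi>)) * g \<xi> * (exp (- \<i> * of_real (y \<bullet> \<xi>)) * of_real (\<psi> y)) \<partial>lborel)"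
      unfolding ft_def by (simp only: integral_mult_right_zero mult.assoc)
    also have "\<dots> = (\<integral>y. ?F y \<xi> \<partial>lborel)"
      by (intro Bochner_Integration.integral_cong refl)
        (simp add: inner_diff_left right_diff_distrib exp_diff exp_minus divide_inverse mult_ac)
    finally show "exp (\<i> * of_real (x \<bullet> \<xi>)) * (g \<xi> * ft \<psi> \<xi>) = (\<integral>y. ?F y \<xi> \<partial>lborel)" .
  qed
  also have "\<dots> = (\<integral>y. \<integral>\<xi>. ?F y \<xi> \<partial>lborel \<partial>lborel)"
    by (rule lborel_pair.Fubini_integral[OF I])
  also have "\<dots> = (\<integral>y. (\<integral>\<xi>. exp (\<i> * of_real ((x - y) \<bullet> \<xi>)) * g \<xi> \<partial>lborel) * of_real (\<psi> y) \<partial>lborel)"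
    by (simp only: integral_mult_left_zero)
  finally show ?thesis .
qed

section \<open>Superpositions of heat kernels\<close>

text \<open>Its transform is exp(-s |\<xi>|^2) times the Laplace transform of \<open>w\<close> at
  |\<xi>|^2. The lemmas below let \<open>w\<close> vanish for t \<le> 0, so that
  \<open>heat_kernel\<close> is only evaluated at positive times where it counts.\<close>

definition heat_mix :: "(real \<Rightarrow> real) \<Rightarrow> real \<Rightarrow> 'a::euclidean_space \<Rightarrow> real" where
  "heat_mix w s x = (\<integral>t. w t * heat_kernel (s + t) x \<partial>lborel)"

lemma heat_kernel_nn_integral:
  "s > 0 \<Longrightarrow> (\<integral>\<^sup>+x. ennreal (heat_kernel s (x::'a::euclidean_space)) \<partial>lborel) = 1"
  using nn_integral_eq_integral[OF heat_kernel_integrable[of s, where 'a='a]]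
  by (simp add: heat_kernel_nonneg heat_kernel_integral)

text \<open>Every heat kernel has mass 1, so the double integral equals the L^1 norm of
  \<open>w\<close>, also for s = 0.\<close>

lemma heat_mix_pair_integrable:
  fixes w :: "real \<Rightarrow> real" and e :: "'a::euclidean_space \<Rightarrow> complex"
  assumes w: "integrable lborel w" "\<And>t. t \<le> 0 \<Longrightarrow> w t = 0" and s: "s \<ge> 0"
    and [measurable]: "e \<in> borel_measurable borel" and e: "\<And>x. norm (e x) = 1"
  shows "integrable (lborel \<Otimes>\<^sub>M lborel) (\<lambda>(t, x). e x * of_real (w t * heat_kernel (s + t) x))"
proof (rule integrable_lborel_pairI)
  have [measurable]: "w \<in> borel_measurable borel" using w by auto
  show "(\<lambda>(t, x). e x * of_real (w t * heat_kernel (s + t) x)) \<in> borel_measurable (lborel \<Otimes>\<^sub>M lborel)"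
    by measurable
  have "(\<integral>\<^sup>+t. \<integral>\<^sup>+x. norm (e x * of_real (w t * heat_kernel (s + t) x)) \<partial>lborel \<partial>lborel)
     = (\<integral>\<^sup>+t. ennreal \<bar>w t\<bar> \<partial>lborel)"
  proof (intro nn_integral_cong)
    fix t :: real
    have "(\<integral>\<^sup>+x. norm (e x * of_real (w t * heat_kernel (s + t) x)) \<partial>lborel)
       = ennreal \<bar>w t\<bar> * (\<integral>\<^sup>+x. ennreal (heat_kernel (s + t) (x::'a)) \<partial>lborel)"
      by (subst nn_integral_cmult[symmetric])
        (simp_all add: norm_mult e abs_mult ennreal_mult' abs_of_nonneg[OF heat_kernel_nonneg])
    also have "\<dots> = ennreal \<bar>w t\<bar>"
      using w(2)[of t] s by (cases "t \<le> 0") (auto simp: heat_kernel_nn_integral)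
    finally show "(\<integral>\<^sup>+x. norm (e x * of_real (w t * heat_kernel (s + t) x)) \<partial>lborel) = ennreal \<bar>w t\<bar>" .
  qed
  also have "\<dots> < \<infinity>" using w by (auto simp: integrable_iff_bounded)
  finally show "(\<integral>\<^sup>+t. \<integral>\<^sup>+x. norm (e x * of_real (w t * heat_kernel (s + t) x)) \<partial>lborel \<partial>lborel) < \<infinity>" .
qed

lemma heat_mix_integrable:
  assumes w: "integrable lborel w" "\<And>t. t \<le> 0 \<Longrightarrow> w t = 0" and s: "s \<ge> 0"
  shows "integrable lborel (heat_mix w s :: 'a::euclidean_space \<Rightarrow> real)"
proof -
  have "integrable (lborel \<Otimes>\<^sub>M lborel) (\<lambda>(t, x::'a). 1 * complex_of_real (w t * heat_kernel (s + t) x))"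
    using heat_mix_pair_integrable[OF w s, of "\<lambda>_. 1"] by simp
  from lborel_pair.integrable_snd[OF this]
  have "integrable lborel (\<lambda>x::'a. complex_of_real (heat_mix w s x))"
    by (simp add: heat_mix_def del: of_real_mult)
  then show ?thesis
    using complex_of_real_integrable_eq by blast
qed

lemma ft_heat_kernel:
  fixes \<xi> :: "'a::euclidean_space"
  assumes "s > 0"
  shows "ft (heat_kernel s) \<xi> = of_real (exp (- s * (norm \<xi>)\<^sup>2))"
  using heat_kernel_fourier[OF assms, of "- \<xi>"] by (simp add: ft_def inner_commute)

lemma ft_heat_mix:
  fixes \<xi> :: "'a::euclidean_space"
  assumes w: "integrable lborel w" "\<And>t. t \<le> 0 \<Longrightarrow> w t = 0" and s: "s \<ge> 0"
  shows "ft (heat_mix w s) \<xi> = of_real (\<integral>t. w t * exp (- (s + t) * (norm \<xi>)\<^sup>2) \<partial>lborel)"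
proof -
  let ?e = "\<lambda>x. exp (- \<i> * complex_of_real (x \<bullet> \<xi>))"
  have "ft (heat_mix w s) \<xi> = (\<integral>x. \<integral>t. ?e x * of_real (w t * heat_kernel (s + t) x) \<partial>lborel \<partial>lborel)"
    unfolding ft_def heat_mix_def by (simp del: of_real_mult)
  also have "\<dots> = (\<integral>t. \<integral>x. ?e x * of_real (w t * heat_kernel (s + t) x) \<partial>lborel \<partial>lborel)"
    using heat_mix_pair_integrable[OF w s, of ?e] by (intro lborel_pair.Fubini_integral) simp
  also have "\<dots> = (\<integral>t. of_real (w t * exp (- (s + t) * (norm \<xi>)\<^sup>2)) \<partial>lborel)"
  proof (intro Bochner_Integration.integral_cong refl)
    fix t :: real
    have "(\<integral>x. ?e x * of_real (w t * heat_kernel (s + t) x) \<partial>lborel) = of_real (w t) * ft (heat_kernel (s + t)) \<xi>"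
      unfolding ft_def by (subst integral_mult_right_zero[symmetric]) (simp add: mult_ac)
    also have "\<dots> = of_real (w t * exp (- (s + t) * (norm \<xi>)\<^sup>2))"
      using w(2)[of t] s by (cases "t \<le> 0") (auto simp: ft_heat_kernel)
    finally show "(\<integral>x. ?e x * of_real (w t * heat_kernel (s + t) x) \<partial>lborel) = of_real (w t * exp (- (s + t) * (norm \<xi>)\<^sup>2))" .
  qed
  finally show ?thesis by (simp del: of_real_mult)
qed

text \<open>Here s > 0 is essential: exp(-s |\<xi>|^2) dominates all the Gaussians in the mixture
  and makes the integrand absolutely integrable in \<open>t\<close> and \<xi> together.\<close>

lemma
  fixes x :: "'a::euclidean_space"
  assumes w: "integrable lborel w" "\<And>t. t \<le> 0 \<Longrightarrow> w t = 0" and s: "s > 0"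
  shows inverse_transform_heat_mix:
    "(\<integral>\<xi>. exp (\<i> * of_real (x \<bullet> \<xi>)) * of_real (\<integral>t. w t * exp (- (s + t) * (norm \<xi>)\<^sup>2) \<partial>lborel) \<partial>lborel)
     = of_real ((2 * pi) ^ DIM('a) * heat_mix w s x)" (is ?A)
  and heat_mix_transform_integrable:
    "integrable lborel (\<lambda>\<xi>::'a. complex_of_real (\<integral>t. w t * exp (- (s + t) * (norm \<xi>)\<^sup>2) \<partial>lborel))" (is ?B)
proof -
  have [measurable]: "w \<in> borel_measurable borel" using w by auto
  have I: "integrable (lborel \<Otimes>\<^sub>M lborel) (\<lambda>(t, \<xi>). exp (\<i> * of_real (x \<bullet> \<xi>)) * of_real (w t * exp (- (s + t) * (norm \<xi>)\<^sup>2)))"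
    for x :: 'a
  proof (rule integrable_lborel_pairI)
    have "integrable lborel (\<lambda>\<xi>::'a. complex_of_real (exp (- s * (norm \<xi>)\<^sup>2)))"
      using exp_sq_fourier_integrable[OF s, of 0] by simp
    then have fin: "(\<integral>\<^sup>+\<xi>. ennreal (exp (- s * (norm (\<xi>::'a))\<^sup>2)) \<partial>lborel) < \<infinity>"
      by (simp add: integrable_iff_bounded)
    have "(\<integral>\<^sup>+t. \<integral>\<^sup>+\<xi>. norm (exp (\<i> * of_real (x \<bullet> \<xi>)) * of_real (w t * exp (- (s + t) * (norm \<xi>)\<^sup>2))) \<partial>lborel \<partial>lborel)
      \<le> (\<integral>\<^sup>+t. \<integral>\<^sup>+\<xi>. ennreal \<bar>w t\<bar> * ennreal (exp (- s * (norm (\<xi>::'a))\<^sup>2)) \<partial>lborel \<partial>lborel)"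
    proof (intro nn_integral_mono)
      fix t :: real and \<xi> :: 'a
      have "\<bar>w t\<bar> * exp (- (s + t) * (norm \<xi>)\<^sup>2) \<le> \<bar>w t\<bar> * exp (- s * (norm \<xi>)\<^sup>2)"
      proof (cases "t \<le> 0")
        case False
        then have "s * (norm \<xi>)\<^sup>2 \<le> (s + t) * (norm \<xi>)\<^sup>2" by (intro mult_right_mono) auto
        then show ?thesis by (intro mult_left_mono) (simp_all only: exp_le_cancel_iff mult_minus_left neg_le_iff_le abs_ge_zero)
      qed (simp add: w(2))
      then show "ennreal (norm (exp (\<i> * of_real (x \<bullet> \<xi>)) * of_real (w t * exp (- (s + t) * (norm \<xi>)\<^sup>2))))
          \<le> ennreal \<bar>w t\<bar> * ennreal (exp (- s * (norm \<xi>)\<^sup>2))"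
        by (simp add: norm_mult abs_mult flip: ennreal_mult')
    qed
    also have "\<dots> = (\<integral>\<^sup>+t. ennreal \<bar>w t\<bar> \<partial>lborel) * (\<integral>\<^sup>+\<xi>. ennreal (exp (- s * (norm (\<xi>::'a))\<^sup>2)) \<partial>lborel)"
      by (simp add: nn_integral_multc nn_integral_cmult)
    also have "\<dots> < \<infinity>"
      using w fin by (auto simp: integrable_iff_bounded ennreal_mult_less_top)
    finally show "(\<integral>\<^sup>+t. \<integral>\<^sup>+\<xi>. norm (exp (\<i> * of_real (x \<bullet> \<xi>)) * of_real (w t * exp (- (s + t) * (norm \<xi>)\<^sup>2))) \<partial>lborel \<partial>lborel) < \<infinity>" .
  qed measurable
  show ?B
    using lborel_pair.integrable_snd[OF I[of 0]] by (simp del: of_real_mult)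
  have "(\<integral>\<xi>. exp (\<i> * of_real (x \<bullet> \<xi>)) * of_real (\<integral>t. w t * exp (- (s + t) * (norm \<xi>)\<^sup>2) \<partial>lborel) \<partial>lborel)
    = (\<integral>\<xi>. \<integral>t. exp (\<i> * of_real (x \<bullet> \<xi>)) * of_real (w t * exp (- (s + t) * (norm \<xi>)\<^sup>2)) \<partial>lborel \<partial>lborel)"
    by (simp del: of_real_mult)
  also have "\<dots> = (\<integral>t. \<integral>\<xi>. exp (\<i> * of_real (x \<bullet> \<xi>)) * of_real (w t * exp (- (s + t) * (norm \<xi>)\<^sup>2)) \<partial>lborel \<partial>lborel)"
    by (rule lborel_pair.Fubini_integral[OF I])
  also have "\<dots> = (\<integral>t. of_real ((2 * pi) ^ DIM('a) * (w t * heat_kernel (s + t) x)) \<partial>lborel)"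
  proof (intro Bochner_Integration.integral_cong refl)
    fix t :: real
    have "(\<integral>\<xi>. exp (\<i> * of_real (x \<bullet> \<xi>)) * of_real (w t * exp (- (s + t) * (norm \<xi>)\<^sup>2)) \<partial>lborel)
      = of_real (w t) * (\<integral>\<xi>. exp (\<i> * of_real (x \<bullet> \<xi>)) * of_real (exp (- (s + t) * (norm \<xi>)\<^sup>2)) \<partial>lborel)"
      by (subst integral_mult_right_zero[symmetric]) (simp add: mult_ac)
    also have "\<dots> = of_real ((2 * pi) ^ DIM('a) * (w t * heat_kernel (s + t) x))"
      using w(2)[of t] s exp_sq_fourier[of "s + t" x] by (cases "t \<le> 0") (auto simp: mult_ac)
    finally show "(\<integral>\<xi>. exp (\<i> * of_real (x \<bullet> \<xi>)) * of_real (w t * exp (- (s + t) * (norm \<xi>)\<^sup>2)) \<partial>lborel)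
      = of_real ((2 * pi) ^ DIM('a) * (w t * heat_kernel (s + t) x))" .
  qed
  also have "\<dots> = of_real ((2 * pi) ^ DIM('a) * heat_mix w s x)"
    unfolding heat_mix_def by (simp only: integral_complex_of_real integral_mult_right_zero)
  finally show ?A .
qed

lemma gamma_weight_integrable0:
  assumes "M > 0"
  shows "integrable lborel (gamma_weight M)" "t \<le> 0 \<Longrightarrow> gamma_weight M t = 0"
proof -
  show "integrable lborel (gamma_weight M)"
    using gamma_weight_integrable[OF assms, of 0] by simp
qed (simp add: gamma_weight_def)

text \<open>The mixture with Gamma weight is the Bessel kernel, that is, the convolution kernel of
  (1 - Laplace)^(-M).\<close>

lemma ft_bessel:
  fixes \<xi> :: "'a::euclidean_space"
  assumes "M > 0"
  shows "ft (heat_mix (gamma_weight M) 0) \<xi> = of_real ((1 + (norm \<xi>)\<^sup>2) powr (- M))"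
proof -
  have "ft (heat_mix (gamma_weight M) 0) \<xi> = of_real (\<integral>t. gamma_weight M t * exp (- (0 + t) * (norm \<xi>)\<^sup>2) \<partial>lborel)"
    using gamma_weight_integrable0[OF assms] by (rule ft_heat_mix) simp_all
  also have "(\<integral>t. gamma_weight M t * exp (- (0 + t) * (norm \<xi>)\<^sup>2) \<partial>lborel)
     = (\<integral>t. gamma_weight M t * exp (- (norm \<xi>)\<^sup>2 * t) \<partial>lborel)"
    by (intro Bochner_Integration.integral_cong refl) (simp add: mult.commute)
  also have "\<dots> = (1 + (norm \<xi>)\<^sup>2) powr (- M)"
    by (rule gamma_weight_laplace[OF assms]) simp
  finally show ?thesis .
qed

text \<open>The order of the quantifiers matters: \<open>k\<close> is obtained before \<psi> is
  mentioned and works for all \<psi>, so that \<psi> can later be built from the kernels. The time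
  shift 1 in \<open>heat_mix w 1\<close> encodes the transform of \<open>heat_kernel 1\<close>; the
  weight \<open>w\<close> encodes |\<xi>|^(2a) (1 + |\<xi>|^2)^(-M).\<close>

lemma frac_laplacian_bessel:
  fixes a M :: real
  assumes a: "0 \<le> a" "a < M"
  obtains k :: "'a::euclidean_space \<Rightarrow> real" where "integrable lborel k"
    "\<And>\<psi> x. integrable lborel \<psi> \<Longrightarrow>
       frac_laplacian a (convolve (heat_kernel 1) (convolve (heat_mix (gamma_weight M) 0) \<psi>)) x = convolve k \<psi> x"
proof -
  obtain w where w: "integrable lborel w" "\<And>t. t \<le> 0 \<Longrightarrow> w t = 0"
    and wl: "\<And>l. l > 0 \<Longrightarrow> (\<integral>t. w t * exp (- l * t) \<partial>lborel) = l powr a * (1 + l) powr (- M)"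
    using symbol_laplace_weight[OF a] by blast
  have M: "M > 0" using a by simp
  define k :: "'a \<Rightarrow> real" where "k = heat_mix w 1"
  define b :: "'a \<Rightarrow> real" where "b = heat_mix (gamma_weight M) 0"
  define c where "c = (2 * pi) powr (- real DIM('a) / 2)"
  have k: "integrable lborel k" unfolding k_def by (rule heat_mix_integrable[OF w]) simp_all
  have b: "integrable lborel b" unfolding b_def
    by (rule heat_mix_integrable[OF gamma_weight_integrable0[OF M]]) simp_all
  define g where "g \<xi> = complex_of_real (\<integral>t. w t * exp (- (1 + t) * (norm (\<xi>::'a))\<^sup>2) \<partial>lborel)" for \<xi>
  have gi: "integrable lborel g"
    unfolding g_def using heat_mix_transform_integrable[OF w, of 1] by simp
  have gx: "(\<integral>\<xi>. exp (\<i> * of_real (x \<bullet> \<xi>)) * g \<xi> \<partial>lborel) = of_real ((2 * pi) ^ DIM('a) * k x)" for x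
    unfolding g_def k_def using inverse_transform_heat_mix[OF w, of 1 x] by simp
  \<comment> \<open>The origin is excluded: for a = 0 the identity fails there because of
    \<open>0 powr 0 = 0\<close>. A single point does not affect the integral.\<close>
  have g0: "g \<xi> = of_real (norm \<xi> powr (2 * a)) * (of_real (exp (- 1 * (norm \<xi>)\<^sup>2)) * of_real ((1 + (norm \<xi>)\<^sup>2) powr (- M)))"
    if "\<xi> \<noteq> 0" for \<xi>
  proof -
    define l where "l = (norm \<xi>)\<^sup>2"
    have l: "l > 0" using that by (simp add: l_def)
    have "(\<integral>t. w t * exp (- (1 + t) * l) \<partial>lborel) = (\<integral>t. exp (- 1 * l) * (w t * exp (- l * t)) \<partial>lborel)"
    proof (intro Bochner_Integration.integral_cong refl)
      fix t
      have "exp (- (1 + t) * l) = exp (- 1 * l) * exp (- l * t)"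
        unfolding exp_add[symmetric] by (simp add: algebra_simps)
      then show "w t * exp (- (1 + t) * l) = exp (- 1 * l) * (w t * exp (- l * t))"
        by (simp only: mult_ac)
    qed
    also have "\<dots> = exp (- 1 * l) * (l powr a * (1 + l) powr (- M))"
      by (simp only: integral_mult_right_zero wl[OF l])
    also have "l powr a = norm \<xi> powr (2 * a)"
    proof -
      have "l = norm \<xi> powr 2" using that by (simp add: l_def)
      then show ?thesis by (simp only: powr_powr)
    qed
    finally show ?thesis unfolding g_def l_def by (simp only: of_real_mult mult_ac)
  qed
  show thesis
  proof (rule that[OF k])
    fix \<psi> :: "'a \<Rightarrow> real" and x assume \<psi>: "integrable lborel \<psi>"
    let ?\<phi> = "convolve (heat_kernel 1) (convolve b \<psi>)"
    have [measurable]: "\<psi> \<in> borel_measurable borel" "b \<in> borel_measurable borel" "g \<in> borel_measurable borel"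
      "k \<in> borel_measurable borel"
      using \<psi> b gi k by auto
    have [measurable]: "?\<phi> \<in> borel_measurable borel" by measurable
    have F: "fourier (\<lambda>y. of_real (?\<phi> y)) \<xi> = of_real c * (ft (heat_kernel 1) \<xi> * (ft b \<xi> * ft \<psi> \<xi>))" for \<xi>
      unfolding fourier_of_real c_def
      using ft_convolve[OF heat_kernel_integrable convolve_integrable[OF b \<psi>], of 1] ft_convolve[OF b \<psi>] by simp
    have "inv_fourier (\<lambda>\<xi>. of_real (norm \<xi> powr (2 * a)) * fourier (\<lambda>y. of_real (?\<phi> y)) \<xi>) x
      = of_real c * (\<integral>\<xi>. exp (\<i> * of_real (x \<bullet> \<xi>)) * (of_real (norm \<xi> powr (2 * a)) *
          (of_real c * ft ?\<phi> \<xi>)) \<partial>lborel)"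
      unfolding inv_fourier_def c_def fourier_of_real ..
    also have "(\<integral>\<xi>. exp (\<i> * of_real (x \<bullet> \<xi>)) * (of_real (norm \<xi> powr (2 * a)) *
          (of_real c * ft ?\<phi> \<xi>)) \<partial>lborel)
       = (\<integral>\<xi>. of_real c * (exp (\<i> * of_real (x \<bullet> \<xi>)) * (g \<xi> * ft \<psi> \<xi>)) \<partial>lborel)"
    proof (rule integral_cong_AE)
      show "AE \<xi> in lborel. exp (\<i> * of_real (x \<bullet> \<xi>)) * (of_real (norm \<xi> powr (2 * a)) * (of_real c * ft ?\<phi> \<xi>))
        = of_real c * (exp (\<i> * of_real (x \<bullet> \<xi>)) * (g \<xi> * ft \<psi> \<xi>))"
        using AE_lborel_singleton[of 0]
      proof eventually_elim
        fix \<xi> :: 'a assume \<xi>: "\<xi> \<noteq> 0"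
         have "ft ?\<phi> \<xi> = of_real (exp (- 1 * (norm \<xi>)\<^sup>2)) * of_real ((1 + (norm \<xi>)\<^sup>2) powr (- M)) * ft \<psi> \<xi>"
          using ft_convolve[OF heat_kernel_integrable convolve_integrable[OF b \<psi>], of 1] ft_convolve[OF b \<psi>]
            ft_heat_kernel[of 1 \<xi>] ft_bessel[OF M, of \<xi>]
          by (simp add: b_def)
        then show "exp (\<i> * of_real (x \<bullet> \<xi>)) * (of_real (norm \<xi> powr (2 * a)) * (of_real c * ft ?\<phi> \<xi>))
          = of_real c * (exp (\<i> * of_real (x \<bullet> \<xi>)) * (g \<xi> * ft \<psi> \<xi>))"
          by (simp only: g0[OF \<xi>] mult_ac)
      qed
    qed measurable
    also have "\<dots> = of_real c * (\<integral>y. of_real ((2 * pi) ^ DIM('a) * k (x - y)) * of_real (\<psi> y) \<partial>lborel)"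
      by (simp only: integral_mult_right_zero inverse_transform_mult_ft[OF gi \<psi>] gx)
    also have "(\<integral>y. of_real ((2 * pi) ^ DIM('a) * k (x - y)) * of_real (\<psi> y) \<partial>lborel)
       = complex_of_real ((2 * pi) ^ DIM('a) * convolve k \<psi> x)"
      unfolding convolve_def by (simp only: integral_complex_of_real integral_mult_right_zero mult.assoc flip: of_real_mult)
    also have "of_real c * (of_real c * complex_of_real ((2 * pi) ^ DIM('a) * convolve k \<psi> x)) = of_real (convolve k \<psi> x)"
    proof -
      \<comment> \<open>One factor \<open>c\<close> comes from each of the two transforms; together
        they cancel the power of 2 pi in \<open>gx\<close>.\<close>
      have "c * c = inverse ((2 * pi) ^ DIM('a))"
        unfolding c_def powr_add[symmetric] by (simp add: powr_minus powr_realpow)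
      then have "c * (c * ((2 * pi) ^ DIM('a) * convolve k \<psi> x)) = convolve k \<psi> x"
        unfolding mult.assoc[symmetric] by (simp add: field_simps)
      then show ?thesis by (simp only: flip: of_real_mult)
    qed
    finally show "frac_laplacian a (convolve (heat_kernel 1) (convolve (heat_mix (gamma_weight M) 0) \<psi>)) x = convolve k \<psi> x"
      unfolding frac_laplacian_def b_def by simp
  qed
qed

text \<open>The \<open>j\<close>-th term is \<open>\<rho>\<^sup>j\<close> times the \<open>j\<close>-fold convolution of \<open>k\<close> with \<open>exp (- \<Sum> \<bar>x\<^sub>b\<bar>)\<close>, from
  which it inherits the Harnack inequality because convolutions commute with translations.\<close>

primrec neumann_term :: "('a::euclidean_space \<Rightarrow> real) \<Rightarrow> real \<Rightarrow> nat \<Rightarrow> 'a \<Rightarrow> ennreal" where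
  "neumann_term k \<rho> 0 x = ennreal (\<Prod>b\<in>Basis. exp (- \<bar>x \<bullet> b\<bar>))"
| "neumann_term k \<rho> (Suc j) x = ennreal \<rho> * (\<integral>\<^sup>+y. ennreal (k y) * neumann_term k \<rho> j (x - y) \<partial>lborel)"

lemma neumann_term_measurable [measurable]:
  fixes k :: "'a::euclidean_space \<Rightarrow> real"
  assumes [measurable]: "k \<in> borel_measurable borel"
  shows "neumann_term k \<rho> j \<in> borel_measurable borel"
proof (induction j)
  case 0
  then show ?case by (subst measurable_cong[OF neumann_term.simps(1)]) measurable
next
  case (Suc j)
  note [measurable] = Suc.IH
  show ?case by (subst measurable_cong[OF neumann_term.simps(2)]) measurable
qed

text \<open>\<open>gamma_weight 1\<close> is the exponential density; away from 0 the integrand is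
  this density plus its reflection.\<close>

lemma exp_abs_nn_integral: "(\<integral>\<^sup>+t. ennreal (exp (- \<bar>t\<bar>)) \<partial>(lborel::real measure)) < \<infinity>"
proof -
  have 1: "(\<integral>\<^sup>+t. ennreal (gamma_weight 1 t) \<partial>lborel) = 1"
    using nn_integral_gamma_weight[of 1 0] by simp
  have 2: "(\<integral>\<^sup>+t. ennreal (gamma_weight 1 (- t)) \<partial>lborel) = 1"
    using nn_integral_reflect[of "\<lambda>t. ennreal (gamma_weight 1 t)" 0] 1 by simp
  have "(\<integral>\<^sup>+t. ennreal (exp (- \<bar>t\<bar>)) \<partial>lborel)
    \<le> (\<integral>\<^sup>+t. ennreal (gamma_weight 1 t) + ennreal (gamma_weight 1 (- t)) \<partial>lborel)"
  proof (rule nn_integral_mono_AE)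
    show "AE t in lborel. ennreal (exp (- \<bar>t\<bar>)) \<le> ennreal (gamma_weight 1 t) + ennreal (gamma_weight 1 (- t))"
      using AE_lborel_singleton[of 0]
      by eventually_elim (auto simp: gamma_weight_def)
  qed
  also have "\<dots> = 1 + 1"
    by (subst nn_integral_add) (simp_all add: 1 2)
  finally show ?thesis by (rule order_le_less_trans) simp
qed

section \<open>A positive supersolution for convolution with an integrable kernel\<close>

text \<open>For the sum F of the terms f_j, shifting the index gives \<rho> (k * F) = F - f_0 \<le>
  F, hence L = 1 / \<rho>. The terms shrink geometrically both in supremum and in mass, and the
  Harnack constant of f_0 passes unchanged to each term and to the sum. Working in
  \<open>ennreal\<close> postpones all questions of convergence.\<close>

lemma neumann_supersolution:
  fixes k :: "'a::euclidean_space \<Rightarrow> real"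
  assumes k: "integrable lborel k" and k0: "\<And>x. k x \<ge> 0"
  obtains \<psi> L C where "integrable lborel \<psi>" "\<And>x. \<psi> x > 0" "\<And>x. \<psi> x \<le> 2" "L > 0" "C > 0"
    "\<And>x. (\<integral>\<^sup>+y. ennreal (k y * \<psi> (x - y)) \<partial>lborel) \<le> ennreal (L * \<psi> x)"
    "\<And>x z. norm z \<le> 1 \<Longrightarrow> \<psi> x \<le> C * \<psi> (x - z)"
proof -
  have [measurable]: "k \<in> borel_measurable borel" using k by auto
  define I where "I = (\<integral>x. k x \<partial>lborel)"
  have I0: "I \<ge> 0" unfolding I_def using k0 by simp
  have kI: "(\<integral>\<^sup>+x. ennreal (k x) \<partial>lborel) = ennreal I"
    unfolding I_def by (rule nn_integral_eq_integral[OF k]) (use k0 in simp)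
  \<comment> \<open>Each further convolution then gains a factor of at most 1/2;
    \<open>1 + I\<close> keeps the denominator positive even if \<open>k\<close> has mass 0.\<close>
  define \<rho> where "\<rho> = 1 / (2 * (1 + I))"
  have \<rho>: "\<rho> > 0" "\<rho> * I \<le> 1/2" using I0 by (auto simp: \<rho>_def field_simps)
  let ?f = "neumann_term k \<rho>"
  define J where "J = (\<integral>\<^sup>+x. ?f 0 x \<partial>lborel)"
  have J: "J < \<infinity>"
  proof -
    have "J = (\<integral>\<^sup>+(x::'a). (\<Prod>b\<in>Basis. ennreal (exp (- \<bar>x \<bullet> b\<bar>))) \<partial>lborel)"
      unfolding J_def by (intro nn_integral_cong) (simp add: prod_ennreal)
    also have "\<dots> = (\<Prod>b\<in>(Basis::'a set). (\<integral>\<^sup>+t. ennreal (exp (- \<bar>t\<bar>)) \<partial>lborel))"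
      by (rule nn_integral_lborel_prod) simp_all
    also have "\<dots> < \<infinity>"
      using exp_abs_nn_integral by (simp add: less_top[symmetric] ennreal_prod_eq_top power_eq_top_ennreal)
    finally show ?thesis .
  qed
  \<comment> \<open>A shift by a vector of length at most 1 changes each coordinate by at most 1,
    which costs the seed a factor e per coordinate.\<close>
  define C where "C = exp (real DIM('a))"
  have bound: "?f j x \<le> ennreal ((1/2) ^ j)" for j x
  proof (induction j arbitrary: x)
    case 0
    have "(\<Prod>b\<in>Basis. exp (- \<bar>x \<bullet> b\<bar>)) \<le> 1" by (intro prod_le_1) auto
    then show ?case by (simp flip: ennreal_1)
  next
    case (Suc j)
    have "?f (Suc j) x \<le> ennreal \<rho> * (\<integral>\<^sup>+y. ennreal (k y) * ennreal ((1/2) ^ j) \<partial>lborel)"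
      unfolding neumann_term.simps by (intro mult_left_mono nn_integral_mono Suc) simp_all
    also have "\<dots> = ennreal (\<rho> * I * (1/2) ^ j)"
      using \<rho> I0 by (simp add: nn_integral_multc kI ennreal_mult mult.assoc)
    also have "\<dots> \<le> ennreal ((1/2) ^ Suc j)"
      using \<rho> by (intro ennreal_leI) (simp add: mult_right_mono)
    finally show ?case .
  qed
  have mass: "(\<integral>\<^sup>+x. ?f j x \<partial>lborel) \<le> ennreal ((1/2) ^ j) * J" for j
  proof (induction j)
    case 0
    then show ?case by (simp add: J_def)
  next
    case (Suc j)
    have "(\<integral>\<^sup>+x. ?f (Suc j) x \<partial>lborel) = ennreal \<rho> * (\<integral>\<^sup>+x. \<integral>\<^sup>+y. ennreal (k y) * ?f j (x - y) \<partial>lborel \<partial>lborel)"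
      unfolding neumann_term.simps by (intro nn_integral_cmult) measurable
    also have "(\<integral>\<^sup>+x. \<integral>\<^sup>+y. ennreal (k y) * ?f j (x - y) \<partial>lborel \<partial>lborel)
      = (\<integral>\<^sup>+y. \<integral>\<^sup>+x. ennreal (k y) * ?f j (x - y) \<partial>lborel \<partial>lborel)"
      by (rule lborel_pair.Fubini') measurable
    also have "\<dots> = (\<integral>\<^sup>+y. ennreal (k y) * (\<integral>\<^sup>+x. ?f j x \<partial>lborel) \<partial>lborel)"
      by (intro nn_integral_cong, subst nn_integral_cmult) (simp_all add: nn_integral_shift)
    also have "\<dots> = ennreal I * (\<integral>\<^sup>+x. ?f j x \<partial>lborel)"
      by (simp add: nn_integral_multc kI)
    also have "ennreal \<rho> * \<dots> \<le> ennreal \<rho> * (ennreal I * (ennreal ((1/2) ^ j) * J))"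
      by (intro mult_left_mono Suc) simp_all
    also have "\<dots> = ennreal (\<rho> * I * (1/2) ^ j) * J"
      using \<rho> I0 by (simp add: ennreal_mult mult.assoc)
    also have "\<dots> \<le> ennreal ((1/2) ^ Suc j) * J"
      using \<rho> by (intro mult_right_mono ennreal_leI) (simp_all add: mult_right_mono)
    finally show ?case .
  qed
  have harnack: "?f j x \<le> ennreal C * ?f j (x - z)" if z: "norm z \<le> 1" for j x z
  proof (induction j arbitrary: x)
    case 0
    have "(\<Prod>b\<in>Basis. exp (- \<bar>x \<bullet> b\<bar>)) \<le> (\<Prod>b\<in>Basis. exp 1 * exp (- \<bar>(x - z) \<bullet> b\<bar>))"
    proof (intro prod_mono conjI)
      fix b :: 'a assume b: "b \<in> Basis"
      have "\<bar>z \<bullet> b\<bar> \<le> 1" using Basis_le_norm[OF b, of z] z by simp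
      then show "exp (- \<bar>x \<bullet> b\<bar>) \<le> exp 1 * exp (- \<bar>(x - z) \<bullet> b\<bar>)"
        by (simp add: inner_diff_left flip: exp_add)
    qed simp
    also have "\<dots> = C * (\<Prod>b\<in>Basis. exp (- \<bar>(x - z) \<bullet> b\<bar>))"
      by (simp add: prod.distrib C_def flip: exp_of_nat_mult)
    finally show ?case
      by (simp add: C_def prod_nonneg flip: ennreal_mult)
  next
    case (Suc j)
    have "?f (Suc j) x \<le> ennreal \<rho> * (\<integral>\<^sup>+y. ennreal C * (ennreal (k y) * ?f j (x - z - y)) \<partial>lborel)"
      unfolding neumann_term.simps
    proof (intro mult_left_mono nn_integral_mono)
      fix y
      have "ennreal (k y) * ?f j (x - y) \<le> ennreal (k y) * (ennreal C * ?f j (x - y - z))"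
        by (intro mult_left_mono Suc) simp
      then show "ennreal (k y) * ?f j (x - y) \<le> ennreal C * (ennreal (k y) * ?f j (x - z - y))"
        by (simp add: mult_ac diff_diff_eq add.commute)
    qed simp
    also have "\<dots> = ennreal C * ?f (Suc j) (x - z)"
    proof -
      have "(\<integral>\<^sup>+y. ennreal C * (ennreal (k y) * ?f j (x - z - y)) \<partial>lborel)
          = ennreal C * (\<integral>\<^sup>+y. ennreal (k y) * ?f j (x - z - y) \<partial>lborel)"
        by (rule nn_integral_cmult) measurable
      then show ?thesis unfolding neumann_term.simps by (simp only: mult_ac)
    qed
    finally show ?case .
  qed
  define F where "F x = (\<Sum>j. ?f j x)" for x
  have [measurable]: "F \<in> borel_measurable borel" unfolding F_def[abs_def] by measurable
  have half: "(\<Sum>j. ennreal ((1/2) ^ j)) = 2"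
  proof -
    have "(\<Sum>j. ennreal ((1/2) ^ j)) = ennreal (\<Sum>j. (1/2) ^ j)"
      by (rule suminf_ennreal2) (auto intro: summable_geometric)
    also have "(\<Sum>j. (1/2::real) ^ j) = 2"
      by (subst suminf_geometric) auto
    finally show ?thesis by simp
  qed
  have F2: "F x \<le> 2" for x
    unfolding F_def half[symmetric] by (intro suminf_le bound) auto
  then have Ftop: "F x < \<infinity>" for x by (rule order_le_less_trans) simp
  have FJ: "(\<integral>\<^sup>+x. F x \<partial>lborel) \<le> 2 * J"
  proof -
    have "(\<integral>\<^sup>+x. F x \<partial>lborel) = (\<Sum>j. \<integral>\<^sup>+x. ?f j x \<partial>lborel)"
      unfolding F_def by (intro nn_integral_suminf) measurable
    also have "\<dots> \<le> (\<Sum>j. ennreal ((1/2) ^ j) * J)" by (intro suminf_le mass) auto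
    also have "\<dots> = 2 * J" by (simp only: ennreal_suminf_multc half)
    finally show ?thesis .
  qed
  have Fk: "ennreal \<rho> * (\<integral>\<^sup>+y. ennreal (k y) * F (x - y) \<partial>lborel) \<le> F x" for x
  proof -
    have "(\<integral>\<^sup>+y. ennreal (k y) * F (x - y) \<partial>lborel) = (\<integral>\<^sup>+y. (\<Sum>j. ennreal (k y) * ?f j (x - y)) \<partial>lborel)"
      by (simp add: F_def)
    also have "\<dots> = (\<Sum>j. \<integral>\<^sup>+y. ennreal (k y) * ?f j (x - y) \<partial>lborel)"
      by (intro nn_integral_suminf) measurable
    finally have "ennreal \<rho> * (\<integral>\<^sup>+y. ennreal (k y) * F (x - y) \<partial>lborel) = (\<Sum>j. ?f (Suc j) x)"
      by (simp add: ennreal_suminf_cmult)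
    also have "\<dots> \<le> F x"
    proof (rule suminf_le_const)
      fix n
      have "(\<Sum>j<n. ?f (Suc j) x) \<le> (\<Sum>j<Suc n. ?f j x)"
        unfolding sum.lessThan_Suc_shift by (rule add_increasing) simp_all
      also have "\<dots> \<le> F x" unfolding F_def by (rule sum_le_suminf) auto
      finally show "(\<Sum>j<n. ?f (Suc j) x) \<le> F x" .
    qed auto
    finally show ?thesis .
  qed
  define \<psi> where "\<psi> x = enn2real (F x)" for x
  have e: "ennreal (\<psi> x) = F x" for x using Ftop[of x] by (simp add: \<psi>_def)
  have \<psi>0: "\<psi> x \<ge> 0" for x by (simp add: \<psi>_def)
  have [measurable]: "\<psi> \<in> borel_measurable borel" unfolding \<psi>_def[abs_def] by measurable
  show thesis
  proof (rule that[of \<psi> "1 / \<rho>" C])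
    show "integrable lborel \<psi>"
    proof (rule integrableI_nonneg)
      have "(\<integral>\<^sup>+x. ennreal (\<psi> x) \<partial>lborel) \<le> 2 * J" using FJ by (simp add: e)
      also have "\<dots> < \<infinity>" using J by (simp add: ennreal_mult_less_top)
      finally show "(\<integral>\<^sup>+x. ennreal (\<psi> x) \<partial>lborel) < \<infinity>" .
    qed (simp_all add: \<psi>0)
    show "\<psi> x > 0" for x
    proof -
      have "0 < ?f 0 x" by (simp add: prod_pos)
      also have "?f 0 x \<le> F x"
        unfolding F_def using sum_le_suminf[of "\<lambda>j. ?f j x" "{0}"] by simp
      finally show ?thesis using e[of x] by (metis ennreal_less_zero_iff)
    qed
    show "\<psi> x \<le> 2" for x
      using F2[of x] unfolding e[symmetric] by (simp add: ennreal_le_iff flip: ennreal_numeral)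
    show "1 / \<rho> > 0" "C > 0" using \<rho> by (auto simp: C_def)
    show "\<psi> x \<le> C * \<psi> (x - z)" if "norm z \<le> 1" for x z
    proof -
      have "F x \<le> (\<Sum>j. ennreal C * ?f j (x - z))"
        unfolding F_def by (intro suminf_le harnack that) auto
      also have "\<dots> = ennreal C * F (x - z)" by (simp add: F_def)
      finally have "ennreal (\<psi> x) \<le> ennreal (C * \<psi> (x - z))"
        by (simp add: e C_def ennreal_mult')
      then show ?thesis by (subst (asm) ennreal_le_iff) (auto simp: \<psi>0 C_def)
    qed
    show "(\<integral>\<^sup>+y. ennreal (k y * \<psi> (x - y)) \<partial>lborel) \<le> ennreal (1 / \<rho> * \<psi> x)" for x
    proof -
      have "(\<integral>\<^sup>+y. ennreal (k y * \<psi> (x - y)) \<partial>lborel) = (\<integral>\<^sup>+y. ennreal (k y) * F (x - y) \<partial>lborel)"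
        by (simp add: ennreal_mult k0 \<psi>0 e)
      also have "\<dots> = ennreal (1 / \<rho>) * (ennreal \<rho> * (\<integral>\<^sup>+y. ennreal (k y) * F (x - y) \<partial>lborel))"
        using \<rho> by (simp flip: mult.assoc ennreal_mult)
      also have "\<dots> \<le> ennreal (1 / \<rho>) * F x" by (intro mult_left_mono Fk) simp
      also have "\<dots> = ennreal (1 / \<rho> * \<psi> x)" unfolding e[symmetric]
        using \<rho> by (intro ennreal_mult'[symmetric]) simp
      finally show ?thesis .
    qed
  qed
qed

section \<open>Smoothness of Gaussian convolutions\<close>

lemma real_polynomial_function_bound:
  fixes P :: "'a::real_normed_vector \<Rightarrow> real"
  assumes "real_polynomial_function P"
  obtains C k where "C \<ge> 0" "\<And>x. \<bar>P x\<bar> \<le> C * (1 + norm x) ^ k"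
proof -
  have "\<exists>C k. C \<ge> 0 \<and> (\<forall>x. \<bar>P x\<bar> \<le> C * (1 + norm x) ^ k)"
    using assms
  proof induction
    case (linear f)
    then obtain K where K: "K > 0" "\<And>x. norm (f x) \<le> norm x * K"
      using bounded_linear.pos_bounded by blast
    have "\<bar>f x\<bar> \<le> K * (1 + norm x) ^ 1" for x
      using K(2)[of x] K(1) by (simp add: algebra_simps)
    then show ?case using K(1) by (intro exI[of _ K] exI[of _ 1]) auto
  next
    case (const c)
    then show ?case by (intro exI[of _ "\<bar>c\<bar>"] exI[of _ 0]) auto
  next
    case (add f g)
    then obtain C k D l where *: "C \<ge> 0" "D \<ge> 0" "\<And>x. \<bar>f x\<bar> \<le> C * (1 + norm x) ^ k" "\<And>x. \<bar>g x\<bar> \<le> D * (1 + norm x) ^ l"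
      by blast
    have "\<bar>f x + g x\<bar> \<le> (C + D) * (1 + norm x) ^ max k l" for x
    proof -
      have "\<bar>f x + g x\<bar> \<le> C * (1 + norm x) ^ k + D * (1 + norm x) ^ l"
        using *(3,4)[of x] by linarith
      also have "\<dots> \<le> C * (1 + norm x) ^ max k l + D * (1 + norm x) ^ max k l"
        using * by (intro add_mono mult_left_mono power_increasing) auto
      finally show ?thesis by (simp add: distrib_right)
    qed
    then show ?case using * by (intro exI[of _ "C + D"] exI[of _ "max k l"]) auto
  next
    case (mult f g)
    then obtain C k D l where *: "C \<ge> 0" "D \<ge> 0" "\<And>x. \<bar>f x\<bar> \<le> C * (1 + norm x) ^ k" "\<And>x. \<bar>g x\<bar> \<le> D * (1 + norm x) ^ l"
      by blast
    have "\<bar>f x * g x\<bar> \<le> (C * D) * (1 + norm x) ^ (k + l)" for x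
    proof -
      have "\<bar>f x * g x\<bar> \<le> (C * (1 + norm x) ^ k) * (D * (1 + norm x) ^ l)"
        unfolding abs_mult using * by (intro mult_mono) auto
      then show ?thesis by (simp add: power_add mult_ac)
    qed
    then show ?case using * by (intro exI[of _ "C * D"] exI[of _ "k + l"]) auto
  qed
  then show thesis using that by blast
qed

lemma real_polynomial_function_derivative:
  fixes P :: "'a::real_normed_vector \<Rightarrow> real"
  assumes "real_polynomial_function P"
  obtains D where "\<And>x. (P has_derivative D x) (at x)" "\<And>h. real_polynomial_function (\<lambda>x. D x h)"
proof -
  have "\<exists>D. (\<forall>x. (P has_derivative D x) (at x)) \<and> (\<forall>h. real_polynomial_function (\<lambda>x. D x h))"
    using assms
  proof induction
    case (linear f)
    then show ?case
      by (intro exI[of _ "\<lambda>x. f"]) (auto intro: bounded_linear_imp_has_derivative)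
  next
    case (const c)
    then show ?case by (intro exI[of _ "\<lambda>x h. 0"]) auto
  next
    case (add f g)
    then obtain D E where "\<forall>x. (f has_derivative D x) (at x)" "\<forall>h. real_polynomial_function (\<lambda>x. D x h)"
      "\<forall>x. (g has_derivative E x) (at x)" "\<forall>h. real_polynomial_function (\<lambda>x. E x h)" by blast
    then show ?case
      by (intro exI[of _ "\<lambda>x h. D x h + E x h"]) (auto intro!: has_derivative_add)
  next
    case (mult f g)
    then obtain D E where "\<forall>x. (f has_derivative D x) (at x)" "\<forall>h. real_polynomial_function (\<lambda>x. D x h)"
      "\<forall>x. (g has_derivative E x) (at x)" "\<forall>h. real_polynomial_function (\<lambda>x. E x h)" by blast
    with mult.hyps show ?case
      by (intro exI[of _ "\<lambda>x h. f x * E x h + D x h * g x"])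
        (auto intro!: has_derivative_mult real_polynomial_function.intros(3,4))
  qed
  then show thesis using that by blast
qed

lemma power_le_fact_exp:
  fixes x :: real
  assumes "x \<ge> 0"
  shows "x ^ k \<le> fact k * exp x"
proof -
  have "(\<Sum>n\<in>{k}. x ^ n /\<^sub>R fact n) \<le> (\<Sum>n. x ^ n /\<^sub>R fact n)"
    using assms exp_converges[of x] by (intro sum_le_suminf) (auto simp: sums_iff)
  then have "x ^ k / fact k \<le> exp x"
    using exp_converges[of x] by (simp add: sums_iff divide_inverse mult.commute)
  then show ?thesis by (simp add: pos_divide_le_eq mult.commute)
qed

lemma power_exp_neg_square_bounded:
  fixes r :: real
  assumes "r \<ge> 0"
  shows "(1 + r) ^ k * exp (- r\<^sup>2 / 8) \<le> fact k * exp 3"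
proof -
  have "(1 + r) ^ k \<le> fact k * exp (1 + r)"
    using assms by (intro power_le_fact_exp) simp
  then have "(1 + r) ^ k * exp (- r\<^sup>2 / 8) \<le> fact k * exp (1 + r) * exp (- r\<^sup>2 / 8)"
    by (intro mult_right_mono) auto
  also have "\<dots> = fact k * exp (1 + r - r\<^sup>2 / 8)"
    by (simp flip: exp_add)
  also have "\<dots> \<le> fact k * exp 3"
  proof -
    \<comment> \<open>The exponent 1 + r - r^2/8 has its maximum 3 at r = 4.\<close>
    have "0 \<le> (r - 4)\<^sup>2" by simp
    then have "1 + r - r\<^sup>2 / 8 \<le> 3" by (simp add: power2_eq_square algebra_simps)
    then show ?thesis by simp
  qed
  finally show ?thesis .
qed

section \<open>Polynomials times a Gaussian\<close>

text \<open>A class of kernels that contains \<open>heat_kernel 1\<close> (with a constant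
  \<open>P\<close>) and is closed under partial derivatives, so that an induction over iterated
  derivatives stays inside it.\<close>

definition poly_gauss :: "('a::euclidean_space \<Rightarrow> real) \<Rightarrow> 'a \<Rightarrow> real" where
  "poly_gauss P x = P x * exp (- (norm x)\<^sup>2 / 4)"

text \<open>The exponent 1/4 is split into two halves: one factor exp(-|x|^2/8) absorbs the
  polynomial, the other remains as an integrable majorant.\<close>

lemma poly_gauss_bound:
  assumes "real_polynomial_function P"
  obtains C where "C \<ge> 0" "\<And>x. \<bar>poly_gauss P x\<bar> \<le> C * exp (- (norm x)\<^sup>2 / 8)" "\<And>x. \<bar>poly_gauss P x\<bar> \<le> C"
proof -
  obtain C k where C: "C \<ge> 0" "\<And>x. \<bar>P x\<bar> \<le> C * (1 + norm x) ^ k"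
    using real_polynomial_function_bound[OF assms] by blast
  have 1: "\<bar>poly_gauss P x\<bar> \<le> C * fact k * exp 3 * exp (- (norm x)\<^sup>2 / 8)" for x
  proof -
    have "\<bar>poly_gauss P x\<bar> = \<bar>P x\<bar> * exp (- (norm x)\<^sup>2 / 8) * exp (- (norm x)\<^sup>2 / 8)"
      by (simp add: poly_gauss_def abs_mult flip: exp_add)
    also have "\<dots> \<le> C * ((1 + norm x) ^ k * exp (- (norm x)\<^sup>2 / 8)) * exp (- (norm x)\<^sup>2 / 8)"
      unfolding mult.assoc[symmetric, of C] by (intro mult_right_mono C) auto
    also have "\<dots> \<le> C * (fact k * exp 3) * exp (- (norm x)\<^sup>2 / 8)"
      by (intro mult_right_mono mult_left_mono power_exp_neg_square_bounded C) auto
    finally show ?thesis by (simp add: mult.assoc)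
  qed
  have 2: "\<bar>poly_gauss P x\<bar> \<le> C * fact k * exp 3" for x
  proof -
    have "C * fact k * exp 3 * exp (- (norm x)\<^sup>2 / 8) \<le> C * fact k * exp 3 * 1"
      using C(1) by (intro mult_left_mono) auto
    with 1[of x] show ?thesis by simp
  qed
  show thesis by (rule that[of "C * fact k * exp 3"]) (use C(1) 1 2 in auto)
qed

lemma poly_gauss_measurable [measurable]:
  assumes "real_polynomial_function P"
  shows "poly_gauss P \<in> borel_measurable borel"
proof -
  have "continuous_on UNIV P"
    using assms continuous_on_polymonial_function real_polynomial_function_eq by blast
  then have [measurable]: "P \<in> borel_measurable borel" by (rule borel_measurable_continuous_onI)
  show ?thesis unfolding poly_gauss_def[abs_def] by measurable
qed

lemma poly_gauss_integrable:
  fixes P :: "'a::euclidean_space \<Rightarrow> real"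
  assumes "real_polynomial_function P"
  shows "integrable lborel (poly_gauss P)"
proof -
  obtain C where C: "C \<ge> 0" "\<And>x. \<bar>poly_gauss P x\<bar> \<le> C * exp (- (norm x)\<^sup>2 / 8)" "\<And>x. \<bar>poly_gauss P x\<bar> \<le> C"
    by (rule poly_gauss_bound[OF assms], rule that)
  have "integrable lborel (\<lambda>x::'a. complex_of_real (exp (- (1/8) * (norm x)\<^sup>2)))"
    using exp_sq_fourier_integrable[of "1/8" "0::'a"] by simp
  then have "integrable lborel (\<lambda>x::'a. exp (- (1/8) * (norm x)\<^sup>2))"
    using complex_of_real_integrable_eq by blast
  then have "integrable lborel (\<lambda>x::'a. C * exp (- (norm x)\<^sup>2 / 8))"
    by (intro integrable_mult_right) simp
  then show ?thesis
  proof (rule Bochner_Integration.integrable_bound)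
    show "poly_gauss P \<in> borel_measurable lborel" using poly_gauss_measurable[OF assms] by simp
    show "AE x in lborel. norm (poly_gauss P x) \<le> norm (C * exp (- (norm x)\<^sup>2 / 8))"
      unfolding real_norm_def using C(2) by (intro AE_I2 order_trans[OF C(2) abs_ge_self])
  qed
qed

lemma poly_gauss_derivative:
  fixes P :: "'a::euclidean_space \<Rightarrow> real"
  assumes "real_polynomial_function P"
  obtains Q where "\<And>b. real_polynomial_function (Q b)"
    "\<And>x. (poly_gauss P has_derivative (\<lambda>h. \<Sum>b\<in>Basis. (h \<bullet> b) * poly_gauss (Q b) x)) (at x)"
proof -
  obtain D where D: "\<And>x. (P has_derivative D x) (at x)" "\<And>h. real_polynomial_function (\<lambda>x. D x h)"
    using real_polynomial_function_derivative[OF assms] by blast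
  \<comment> \<open>The second summand is the derivative of -|x|^2/4 in direction \<open>b\<close>,
    namely -(x \<bullet> b)/2.\<close>
  define Q where "Q b x = D x b - P x * ((x \<bullet> b) / 2)" for b x
  have 1: "real_polynomial_function (Q b)" for b
    unfolding Q_def[abs_def]
    by (intro real_polynomial_function_diff D(2) real_polynomial_function.intros(4) assms
        real_polynomial_function.intros(1) bounded_linear_divide[THEN bounded_linear_compose] bounded_linear_inner_left)
  have 2: "(poly_gauss P has_derivative (\<lambda>h. \<Sum>b\<in>Basis. (h \<bullet> b) * poly_gauss (Q b) x)) (at x)" for x
  proof -
    have "((\<lambda>x. P x * exp (- (x \<bullet> x) / 4)) has_derivative
       (\<lambda>h. P x * (exp (- (x \<bullet> x) / 4) * (- (x \<bullet> h + h \<bullet> x) / 4)) + D x h * exp (- (x \<bullet> x) / 4))) (at x)"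
      by (auto intro!: derivative_eq_intros D simp: fun_eq_iff field_simps)
    also have "(\<lambda>h. P x * (exp (- (x \<bullet> x) / 4) * (- (x \<bullet> h + h \<bullet> x) / 4)) + D x h * exp (- (x \<bullet> x) / 4))
       = (\<lambda>h. \<Sum>b\<in>Basis. (h \<bullet> b) * poly_gauss (Q b) x)"
    proof
      fix h
      interpret D: bounded_linear "D x" using D(1) by (rule has_derivative_bounded_linear)
      have "D x h = D x (\<Sum>b\<in>Basis. (h \<bullet> b) *\<^sub>R b)" by (simp add: euclidean_representation)
      also have "\<dots> = (\<Sum>b\<in>Basis. (h \<bullet> b) * D x b)" by (simp add: D.sum D.scaleR)
      finally have 1: "D x h = (\<Sum>b\<in>Basis. (h \<bullet> b) * D x b)" .
      have 2: "x \<bullet> h = (\<Sum>b\<in>Basis. (h \<bullet> b) * (x \<bullet> b))"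
        unfolding euclidean_inner[of x h] by (simp add: mult.commute)
      have "P x * (exp (- (x \<bullet> x) / 4) * (- (x \<bullet> h + h \<bullet> x) / 4)) + D x h * exp (- (x \<bullet> x) / 4)
        = (D x h - P x / 2 * (x \<bullet> h)) * exp (- (x \<bullet> x) / 4)"
        by (simp add: inner_commute[of h x] algebra_simps)
      also have "D x h - P x / 2 * (x \<bullet> h) = (\<Sum>b\<in>Basis. (h \<bullet> b) * Q b x)"
        unfolding 1 2 Q_def by (simp add: sum_distrib_left sum_subtractf algebra_simps)
      finally show "P x * (exp (- (x \<bullet> x) / 4) * (- (x \<bullet> h + h \<bullet> x) / 4)) + D x h * exp (- (x \<bullet> x) / 4)
         = (\<Sum>b\<in>Basis. (h \<bullet> b) * poly_gauss (Q b) x)"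
        by (simp add: poly_gauss_def power2_norm_eq_inner sum_distrib_right mult.assoc)
    qed
    finally show ?thesis
      by (simp add: poly_gauss_def[abs_def] power2_norm_eq_inner)
  qed
  show thesis using that[OF 1 2] .
qed

text \<open>The partial derivatives lie in the same class and are therefore bounded. Applied to
  these derivatives in turn, the lemma controls the second-order Taylor remainder.\<close>

lemma poly_gauss_lipschitz:
  fixes P :: "'a::euclidean_space \<Rightarrow> real"
  assumes "real_polynomial_function P"
  obtains L where "L \<ge> 0" "\<And>x y. \<bar>poly_gauss P x - poly_gauss P y\<bar> \<le> L * norm (x - y)"
proof -
  obtain Q where Q: "\<And>b. real_polynomial_function (Q b)"
    "\<And>x. (poly_gauss P has_derivative (\<lambda>h. \<Sum>b\<in>Basis. (h \<bullet> b) * poly_gauss (Q b) x)) (at x)"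
    using poly_gauss_derivative[OF assms] by blast
  have "\<forall>b. \<exists>C\<ge>0. \<forall>x. \<bar>poly_gauss (Q b) x\<bar> \<le> C" using poly_gauss_bound[OF Q(1)] by metis
  then obtain C where C: "\<And>b. C b \<ge> 0" "\<And>b x. \<bar>poly_gauss (Q b) x\<bar> \<le> C b" by metis
  define L where "L = (\<Sum>b\<in>Basis. C b)"
  have "norm (poly_gauss P x - poly_gauss P y) \<le> L * norm (x - y)" for x y
  proof (rule differentiable_bound[of UNIV])
    show "onorm (\<lambda>h. \<Sum>b\<in>Basis. (h \<bullet> b) * poly_gauss (Q b) x) \<le> L" for x
    proof (rule onorm_bound)
      fix h
      have "norm (\<Sum>b\<in>Basis. (h \<bullet> b) * poly_gauss (Q b) x) \<le> (\<Sum>b\<in>Basis. norm h * C b)"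
        unfolding real_norm_def
      proof (rule order_trans[OF sum_abs], intro sum_mono)
        fix b :: 'a assume "b \<in> Basis"
        then show "\<bar>(h \<bullet> b) * poly_gauss (Q b) x\<bar> \<le> norm h * C b"
          unfolding abs_mult by (intro mult_mono Basis_le_norm C) auto
      qed
      then show "norm (\<Sum>b\<in>Basis. (h \<bullet> b) * poly_gauss (Q b) x) \<le> L * norm h"
        by (simp add: L_def sum_distrib_left mult.commute)
    qed (simp add: L_def C sum_nonneg)
  qed (use Q(2) in auto)
  then show thesis using that[of L] C by (auto simp: L_def sum_nonneg)
qed

lemma poly_gauss_convolve_integrand:
  fixes P :: "'a::euclidean_space \<Rightarrow> real"
  assumes P: "real_polynomial_function P" and \<psi>: "integrable lborel \<psi>"
  shows "integrable lborel (\<lambda>y. poly_gauss P (x - y) * \<psi> y)"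
proof -
  have [measurable]: "\<psi> \<in> borel_measurable borel" "poly_gauss P \<in> borel_measurable borel"
    using \<psi> poly_gauss_measurable[OF P] by auto
  obtain C where C: "C \<ge> 0" "\<And>x. \<bar>poly_gauss P x\<bar> \<le> C * exp (- (norm x)\<^sup>2 / 8)" "\<And>x. \<bar>poly_gauss P x\<bar> \<le> C"
    by (rule poly_gauss_bound[OF P], rule that)
  have "integrable lborel (\<lambda>y. C * \<psi> y)" using \<psi> by (rule integrable_mult_right)
  then show ?thesis
  proof (rule Bochner_Integration.integrable_bound)
    show "AE y in lborel. norm (poly_gauss P (x - y) * \<psi> y) \<le> norm (C * \<psi> y)"
      using C(1,3) by (auto simp: abs_mult intro!: mult_right_mono)
  qed measurable
qed

text \<open>The Taylor remainder of the kernel is at most K |z - x|^2 with \<open>K\<close>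
  independent of the point, so it can be integrated against |\<psi>|. Differentiation under the
  integral follows for every integrable \<psi>.\<close>

lemma poly_gauss_convolve_derivative:
  fixes P :: "'a::euclidean_space \<Rightarrow> real"
  assumes P: "real_polynomial_function P" and \<psi>: "integrable lborel \<psi>"
  obtains Q where "\<And>b. real_polynomial_function (Q b)"
    "\<And>x. (convolve (poly_gauss P) \<psi> has_derivative (\<lambda>h. \<Sum>b\<in>Basis. (h \<bullet> b) * convolve (poly_gauss (Q b)) \<psi> x)) (at x)"
proof -
  obtain Q where Q: "\<And>b. real_polynomial_function (Q b)"
    "\<And>x. (poly_gauss P has_derivative (\<lambda>h. \<Sum>b\<in>Basis. (h \<bullet> b) * poly_gauss (Q b) x)) (at x)"
    using poly_gauss_derivative[OF P] by blast
  have "\<forall>b. \<exists>L\<ge>0. \<forall>x y. \<bar>poly_gauss (Q b) x - poly_gauss (Q b) y\<bar> \<le> L * norm (x - y)"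
    using poly_gauss_lipschitz[OF Q(1)] by metis
  then obtain L where L: "\<And>b. L b \<ge> 0" "\<And>b x y. \<bar>poly_gauss (Q b) x - poly_gauss (Q b) y\<bar> \<le> L b * norm (x - y)"
    by metis
  define K where "K = (\<Sum>b\<in>Basis. L b)"
  have K0: "K \<ge> 0" using L by (simp add: K_def sum_nonneg)
  have taylor: "\<bar>poly_gauss P z - poly_gauss P x - (\<Sum>b\<in>Basis. ((z - x) \<bullet> b) * poly_gauss (Q b) x)\<bar>
      \<le> K * (norm (z - x))\<^sup>2" for x z
  proof -
    have "norm (poly_gauss P z - poly_gauss P x - (\<lambda>h. \<Sum>b\<in>Basis. (h \<bullet> b) * poly_gauss (Q b) x) (z - x))
      \<le> norm (z - x) * (K * norm (z - x))"
    proof (rule differentiable_bound_linearization[where S="cball x (norm (z - x))"])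
      fix y assume y: "y \<in> cball x (norm (z - x))"
      show "onorm ((\<lambda>h. \<Sum>b\<in>Basis. (h \<bullet> b) * poly_gauss (Q b) y) - (\<lambda>h. \<Sum>b\<in>Basis. (h \<bullet> b) * poly_gauss (Q b) x))
        \<le> K * norm (z - x)"
      proof (rule onorm_bound)
        fix h
        have "norm (\<Sum>b\<in>Basis. (h \<bullet> b) * (poly_gauss (Q b) y - poly_gauss (Q b) x)) \<le> (\<Sum>b\<in>Basis. norm h * (L b * norm (z - x)))"
        proof (intro sum_norm_le)
          fix b :: 'a assume b: "b \<in> Basis"
          have "\<bar>poly_gauss (Q b) y - poly_gauss (Q b) x\<bar> \<le> L b * norm (y - x)" by (rule L)
          also have "\<dots> \<le> L b * norm (z - x)"
            using y L(1)[of b] by (intro mult_left_mono) (auto simp: dist_norm norm_minus_commute)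
          finally show "norm ((h \<bullet> b) * (poly_gauss (Q b) y - poly_gauss (Q b) x)) \<le> norm h * (L b * norm (z - x))"
            using Basis_le_norm[OF b, of h] by (simp add: abs_mult mult_mono)
        qed
        also have "\<dots> = K * norm (z - x) * norm h"
          by (simp add: K_def sum_distrib_left sum_distrib_right mult_ac)
        finally show "norm (((\<lambda>h. \<Sum>b\<in>Basis. (h \<bullet> b) * poly_gauss (Q b) y) - (\<lambda>h. \<Sum>b\<in>Basis. (h \<bullet> b) * poly_gauss (Q b) x)) h)
          \<le> K * norm (z - x) * norm h"
          by (simp add: sum_subtractf right_diff_distrib)
      qed (use K0 in simp)
    next
      fix t :: real assume t: "t \<in> {0..1}"
      then have "\<bar>t\<bar> * norm (z - x) \<le> norm (z - x)" by (intro mult_left_le_one_le) auto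
      then show "x + t *\<^sub>R (z - x) \<in> cball x (norm (z - x))" by (simp add: dist_norm)
    qed (auto intro: has_derivative_at_withinI[OF Q(2)])
    then show ?thesis by (simp add: power2_eq_square mult_ac)
  qed
  define N where "N = (\<integral>y. \<bar>\<psi> y\<bar> \<partial>lborel)"
  have N0: "N \<ge> 0" by (simp add: N_def)
  have main: "\<bar>convolve (poly_gauss P) \<psi> z - convolve (poly_gauss P) \<psi> x
       - (\<Sum>b\<in>Basis. ((z - x) \<bullet> b) * convolve (poly_gauss (Q b)) \<psi> x)\<bar> \<le> K * (norm (z - x))\<^sup>2 * N" for x z
  proof -
    note I = poly_gauss_convolve_integrand[OF P \<psi>] poly_gauss_convolve_integrand[OF Q(1) \<psi>]
    have "convolve (poly_gauss P) \<psi> z - convolve (poly_gauss P) \<psi> x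
       - (\<Sum>b\<in>Basis. ((z - x) \<bullet> b) * convolve (poly_gauss (Q b)) \<psi> x)
      = (\<integral>y. poly_gauss P (z - y) * \<psi> y - poly_gauss P (x - y) * \<psi> y
         - (\<Sum>b\<in>Basis. ((z - x) \<bullet> b) * (poly_gauss (Q b) (x - y) * \<psi> y)) \<partial>lborel)"
      unfolding convolve_def
      using I by (simp add: Bochner_Integration.integral_diff Bochner_Integration.integrable_diff
          Bochner_Integration.integrable_sum Bochner_Integration.integral_sum)
    also have "\<bar>\<dots>\<bar> \<le> (\<integral>y. K * (norm (z - x))\<^sup>2 * \<bar>\<psi> y\<bar> \<partial>lborel)"
    proof (rule integral_abs_bound[THEN order_trans], rule integral_mono')
      show "integrable lborel (\<lambda>y. K * (norm (z - x))\<^sup>2 * \<bar>\<psi> y\<bar>)"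
        using \<psi> by (intro integrable_mult_right) simp
      fix y
      have "\<bar>poly_gauss P (z - y) * \<psi> y - poly_gauss P (x - y) * \<psi> y
         - (\<Sum>b\<in>Basis. ((z - x) \<bullet> b) * (poly_gauss (Q b) (x - y) * \<psi> y))\<bar>
        = \<bar>poly_gauss P (z - y) - poly_gauss P (x - y)
         - (\<Sum>b\<in>Basis. (((z - y) - (x - y)) \<bullet> b) * poly_gauss (Q b) (x - y))\<bar> * \<bar>\<psi> y\<bar>"
        unfolding abs_mult[symmetric] by (simp add: left_diff_distrib sum_distrib_right mult.assoc)
      also have "\<dots> \<le> K * (norm (z - x))\<^sup>2 * \<bar>\<psi> y\<bar>"
        using taylor[of "z - y" "x - y"] by (intro mult_right_mono) auto
      finally show "\<bar>poly_gauss P (z - y) * \<psi> y - poly_gauss P (x - y) * \<psi> y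
         - (\<Sum>b\<in>Basis. ((z - x) \<bullet> b) * (poly_gauss (Q b) (x - y) * \<psi> y))\<bar> \<le> K * (norm (z - x))\<^sup>2 * \<bar>\<psi> y\<bar>" .
    qed (use K0 in simp)
    also have "\<dots> = K * (norm (z - x))\<^sup>2 * N" by (simp add: N_def)
    finally show ?thesis .
  qed
  have "(convolve (poly_gauss P) \<psi> has_derivative (\<lambda>h. \<Sum>b\<in>Basis. (h \<bullet> b) * convolve (poly_gauss (Q b)) \<psi> x)) (at x)" for x
    unfolding has_derivative_at'
  proof (intro conjI allI impI)
    show "bounded_linear (\<lambda>h. \<Sum>b\<in>Basis. (h \<bullet> b) * convolve (poly_gauss (Q b)) \<psi> x)"
      by (intro bounded_linear_sum bounded_linear_mult_const bounded_linear_inner_left)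
    fix e :: real assume e: "e > 0"
    \<comment> \<open>The summand 1 prevents division by zero when \<open>K * N\<close>
      vanishes.\<close>
    define d where "d = e / (K * N + 1)"
    have KN: "K * N + 1 > 0" using K0 N0 by (simp add: add_nonneg_pos)
    have d: "d > 0" using e KN by (simp add: d_def)
    have "norm (convolve (poly_gauss P) \<psi> z - convolve (poly_gauss P) \<psi> x
       - (\<Sum>b\<in>Basis. ((z - x) \<bullet> b) * convolve (poly_gauss (Q b)) \<psi> x)) / norm (z - x) < e"
      if z: "0 < norm (z - x)" "norm (z - x) < d" for z
    proof -
      have "norm (convolve (poly_gauss P) \<psi> z - convolve (poly_gauss P) \<psi> x
         - (\<Sum>b\<in>Basis. ((z - x) \<bullet> b) * convolve (poly_gauss (Q b)) \<psi> x)) / norm (z - x)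
        \<le> (K * N) * norm (z - x)"
        using main[of z x] z(1) by (simp add: divide_le_eq power2_eq_square mult_ac)
      also have "\<dots> \<le> (K * N + 1) * norm (z - x)" by (intro mult_right_mono) auto
      also have "\<dots> < (K * N + 1) * d" using z(2) KN by (rule mult_strict_left_mono)
      also have "\<dots> = e" using KN by (simp add: d_def)
      finally show ?thesis .
    qed
    then show "\<exists>d>0. \<forall>z. 0 < norm (z - x) \<and> norm (z - x) < d \<longrightarrow>
       norm (convolve (poly_gauss P) \<psi> z - convolve (poly_gauss P) \<psi> x
       - (\<Sum>b\<in>Basis. ((z - x) \<bullet> b) * convolve (poly_gauss (Q b)) \<psi> x)) / norm (z - x) < e"
      using d by blast
  qed
  then show thesis using that[of Q] Q(1) by blast
qed

lemma poly_gauss_convolve_bounded: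
  fixes P :: "'a::euclidean_space \<Rightarrow> real"
  assumes P: "real_polynomial_function P" and \<psi>: "integrable lborel \<psi>"
  shows "bounded (range (convolve (poly_gauss P) \<psi>))"
proof -
  obtain C where C: "C \<ge> 0" "\<And>x. \<bar>poly_gauss P x\<bar> \<le> C * exp (- (norm x)\<^sup>2 / 8)" "\<And>x. \<bar>poly_gauss P x\<bar> \<le> C"
    by (rule poly_gauss_bound[OF P], rule that)
  have "norm (convolve (poly_gauss P) \<psi> x) \<le> (\<integral>y. C * \<bar>\<psi> y\<bar> \<partial>lborel)" for x
    unfolding convolve_def real_norm_def
  proof (rule integral_abs_bound[THEN order_trans], rule integral_mono')
    show "integrable lborel (\<lambda>y. C * \<bar>\<psi> y\<bar>)" using \<psi> by (intro integrable_mult_right) simp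
  qed (use C(1,3) in \<open>auto simp: abs_mult intro!: mult_right_mono\<close>)
  then show ?thesis by (auto simp: bounded_iff)
qed

text \<open>All derivatives fall on the kernel: each iterated partial derivative is again the
  convolution of \<psi> with some \<open>poly_gauss Q\<close>, which is integrable, bounded and
  differentiable.\<close>

lemma poly_gauss_convolve_space_test:
  fixes P :: "'a::euclidean_space \<Rightarrow> real"
  assumes P: "real_polynomial_function P" and \<psi>: "integrable lborel \<psi>"
  shows "space_test (convolve (poly_gauss P) \<psi>)"
proof -
  have *: "\<exists>Q. real_polynomial_function Q \<and> iter_partial bs (convolve (poly_gauss P) \<psi>) = convolve (poly_gauss Q) \<psi>"
    if "set bs \<subseteq> Basis" for bs
    using that
  proof (induction bs)
    case Nil
    then show ?case using P by auto
  next
    case (Cons b bs)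
    then obtain R where R: "real_polynomial_function R" "iter_partial bs (convolve (poly_gauss P) \<psi>) = convolve (poly_gauss R) \<psi>"
      by auto
    obtain Q where Q: "\<And>b. real_polynomial_function (Q b)"
      "\<And>x. (convolve (poly_gauss R) \<psi> has_derivative (\<lambda>h. \<Sum>b\<in>Basis. (h \<bullet> b) * convolve (poly_gauss (Q b)) \<psi> x)) (at x)"
      using poly_gauss_convolve_derivative[OF R(1) \<psi>] by blast
    have "iter_partial (b # bs) (convolve (poly_gauss P) \<psi>) = convolve (poly_gauss (Q b)) \<psi>"
    proof
      fix x
      have "iter_partial (b # bs) (convolve (poly_gauss P) \<psi>) x = (\<Sum>c\<in>Basis. (b \<bullet> c) * convolve (poly_gauss (Q c)) \<psi> x)"
        using frechet_derivative_at[OF Q(2)] by (simp add: R(2) fun_eq_iff)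
      also have "\<dots> = (\<Sum>c\<in>Basis. if c = b then convolve (poly_gauss (Q c)) \<psi> x else 0)"
        using Cons.prems by (intro sum.cong) (auto simp: inner_Basis)
      also have "\<dots> = convolve (poly_gauss (Q b)) \<psi> x" using Cons.prems by simp
      finally show "iter_partial (b # bs) (convolve (poly_gauss P) \<psi>) x = convolve (poly_gauss (Q b)) \<psi> x" .
    qed
    then show ?case using Q(1) by blast
  qed
  show ?thesis
    unfolding space_test_def smooth_def
  proof (intro conjI allI impI)
    fix bs :: "'a list" and x assume bs: "set bs \<subseteq> Basis"
    obtain Q where Q: "real_polynomial_function Q" "iter_partial bs (convolve (poly_gauss P) \<psi>) = convolve (poly_gauss Q) \<psi>"
      using *[OF bs] by blast
    obtain R where "\<And>b. real_polynomial_function (R b)"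
      "\<And>x. (convolve (poly_gauss Q) \<psi> has_derivative (\<lambda>h. \<Sum>b\<in>Basis. (h \<bullet> b) * convolve (poly_gauss (R b)) \<psi> x)) (at x)"
      by (rule poly_gauss_convolve_derivative[OF Q(1) \<psi>], rule that)
    then show "iter_partial bs (convolve (poly_gauss P) \<psi>) differentiable at x"
      unfolding Q(2) differentiable_def by blast
  next
    fix bs :: "'a list" assume bs: "set bs \<subseteq> Basis"
    obtain Q where Q: "real_polynomial_function Q" "iter_partial bs (convolve (poly_gauss P) \<psi>) = convolve (poly_gauss Q) \<psi>"
      using *[OF bs] by blast
    show "integrable lborel (iter_partial bs (convolve (poly_gauss P) \<psi>))"
      unfolding Q(2) by (rule convolve_integrable[OF poly_gauss_integrable[OF Q(1)] \<psi>])
    show "bounded (range (iter_partial bs (convolve (poly_gauss P) \<psi>)))"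
      unfolding Q(2) by (rule poly_gauss_convolve_bounded[OF Q(1) \<psi>])
  qed
qed

lemma heat_kernel_convolve_space_test:
  fixes \<psi> :: "'a::euclidean_space \<Rightarrow> real"
  assumes "integrable lborel \<psi>"
  shows "space_test (convolve (heat_kernel 1) \<psi>)"
proof -
  have "heat_kernel 1 = poly_gauss (\<lambda>x::'a. (4 * pi) powr (- real DIM('a) / 2))"
    by (simp add: fun_eq_iff heat_kernel_def poly_gauss_def)
  then show ?thesis
    using poly_gauss_convolve_space_test[OF real_polynomial_function.intros(2) assms] by simp
qed

section \<open>Test functions dominating their fractional Laplacians\<close>

lemma convolve_bounded_integrand:
  fixes f \<psi> :: "'a::euclidean_space \<Rightarrow> real"
  assumes f: "integrable lborel f" and [measurable]: "\<psi> \<in> borel_measurable borel"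
    and B: "\<And>x. \<bar>\<psi> x\<bar> \<le> B"
  shows "integrable lborel (\<lambda>y. f y * \<psi> (x - y))"
proof -
  have [measurable]: "f \<in> borel_measurable borel" using f by auto
  have "integrable lborel (\<lambda>y. f y * B)" using f by (rule integrable_mult_left)
  then show ?thesis
  proof (rule Bochner_Integration.integrable_bound)
    show "AE y in lborel. norm (f y * \<psi> (x - y)) \<le> norm (f y * B)"
      unfolding real_norm_def abs_mult
      by (intro AE_I2 mult_left_mono order_trans[OF B abs_ge_self]) simp
  qed measurable
qed

text \<open>\<open>convolve_lower_bound\<close> is applied twice, first to the Bessel kernel and
  then to the heat kernel; the other three facts show that the result of the first convolution
  satisfies the hypotheses for the second. The lower bound on \<open>f\<close> is required only
  almost everywhere because nothing better is available for the Bessel kernel.\<close>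

lemma
  fixes f \<psi> :: "'a::euclidean_space \<Rightarrow> real"
  assumes f: "integrable lborel f" and f0: "\<And>x. f x \<ge> 0"
    and \<psi>m: "\<psi> \<in> borel_measurable borel" and \<psi>0: "\<And>x. \<psi> x \<ge> 0" and B: "\<And>x. \<psi> x \<le> B"
    and C: "C > 0" and harnack: "\<And>x z. norm z \<le> 1 \<Longrightarrow> \<psi> x \<le> C * \<psi> (x - z)"
  shows convolve_nonneg: "convolve f \<psi> x \<ge> 0"
    and convolve_le_const: "convolve f \<psi> x \<le> B * (\<integral>y. f y \<partial>lborel)"
    and convolve_harnack: "norm z \<le> 1 \<Longrightarrow> convolve f \<psi> x \<le> C * convolve f \<psi> (x - z)"
    and convolve_lower_bound:
      "c \<ge> 0 \<Longrightarrow> AE y in lborel. norm y \<le> 1 \<longrightarrow> c \<le> f y \<Longrightarrow>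
         c * measure lborel (cball 0 1 :: 'a set) / C * \<psi> x \<le> convolve f \<psi> x"
proof -
  have [measurable]: "f \<in> borel_measurable borel" using f by auto
  note [measurable] = \<psi>m
  have absB: "\<bar>\<psi> x\<bar> \<le> B" for x using \<psi>0 B by simp
  note I = convolve_bounded_integrand[OF f \<psi>m absB]
  note alt = convolve_alt[of f \<psi>, simplified]
  show "convolve f \<psi> x \<ge> 0" by (simp add: alt f0 \<psi>0)
  have "convolve f \<psi> x \<le> (\<integral>y. B * f y \<partial>lborel)"
    unfolding alt using I f f0 B by (intro integral_mono) (auto simp: mult.commute[of B] intro!: mult_left_mono)
  then show "convolve f \<psi> x \<le> B * (\<integral>y. f y \<partial>lborel)" by simp
  show "convolve f \<psi> x \<le> C * convolve f \<psi> (x - z)" if z: "norm z \<le> 1"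
  proof -
    have "convolve f \<psi> x \<le> (\<integral>y. C * (f y * \<psi> (x - z - y)) \<partial>lborel)"
      unfolding alt
    proof (intro integral_mono I integrable_mult_right)
      fix y
      have "f y * \<psi> (x - y) \<le> f y * (C * \<psi> (x - y - z))"
        by (intro mult_left_mono harnack z f0)
      then show "f y * \<psi> (x - y) \<le> C * (f y * \<psi> (x - z - y))"
        by (simp add: mult_ac diff_diff_eq add.commute)
    qed
    then show ?thesis by (simp add: alt)
  qed
  show "c * measure lborel (cball 0 1 :: 'a set) / C * \<psi> x \<le> convolve f \<psi> x"
    if c: "c \<ge> 0" "AE y in lborel. norm y \<le> 1 \<longrightarrow> c \<le> f y"
  proof -
    have fin: "emeasure lborel (cball 0 1 :: 'a set) < \<infinity>" by (rule emeasure_lborel_cball_finite)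
    have "c * measure lborel (cball 0 1 :: 'a set) / C * \<psi> x
      = (\<integral>y. indicator (cball (0::'a) 1) y * (c * \<psi> x / C) \<partial>lborel)"
      using fin by simp
    also have "\<dots> \<le> (\<integral>y. f y * \<psi> (x - y) \<partial>lborel)"
    proof (intro integral_mono_AE I)
      show "integrable lborel (\<lambda>y. indicator (cball (0::'a) 1) y * (c * \<psi> x / C))"
        using fin by (intro integrable_mult_left integrable_real_indicator) simp_all
      show "AE y in lborel. indicator (cball 0 1) y * (c * \<psi> x / C) \<le> f y * \<psi> (x - y)"
        using c(2)
      proof eventually_elim
        fix y assume y: "norm y \<le> 1 \<longrightarrow> c \<le> f y"
        show "indicator (cball 0 1) y * (c * \<psi> x / C) \<le> f y * \<psi> (x - y)"
        proof (cases "norm y \<le> 1")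
          case True
          \<comment> \<open>By Harnack all values of \<psi> on the unit ball around \<open>x\<close>
            are at least \<psi> x / C, so the part of the convolution over |y| \<le> 1 alone
            reproduces a multiple of \<psi> x.\<close>
          have "\<psi> x / C \<le> \<psi> (x - y)" using harnack[OF True, of x] C by (simp add: pos_divide_le_eq mult.commute)
          then have "c * (\<psi> x / C) \<le> f y * \<psi> (x - y)"
            using y True c(1) f0 \<psi>0 C by (intro mult_mono) auto
          then show ?thesis using True by simp
        next
          case False
          then show ?thesis using f0 \<psi>0 by simp
        qed
      qed
    qed
    finally show ?thesis by (simp add: alt)
  qed
qed

text \<open>The range of \<open>s\<close> covers both applications: s = 1 for the outer convolution,
  and all of [1, 2] for the mixture defining the Bessel kernel.\<close>

lemma heat_kernel_lower_bound:
  fixes x :: "'a::euclidean_space"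
  assumes s: "1 \<le> s" "s \<le> 2" and x: "norm x \<le> 1"
  shows "(8 * pi) powr (- real DIM('a) / 2) * exp (- 1) \<le> heat_kernel s x"
  unfolding heat_kernel_def
proof (intro mult_mono)
  show "(8 * pi) powr (- real DIM('a) / 2) \<le> (4 * pi * s) powr (- real DIM('a) / 2)"
    using s by (intro powr_mono2') auto
  have "(norm x)\<^sup>2 \<le> 1" using x by (simp add: power_le_one)
  then have "(norm x)\<^sup>2 / (4 * s) \<le> 1" using s by (simp add: divide_le_eq)
  then show "exp (- 1) \<le> exp (- (norm x)\<^sup>2 / (4 * s))" by simp
qed auto

text \<open>Only the times t in [1, 2] of the mixture are kept. The bound is almost everywhere
  because the integral over \<open>t\<close> is known to converge only for almost every
  \<open>x\<close>; for M \<le> n/2 it diverges at the origin, where \<open>heat_mix\<close> then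
  takes the default value 0.\<close>

lemma bessel_lower_bound:
  assumes M: "M \<ge> 1"
  obtains c where "c > 0"
    "AE x in (lborel :: 'a::euclidean_space measure). norm x \<le> 1 \<longrightarrow> c \<le> heat_mix (gamma_weight M) 0 x"
proof -
  define d where "d = (8 * pi) powr (- real DIM('a) / 2) * exp (- 1)"
  define c where "c = exp (- 2) / Gamma M * d"
  have G: "Gamma M > 0" using M by (intro Gamma_real_pos) simp
  have d: "d > 0" by (simp add: d_def)
  have M0: "M > 0" using M by simp
  have "integrable (lborel \<Otimes>\<^sub>M lborel) (\<lambda>(t, x::'a). 1 * complex_of_real (gamma_weight M t * heat_kernel (0 + t) x))"
    by (rule heat_mix_pair_integrable[OF gamma_weight_integrable0[OF M0]]) simp_all
  from lborel_pair.AE_integrable_snd[OF this]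
  have "AE x in (lborel :: 'a measure). integrable lborel (\<lambda>t. complex_of_real (gamma_weight M t * heat_kernel t x))"
    by simp
  then have "AE x in (lborel :: 'a measure). norm x \<le> 1 \<longrightarrow> c \<le> heat_mix (gamma_weight M) 0 x"
  proof eventually_elim
    fix x :: 'a assume "integrable lborel (\<lambda>t. complex_of_real (gamma_weight M t * heat_kernel t x))"
    then have I: "integrable lborel (\<lambda>t. gamma_weight M t * heat_kernel t x)"
      using complex_of_real_integrable_eq by blast
    show "norm x \<le> 1 \<longrightarrow> c \<le> heat_mix (gamma_weight M) 0 x"
    proof
      assume x: "norm x \<le> 1"
      have "c = (\<integral>t. indicator {1..2::real} t * c \<partial>lborel)" by simp
      also have "\<dots> \<le> (\<integral>t. gamma_weight M t * heat_kernel t x \<partial>lborel)"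
      proof (intro integral_mono I)
        show "integrable lborel (\<lambda>t. indicator {1..2::real} t * c)"
          by (intro integrable_mult_left integrable_real_indicator) simp_all
        fix t :: real
        show "indicator {1..2::real} t * c \<le> gamma_weight M t * heat_kernel t x"
        proof (cases "t \<in> {1..2}")
          case True
          have "1 * exp (- 2) \<le> t powr (M - 1) * exp (- t)"
            \<comment> \<open>M \<ge> 1 and t \<ge> 1 give t^(M-1) \<ge> 1, and t \<le> 2 gives the
              factor exp(-2) in \<open>c\<close>.\<close>
            using True M by (intro mult_mono ge_one_powr_ge_zero) auto
          then have "exp (- 2) / Gamma M \<le> gamma_weight M t"
            using True G by (simp add: gamma_weight_def divide_right_mono)
          moreover have "d \<le> heat_kernel t x"
            unfolding d_def using True x by (intro heat_kernel_lower_bound) auto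
          ultimately have "c \<le> gamma_weight M t * heat_kernel t x"
            unfolding c_def using d gamma_weight_nonneg[OF M0] by (intro mult_mono) auto
          then show ?thesis using True by simp
        next
          case False
          then show ?thesis using gamma_weight_nonneg[OF M0] heat_kernel_nonneg[of t x] by simp
        qed
      qed
      also have "\<dots> = heat_mix (gamma_weight M) 0 x" by (simp add: heat_mix_def)
      finally show "c \<le> heat_mix (gamma_weight M) 0 x" .
    qed
  qed
  then show thesis using that[of c] G d by (simp add: c_def)
qed

text \<open>The choices are made in the order kernels, \<kappa>, \<psi>, \<phi>. The resulting chain
  is |(-Laplace)^a \<phi>| = |k_a * \<psi>| \<le> \<kappa> * \<psi> \<le> L \<psi> \<le> (L / K)
  \<phi>, where the last inequality uses a lower bound for each of the two convolutions that lead
  from \<psi> to \<phi>.\<close>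

lemma frac_laplacian_test_function:
  fixes A :: "real set"
  assumes A: "finite A" "\<And>a. a \<in> A \<Longrightarrow> a \<ge> 0"
  obtains \<phi> :: "'a::euclidean_space \<Rightarrow> real" and C where "space_test \<phi>" "\<And>x. \<phi> x > 0" "C > 0"
    "\<And>a x. a \<in> A \<Longrightarrow> \<bar>frac_laplacian a \<phi> x\<bar> \<le> C * \<phi> x"
proof -
  \<comment> \<open>The summand 1 makes a < M strict on \<open>A\<close>; inserting 1 guarantees M
    \<ge> 1 for \<open>bessel_lower_bound\<close> and a nonempty set for \<open>Max\<close>.\<close>
  define M where "M = Max (insert 1 A) + 1"
  have max: "a \<le> M - 1" if "a \<in> insert 1 A" for a
    unfolding M_def using A that Max_ge[of "insert 1 A" a] by auto
  have M1: "M \<ge> 1" using max[of 1] by simp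
  have MA: "a < M" if "a \<in> A" for a using max[of a] that by simp
  have M0: "M > 0" using M1 by simp
  define b :: "'a \<Rightarrow> real" where "b = heat_mix (gamma_weight M) 0"
  let ?R = "\<lambda>a k. integrable lborel k \<and> (\<forall>\<psi> x. integrable lborel \<psi> \<longrightarrow>
       frac_laplacian a (convolve (heat_kernel 1) (convolve b \<psi>)) x = convolve k \<psi> x)"
  have "\<exists>k :: 'a \<Rightarrow> real. ?R a k" if a: "a \<in> A" for a
  proof -
    obtain k :: "'a \<Rightarrow> real" where "integrable lborel k"
      "\<And>\<psi> x. integrable lborel \<psi> \<Longrightarrow>
       frac_laplacian a (convolve (heat_kernel 1) (convolve (heat_mix (gamma_weight M) 0) \<psi>)) x = convolve k \<psi> x"
      by (rule frac_laplacian_bessel[OF A(2)[OF a] MA[OF a]], rule that)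
    then show ?thesis unfolding b_def by blast
  qed
  then have "\<forall>a\<in>A. \<exists>k. ?R a k" by blast
  from bchoice[OF this] obtain k where kR: "\<forall>a\<in>A. ?R a (k a)" ..
  have k: "\<And>a. a \<in> A \<Longrightarrow> integrable lborel (k a)"
    and kF: "\<And>a \<psi> x. a \<in> A \<Longrightarrow> integrable lborel \<psi> \<Longrightarrow>
       frac_laplacian a (convolve (heat_kernel 1) (convolve b \<psi>)) x = convolve (k a) \<psi> x"
    using kR by simp_all
  define \<kappa> where "\<kappa> x = (\<Sum>a\<in>A. \<bar>k a x\<bar>)" for x
  have \<kappa>: "integrable lborel \<kappa>"
    unfolding \<kappa>_def[abs_def] using k by (intro Bochner_Integration.integrable_sum) auto
  have \<kappa>0: "\<kappa> x \<ge> 0" for x by (simp add: \<kappa>_def sum_nonneg)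
  obtain \<psi> L C where \<psi>: "integrable lborel \<psi>" "\<And>x. \<psi> x > 0" "\<And>x. \<psi> x \<le> 2" "L > 0" "C > 0"
    "\<And>x. (\<integral>\<^sup>+y. ennreal (\<kappa> y * \<psi> (x - y)) \<partial>lborel) \<le> ennreal (L * \<psi> x)"
    "\<And>x z. norm z \<le> 1 \<Longrightarrow> \<psi> x \<le> C * \<psi> (x - z)"
    by (rule neumann_supersolution[OF \<kappa> \<kappa>0], rule that)
  have \<psi>m [measurable]: "\<psi> \<in> borel_measurable borel" using \<psi>(1) by auto
  have \<psi>0: "\<psi> x \<ge> 0" for x using \<psi>(2)[of x] by simp
  have \<psi>B: "\<bar>\<psi> x\<bar> \<le> 2" for x using \<psi>0 \<psi>(3) by simp
  have bI: "integrable lborel b"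
    unfolding b_def by (rule heat_mix_integrable[OF gamma_weight_integrable0[OF M0]]) simp_all
  have b0: "b x \<ge> 0" for x
    unfolding b_def heat_mix_def by (simp add: heat_kernel_nonneg gamma_weight_nonneg[OF M0])
  obtain c1 where c1: "c1 > 0" and c1': "AE x in lborel. norm (x::'a) \<le> 1 \<longrightarrow> c1 \<le> heat_mix (gamma_weight M) 0 x"
    by (rule bessel_lower_bound[OF M1], rule that)
  note c1b = c1'[folded b_def]
  define m where "m = measure lborel (cball 0 1 :: 'a set)"
  have m: "m > 0" unfolding m_def by (simp add: content_cball_pos)
  define \<psi>2 where "\<psi>2 = convolve b \<psi>"
  note P = bI b0 \<psi>m \<psi>0 \<psi>(3) \<psi>(5,7)
  have \<psi>2: "integrable lborel \<psi>2" unfolding \<psi>2_def by (rule convolve_integrable[OF bI \<psi>(1)])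
  have \<psi>2m: "\<psi>2 \<in> borel_measurable borel" using \<psi>2 by auto
  have low1: "c1 * m / C * \<psi> x \<le> \<psi>2 x" for x
    unfolding \<psi>2_def m_def using c1 c1b by (intro convolve_lower_bound[OF P]) auto
  have \<psi>20: "\<psi>2 x \<ge> 0" for x unfolding \<psi>2_def by (rule convolve_nonneg[OF P])
  have \<psi>2B: "\<psi>2 x \<le> 2 * (\<integral>y. b y \<partial>lborel)" for x unfolding \<psi>2_def by (rule convolve_le_const[OF P])
  have \<psi>2H: "\<psi>2 x \<le> C * \<psi>2 (x - z)" if "norm z \<le> 1" for x z
    unfolding \<psi>2_def by (rule convolve_harnack[OF P]) (use that in auto)
  define \<phi> where "\<phi> = convolve (heat_kernel 1) \<psi>2"
  define c2 where "c2 = (8 * pi) powr (- real DIM('a) / 2) * exp (- 1)"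
  have c2: "c2 > 0" by (simp add: c2_def)
  have low2: "c2 * m / C * \<psi>2 x \<le> \<phi> x" for x
    unfolding \<phi>_def m_def
  proof (rule convolve_lower_bound[OF heat_kernel_integrable heat_kernel_nonneg \<psi>2m \<psi>20 \<psi>2B \<psi>(5) \<psi>2H])
    show "AE y in lborel. norm (y::'a) \<le> 1 \<longrightarrow> c2 \<le> heat_kernel 1 y"
      unfolding c2_def using heat_kernel_lower_bound[of 1] by auto
  qed (use c2 in auto)
  define K where "K = (c2 * m / C) * (c1 * m / C)"
  have K: "K > 0" using c1 c2 m \<psi>(5) by (simp add: K_def)
  have low: "K * \<psi> x \<le> \<phi> x" for x
  proof -
    have "K * \<psi> x = c2 * m / C * (c1 * m / C * \<psi> x)" by (simp only: K_def mult.assoc)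
    also have "\<dots> \<le> c2 * m / C * \<psi>2 x"
      using c2 m \<psi>(5) by (intro mult_left_mono low1) auto
    finally show ?thesis using low2[of x] by simp
  qed
  show thesis
  proof (rule that[of \<phi> "L / K"])
    show "space_test \<phi>" unfolding \<phi>_def by (rule heat_kernel_convolve_space_test[OF \<psi>2])
    show "\<phi> x > 0" for x using low[of x] K \<psi>(2)[of x] by (smt (verit) mult_pos_pos)
    show "L / K > 0" using K \<psi>(4) by simp
    fix a x assume a: "a \<in> A"
    have [measurable]: "k a \<in> borel_measurable borel" using k[OF a] by auto
    have "\<bar>frac_laplacian a \<phi> x\<bar> = \<bar>\<integral>y. k a y * \<psi> (x - y) \<partial>lborel\<bar>"
      unfolding \<phi>_def \<psi>2_def kF[OF a \<psi>(1)] by (subst convolve_alt) simp_all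
    also have "\<dots> \<le> (\<integral>y. \<kappa> y * \<psi> (x - y) \<partial>lborel)"
    proof (rule integral_abs_bound[THEN order_trans], rule integral_mono')
      show "integrable lborel (\<lambda>y. \<kappa> y * \<psi> (x - y))"
        by (rule convolve_bounded_integrand[OF \<kappa> \<psi>m \<psi>B])
      fix y
      have "\<bar>k a y\<bar> \<le> \<kappa> y" unfolding \<kappa>_def using a A(1) by (intro member_le_sum) auto
      then show "\<bar>k a y * \<psi> (x - y)\<bar> \<le> \<kappa> y * \<psi> (x - y)"
        using \<psi>0 by (simp add: abs_mult mult_right_mono)
      show "0 \<le> \<kappa> y * \<psi> (x - y)" using \<kappa>0 \<psi>0 by simp
    qed
    also have "\<dots> \<le> L * \<psi> x"
    proof -
      have "ennreal (\<integral>y. \<kappa> y * \<psi> (x - y) \<partial>lborel) = (\<integral>\<^sup>+y. ennreal (\<kappa> y * \<psi> (x - y)) \<partial>lborel)"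
        using \<kappa>0 \<psi>0 by (intro nn_integral_eq_integral[symmetric] convolve_bounded_integrand[OF \<kappa> \<psi>m \<psi>B]) auto
      also have "\<dots> \<le> ennreal (L * \<psi> x)" by (rule \<psi>(6))
      finally show ?thesis using \<psi>0[of x] \<psi>(4) by (subst (asm) ennreal_le_iff) auto
    qed
    also have "\<dots> \<le> L / K * \<phi> x"
      using low[of x] K \<psi>(4) by (simp add: pos_le_divide_eq mult_ac)
    finally show "\<bar>frac_laplacian a \<phi> x\<bar> \<le> L / K * \<phi> x" .
  qed
qed

section \<open>Scaling and the time cut-off\<close>

lemma smooth_continuous:
  assumes "smooth f"
  shows "continuous_on UNIV f"
  using assms unfolding smooth_def
  by (metis continuous_at_imp_continuous_on differentiable_imp_continuous_within empty_set empty_subsetI iter_partial.simps(1))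

lemma iter_partial_scale:
  assumes f: "smooth f" and bs: "set bs \<subseteq> Basis"
  shows "iter_partial bs (\<lambda>x. f (c *\<^sub>R x)) = (\<lambda>x. c ^ length bs * iter_partial bs f (c *\<^sub>R x))
    \<and> (\<forall>x. iter_partial bs (\<lambda>x. f (c *\<^sub>R x)) differentiable (at x))"
  using bs
proof (induction bs)
  case Nil
  have "f differentiable at (c *\<^sub>R x)" for x using f unfolding smooth_def by (metis empty_set empty_subsetI iter_partial.simps(1))
  then have "(\<lambda>x. f (c *\<^sub>R x)) differentiable at x" for x
    by (intro differentiable_compose[of f "\<lambda>x. c *\<^sub>R x"]) auto
  then show ?case by simp
next
  case (Cons b bs)
  let ?g = "iter_partial bs f"
  have dg: "(?g has_derivative frechet_derivative ?g (at x)) (at x)" for x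
    using f Cons.prems unfolding smooth_def frechet_derivative_works[symmetric] by auto
  have IH: "iter_partial bs (\<lambda>x. f (c *\<^sub>R x)) = (\<lambda>x. c ^ length bs * ?g (c *\<^sub>R x))"
    using Cons by simp
  have "((\<lambda>x. c ^ length bs * ?g (c *\<^sub>R x)) has_derivative
      (\<lambda>h. c ^ length bs * frechet_derivative ?g (at (c *\<^sub>R x)) (c *\<^sub>R h))) (at x)" for x
    by (intro has_derivative_mult_right has_derivative_compose[of "\<lambda>x. c *\<^sub>R x", OF _ dg] derivative_intros)
  then have fr: "frechet_derivative (\<lambda>x. c ^ length bs * ?g (c *\<^sub>R x)) (at x) =
      (\<lambda>h. c ^ length bs * frechet_derivative ?g (at (c *\<^sub>R x)) (c *\<^sub>R h))" for x
    using frechet_derivative_at by metis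
  have eq: "iter_partial (b # bs) (\<lambda>x. f (c *\<^sub>R x)) = (\<lambda>x. c ^ length (b # bs) * iter_partial (b # bs) f (c *\<^sub>R x))"
  proof
    fix x
    interpret bounded_linear "frechet_derivative ?g (at (c *\<^sub>R x))"
      using dg by (rule has_derivative_bounded_linear)
    show "iter_partial (b # bs) (\<lambda>x. f (c *\<^sub>R x)) x = c ^ length (b # bs) * iter_partial (b # bs) f (c *\<^sub>R x)"
      by (simp add: IH fr scaleR)
  qed
  have "iter_partial (b # bs) f differentiable at (c *\<^sub>R x)" for x
    using f Cons.prems unfolding smooth_def by blast
  then have "(\<lambda>x. c ^ length (b # bs) * iter_partial (b # bs) f (c *\<^sub>R x)) differentiable at x" for x
    by (intro differentiable_mult differentiable_const differentiable_compose[of "iter_partial (b # bs) f" "\<lambda>x. c *\<^sub>R x"]) auto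
  with eq show ?case by metis
qed

lemma smooth_scale: "smooth f \<Longrightarrow> smooth (\<lambda>x. f (c *\<^sub>R x))"
  using iter_partial_scale[of f _ c] unfolding smooth_def[of "\<lambda>x. f (c *\<^sub>R x)"] by blast

lemma space_test_scale:
  fixes \<phi> :: "'a::euclidean_space \<Rightarrow> real"
  assumes \<phi>: "space_test \<phi>" and c: "c \<noteq> 0"
  shows "space_test (\<lambda>x. \<phi> (c *\<^sub>R x))"
proof -
  have s: "smooth \<phi>" using \<phi> by (simp add: space_test_def)
  have "integrable lborel (iter_partial bs (\<lambda>x. \<phi> (c *\<^sub>R x))) \<and> bounded (range (iter_partial bs (\<lambda>x. \<phi> (c *\<^sub>R x))))"
    if bs: "set bs \<subseteq> Basis" for bs
  proof -
    have eq: "iter_partial bs (\<lambda>x. \<phi> (c *\<^sub>R x)) = (\<lambda>x. c ^ length bs * iter_partial bs \<phi> (c *\<^sub>R x))"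
      using iter_partial_scale[OF s bs] by blast
    have I: "integrable lborel (iter_partial bs \<phi>)" and B: "bounded (range (iter_partial bs \<phi>))"
      using \<phi> bs by (auto simp: space_test_def)
    obtain K where "\<And>x. norm (iter_partial bs \<phi> x) \<le> K" using B by (auto simp: bounded_iff)
    then have "\<forall>x\<in>range (\<lambda>x. c ^ length bs * iter_partial bs \<phi> (c *\<^sub>R x)). norm x \<le> \<bar>c ^ length bs\<bar> * K"
      by (auto simp: abs_mult intro!: mult_left_mono)
    then have "bounded (range (\<lambda>x. c ^ length bs * iter_partial bs \<phi> (c *\<^sub>R x)))"
      unfolding bounded_iff by blast
    moreover have "integrable lborel (\<lambda>x. c ^ length bs * iter_partial bs \<phi> (c *\<^sub>R x))"
      using integrable_euclidean_affine[OF I c, of 0] by (intro integrable_mult_right) simp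
    ultimately show ?thesis unfolding eq by simp
  qed
  then show ?thesis using smooth_scale[OF s] by (simp add: space_test_def)
qed

lemma space_testD:
  assumes "space_test \<phi>"
  shows "smooth \<phi>" "integrable lborel \<phi>" "bounded (range \<phi>)" "\<phi> \<in> borel_measurable borel"
  using assms unfolding space_test_def
  by (metis empty_set empty_subsetI iter_partial.simps(1))
    (metis assms space_test_def empty_set empty_subsetI iter_partial.simps(1) borel_measurable_continuous_onI smooth_continuous)+

text \<open>The Jacobians of the substitutions in the direct and the inverse transform cancel, and
  the homogeneity of the symbol leaves the factor \<open>c powr (2 * a)\<close>.\<close>

lemma frac_laplacian_scale:
  fixes \<phi> :: "'a::euclidean_space \<Rightarrow> real"
  assumes [measurable]: "\<phi> \<in> borel_measurable borel" and c: "c > 0"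
  shows "frac_laplacian a (\<lambda>x. \<phi> (c *\<^sub>R x)) x = c powr (2 * a) * frac_laplacian a \<phi> (c *\<^sub>R x)"
proof -
  define d where "d = \<bar>c\<bar> ^ DIM('a)"
  have d: "d > 0" using c by (simp add: d_def)
  have ft: "ft \<phi> \<xi> = of_real d * ft (\<lambda>x. \<phi> (c *\<^sub>R x)) (c *\<^sub>R \<xi>)" for \<xi>
    unfolding ft_def d_def
    using c by (subst integral_euclidean_affine[of _ c 0]) (auto simp: scaleR_conv_of_real)
  let ?F = "\<lambda>\<phi> x. (\<integral>\<xi>. exp (\<i> * complex_of_real (x \<bullet> \<xi>)) * (of_real (norm \<xi> powr (2 * a)) *
      (of_real ((2 * pi) powr (- real DIM('a) / 2)) * ft \<phi> \<xi>)) \<partial>lborel)"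
  have "?F (\<lambda>x. \<phi> (c *\<^sub>R x)) x = of_real d * (\<integral>\<xi>. exp (\<i> * complex_of_real (x \<bullet> (c *\<^sub>R \<xi>))) * (of_real (norm (c *\<^sub>R \<xi>) powr (2 * a)) *
      (of_real ((2 * pi) powr (- real DIM('a) / 2)) * ft (\<lambda>x. \<phi> (c *\<^sub>R x)) (c *\<^sub>R \<xi>))) \<partial>lborel)"
    unfolding d_def using c
    by (subst integral_euclidean_affine[of _ c 0]) (auto simp: scaleR_conv_of_real)
  also have "\<dots> = (\<integral>\<xi>. of_real (c powr (2 * a)) * (exp (\<i> * complex_of_real ((c *\<^sub>R x) \<bullet> \<xi>)) * (of_real (norm \<xi> powr (2 * a)) *
      (of_real ((2 * pi) powr (- real DIM('a) / 2)) * ft \<phi> \<xi>))) \<partial>lborel)"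
    unfolding integral_mult_right_zero[symmetric]
  proof (intro Bochner_Integration.integral_cong refl)
    fix \<xi> :: 'a
    have n: "norm (c *\<^sub>R \<xi>) powr (2 * a) = c powr (2 * a) * norm \<xi> powr (2 * a)"
      using c by (simp add: powr_mult)
    have i: "x \<bullet> (c *\<^sub>R \<xi>) = (c *\<^sub>R x) \<bullet> \<xi>" by simp
    show "of_real d * (exp (\<i> * complex_of_real (x \<bullet> (c *\<^sub>R \<xi>))) * (of_real (norm (c *\<^sub>R \<xi>) powr (2 * a)) *
      (of_real ((2 * pi) powr (- real DIM('a) / 2)) * ft (\<lambda>x. \<phi> (c *\<^sub>R x)) (c *\<^sub>R \<xi>))))
      = of_real (c powr (2 * a)) * (exp (\<i> * complex_of_real ((c *\<^sub>R x) \<bullet> \<xi>)) * (of_real (norm \<xi> powr (2 * a)) *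
      (of_real ((2 * pi) powr (- real DIM('a) / 2)) * ft \<phi> \<xi>)))"
      unfolding n i ft of_real_mult by (simp only: mult_ac)
  qed
  also have "\<dots> = of_real (c powr (2 * a)) * ?F \<phi> (c *\<^sub>R x)"
    by (rule integral_mult_right_zero)
  finally have F: "?F (\<lambda>x. \<phi> (c *\<^sub>R x)) x = of_real (c powr (2 * a)) * ?F \<phi> (c *\<^sub>R x)" .
  show ?thesis
    unfolding frac_laplacian_def inv_fourier_def fourier_of_real F by simp
qed

lemma frac_laplacian_cmult:
  fixes \<phi> :: "'a::euclidean_space \<Rightarrow> real"
  shows "frac_laplacian a (\<lambda>x. k * \<phi> x) x = k * frac_laplacian a \<phi> x"
proof -
  have ft: "ft (\<lambda>x. k * \<phi> x) \<xi> = of_real k * ft \<phi> \<xi>" for \<xi> :: 'a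
    unfolding ft_def integral_mult_right_zero[symmetric] by (intro Bochner_Integration.integral_cong refl) simp
  let ?F = "\<lambda>\<phi> x. (\<integral>\<xi>. exp (\<i> * complex_of_real (x \<bullet> \<xi>)) * (of_real (norm \<xi> powr (2 * a)) *
      (of_real ((2 * pi) powr (- real DIM('a) / 2)) * ft \<phi> \<xi>)) \<partial>lborel)"
  have F: "?F (\<lambda>x. k * \<phi> x) x = of_real k * ?F \<phi> x"
    unfolding ft integral_mult_right_zero[symmetric] by (intro Bochner_Integration.integral_cong refl) simp
  show ?thesis
    unfolding frac_laplacian_def inv_fourier_def fourier_of_real F by simp
qed

section \<open>The time cut-off exp(-1/(1-t)) and its derivatives\<close>

text \<open>The induction over the coefficients halves \<theta> at each step: one half of the
  exponential absorbs the new factor \<open>s\<close>, the other is left to the induction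
  hypothesis.\<close>

lemma poly_exp_neg_bounded:
  fixes q :: "real poly"
  assumes "\<theta> > 0"
  obtains K where "K \<ge> 0" "\<And>s. s \<ge> 0 \<Longrightarrow> \<bar>poly q s\<bar> * exp (- \<theta> * s) \<le> K"
proof -
  have "\<exists>K\<ge>0. \<forall>s\<ge>0. \<bar>poly q s\<bar> * exp (- \<theta> * s) \<le> K"
    using assms
  proof (induction q arbitrary: \<theta>)
    case 0
    then show ?case by auto
  next
    case (pCons a q)
    obtain K where K: "K \<ge> 0" "\<And>s. s \<ge> 0 \<Longrightarrow> \<bar>poly q s\<bar> * exp (- (\<theta> / 2) * s) \<le> K"
      using pCons.IH[of "\<theta> / 2"] pCons.prems by auto
    have "\<bar>poly (pCons a q) s\<bar> * exp (- \<theta> * s) \<le> \<bar>a\<bar> + 2 / \<theta> * K" if s: "s \<ge> 0" for s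
    proof -
      have e: "exp (- \<theta> * s) = exp (- (\<theta> / 2) * s) * exp (- (\<theta> / 2) * s)"
        unfolding exp_add[symmetric] by simp
      have e1: "exp (- \<theta> * s) \<le> 1" using s pCons.prems by simp
      have e2: "s * exp (- (\<theta> / 2) * s) \<le> 2 / \<theta>"
      proof -
        have "\<theta> / 2 * s \<le> exp (\<theta> / 2 * s)" using exp_ge_add_one_self[of "\<theta> / 2 * s"] by linarith
        then have "\<theta> / 2 * s * exp (- (\<theta> / 2 * s)) \<le> 1" by (simp add: exp_minus field_simps)
        then show ?thesis using pCons.prems by (simp add: field_simps)
      qed
      have "\<bar>poly (pCons a q) s\<bar> * exp (- \<theta> * s) \<le> (\<bar>a\<bar> + s * \<bar>poly q s\<bar>) * exp (- \<theta> * s)"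
        using s by (intro mult_right_mono) (auto simp: abs_mult intro: order_trans[OF abs_triangle_ineq])
      also have "\<dots> = \<bar>a\<bar> * exp (- \<theta> * s) + (s * exp (- (\<theta> / 2) * s)) * (\<bar>poly q s\<bar> * exp (- (\<theta> / 2) * s))"
        unfolding e by (simp only: distrib_right mult_ac)
      also have "\<dots> \<le> \<bar>a\<bar> * 1 + 2 / \<theta> * K"
        using s pCons.prems K(1) by (intro add_mono mult_mono e1 e2 K(2)) auto
      finally show ?thesis by simp
    qed
    then show ?case using K(1) pCons.prems by (intro exI[of _ "\<bar>a\<bar> + 2 / \<theta> * K"]) auto
  qed
  then show thesis using that by blast
qed

text \<open>In the variable s = 1/(1-t) every derivative of exp(-s) is a polynomial in
  \<open>s\<close> times exp(-s), so this family is closed under differentiation.\<close>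

definition poly_bump :: "real poly \<Rightarrow> real \<Rightarrow> real" where
  "poly_bump q t = (if t < 1 then poly q (1 / (1 - t)) * exp (- (1 / (1 - t))) else 0)"

text \<open>The chain rule with ds/dt = s^2 for s = 1/(1-t).\<close>

definition poly_bump_deriv :: "real poly \<Rightarrow> real poly" where
  "poly_bump_deriv q = [:0, 0, 1:] * (pderiv q - q)"

lemma poly_bump_has_derivative:
  "(poly_bump q has_real_derivative poly_bump (poly_bump_deriv q) t) (at t)"
proof -
  consider "t < 1" | "t = 1" | "t > 1" by linarith
  then show ?thesis
  proof cases
    case 1
    have "((\<lambda>t. poly q (1 / (1 - t)) * exp (- (1 / (1 - t)))) has_real_derivative poly_bump (poly_bump_deriv q) t) (at t)"
      using 1 by (auto intro!: derivative_eq_intros simp: poly_bump_def poly_bump_deriv_def power2_eq_square algebra_simps divide_inverse)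
    moreover have "eventually (\<lambda>u. poly_bump q u = poly q (1 / (1 - u)) * exp (- (1 / (1 - u)))) (nhds t)"
      using eventually_nhds_in_open[of "{..<1}" t] 1 by (auto simp: poly_bump_def elim: eventually_mono)
    ultimately show ?thesis by (subst DERIV_cong_ev[OF refl _ refl])
  next
    case 3
    have "((\<lambda>t. 0) has_real_derivative poly_bump (poly_bump_deriv q) t) (at t)"
      using 3 by (simp add: poly_bump_def)
    moreover have "eventually (\<lambda>u. poly_bump q u = 0) (nhds t)"
      using eventually_nhds_in_open[of "{1<..}" t] 3 by (auto simp: poly_bump_def elim: eventually_mono)
    ultimately show ?thesis by (subst DERIV_cong_ev[OF refl _ refl])
  next
    case 2
    \<comment> \<open>The extra factor s^2 yields a bound quadratic in u - 1, so that the difference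
      quotients at the junction t = 1 tend to 0.\<close>
    obtain K where K: "K \<ge> 0" "\<And>s. s \<ge> 0 \<Longrightarrow> \<bar>poly ([:0, 0, 1:] * q) s\<bar> * exp (- 1 * s) \<le> K"
      by (rule poly_exp_neg_bounded[of 1 "[:0, 0, 1:] * q"], simp, rule that)
    have bound: "\<bar>poly_bump q u\<bar> \<le> K * (u - 1)\<^sup>2" for u
    proof (cases "u < 1")
      case True
      define s where "s = 1 / (1 - u)"
      have s: "s > 0" using True by (simp add: s_def)
      have "\<bar>poly_bump q u\<bar> * s\<^sup>2 = \<bar>poly ([:0, 0, 1:] * q) s\<bar> * exp (- 1 * s)"
        using True s by (simp add: poly_bump_def s_def[symmetric] abs_mult power2_eq_square)
      also have "\<dots> \<le> K" using s by (intro K) simp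
      finally have "\<bar>poly_bump q u\<bar> \<le> K / s\<^sup>2" using s by (simp add: pos_le_divide_eq)
      then show ?thesis using True by (simp add: s_def power_divide power2_commute)
    next
      case False
      then show ?thesis using K(1) by (simp add: poly_bump_def)
    qed
    have "((\<lambda>u. (poly_bump q u - poly_bump q 1) / (u - 1)) \<longlongrightarrow> 0) (at 1)"
    proof (rule Lim_null_comparison)
      show "\<forall>\<^sub>F u in at 1. norm ((poly_bump q u - poly_bump q 1) / (u - 1)) \<le> K * \<bar>u - 1\<bar>"
      proof (rule always_eventually, rule allI)
        fix u
        show "norm ((poly_bump q u - poly_bump q 1) / (u - 1)) \<le> K * \<bar>u - 1\<bar>"
        proof (cases "u = 1")
          case False
          then have "\<bar>poly_bump q u\<bar> / \<bar>u - 1\<bar> \<le> K * \<bar>u - 1\<bar>"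
            using bound[of u] by (simp add: divide_le_eq power2_eq_square mult.assoc)
          then show ?thesis by (simp add: poly_bump_def[of q 1])
        qed simp
      qed
      show "((\<lambda>u. K * \<bar>u - 1\<bar>) \<longlongrightarrow> 0) (at 1)"
        by (auto intro!: tendsto_eq_intros)
    qed
    then show ?thesis using 2 by (simp add: has_field_derivative_iff poly_bump_def[of _ 1])
  qed
qed

lemma poly_bump_smooth: "smooth (poly_bump q)"
proof -
  have fr: "frechet_derivative (poly_bump q) (at x) 1 = poly_bump (poly_bump_deriv q) x" for q x
    using frechet_derivative_at[OF poly_bump_has_derivative[unfolded has_field_derivative_def]]
    by (metis mult.right_neutral)
  have "\<exists>r. iter_partial bs (poly_bump q) = poly_bump r" if "set bs \<subseteq> Basis" for bs
    using that
  proof (induction bs)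
    case (Cons b bs)
    then show ?case by (auto simp: fr)
  qed auto
  moreover have "poly_bump r differentiable at x" for r x
    using poly_bump_has_derivative real_differentiable_def by blast
  ultimately show ?thesis unfolding smooth_def by metis
qed

definition bump :: "real \<Rightarrow> real" where "bump = poly_bump 1"

lemma bump_nonneg: "bump t \<ge> 0" and bump_le_1: "bump t \<le> 1" and bump_zero: "t \<ge> 1 \<Longrightarrow> bump t = 0"
  by (auto simp: bump_def poly_bump_def)

text \<open>Split exp(-s) into exp(-(1 - 1/p) s) and exp(-s)^(1/p). Since p > 1, the first factor
  still decays and absorbs the polynomial. Applied to the first two derivatives of the cut-off, this
  gives exactly the power of \<eta> that Young's inequality requires.\<close>

lemma poly_bump_le_bump_powr:
  assumes "p > 1"
  obtains K where "K \<ge> 0" "\<And>t. \<bar>poly_bump q t\<bar> \<le> K * bump t powr (1 / p)"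
proof -
  have p: "1 - 1 / p > 0" using assms by simp
  obtain K where K: "K \<ge> 0" "\<And>s. s \<ge> 0 \<Longrightarrow> \<bar>poly q s\<bar> * exp (- (1 - 1 / p) * s) \<le> K"
    by (rule poly_exp_neg_bounded[OF p, of q], rule that)
  have "\<bar>poly_bump q t\<bar> \<le> K * bump t powr (1 / p)" for t
  proof (cases "t < 1")
    case True
    define s where "s = 1 / (1 - t)"
    have s: "s > 0" using True by (simp add: s_def)
    have "exp (- s) = exp (- (1 - 1 / p) * s) * exp (- s) powr (1 / p)"
      unfolding powr_def by (simp add: algebra_simps flip: exp_add)
    then have "\<bar>poly_bump q t\<bar> = (\<bar>poly q s\<bar> * exp (- (1 - 1 / p) * s)) * exp (- s) powr (1 / p)"
      using True by (simp add: poly_bump_def s_def[symmetric] abs_mult)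
    also have "\<dots> \<le> K * exp (- s) powr (1 / p)"
      using s by (intro mult_right_mono K) auto
    finally show ?thesis using True by (simp add: bump_def poly_bump_def s_def)
  next
    case False
    then show ?thesis using K(1) by (simp add: poly_bump_def bump_def)
  qed
  then show thesis using that K(1) by blast
qed

section \<open>The test function estimate\<close>

text \<open>The coefficient 1 of \<open>a powr p\<close> is enough: that term will cancel exactly
  against the nonlinear term on the other side of the weak identity. Either b \<le> a^(p-1), or a is
  less than b^(1/(p-1)); in each case one summand alone suffices.\<close>

lemma young_crude:
  fixes a b p :: real
  assumes a: "a \<ge> 0" and b: "b \<ge> 0" and p: "p > 1"
  shows "a * b \<le> a powr p + b powr (p / (p - 1))"
proof (cases "a = 0 \<or> b = 0")
  case False
  with a b have a: "a > 0" and b: "b > 0" by auto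
  show ?thesis
  proof (cases "b \<le> a powr (p - 1)")
    case True
    have "a * b \<le> a powr 1 * a powr (p - 1)" using True a by (simp add: mult_left_mono)
    also have "\<dots> = a powr p" unfolding powr_add[symmetric] by simp
    finally show ?thesis using powr_ge_zero[of b "p / (p - 1)"] by linarith
  next
    case False
    have "a = (a powr (p - 1)) powr (1 / (p - 1))" using a p by (simp add: powr_powr)
    also have "\<dots> \<le> b powr (1 / (p - 1))" using False p a by (intro powr_mono2) auto
    finally have "a * b \<le> b powr (1 / (p - 1)) * b powr 1" using b by (simp add: mult_right_mono)
    also have "\<dots> = b powr (p / (p - 1))"
      unfolding powr_add[symmetric] using p by (simp add: field_simps)
    finally show ?thesis using powr_ge_zero[of a p] by linarith
  qed
qed auto

lemma adjoint_op_product: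
  assumes \<eta>: "\<And>t. (\<eta> has_real_derivative \<eta>1 t) (at t)" and \<eta>1: "\<And>t. (\<eta>1 has_real_derivative \<eta>2 t) (at t)"
  shows "adjoint_op \<sigma> \<sigma>1 \<sigma>2 (\<lambda>s y. \<eta> s * \<phi> y) t x =
    \<eta>2 t * \<phi> x - \<eta>1 t * frac_laplacian \<sigma>1 \<phi> x - \<eta>1 t * frac_laplacian \<sigma>2 \<phi> x + \<eta> t * frac_laplacian \<sigma> \<phi> x"
proof -
  have 1: "deriv (\<lambda>s. \<eta> s * k) t = \<eta>1 t * k" for k t
    by (intro DERIV_imp_deriv DERIV_cmult_right \<eta>)
  have 2: "deriv (\<lambda>s. \<eta>1 s * k) t = \<eta>2 t * k" for k t
    by (intro DERIV_imp_deriv DERIV_cmult_right \<eta>1)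
  have "deriv (\<lambda>s. \<eta> s * \<phi> x) = (\<lambda>t. \<eta>1 t * \<phi> x)" by (rule ext) (rule 1)
  then show ?thesis
    unfolding adjoint_op_def frac_laplacian_cmult by (simp add: 1 2)
qed

text \<open>The integral of |u|^p \<eta> \<phi> occurs on the left of the weak identity and, after
  Young's inequality, on the right with the same coefficient. It is finite by the definition of a
  weak solution, so it drops out. What remains is a constant integrated over [0, \<tau>) and against
  \<phi>.\<close>

lemma weak_solution_scaled_estimate:
  fixes \<phi> :: "'a::euclidean_space \<Rightarrow> real" and p \<tau> B :: real
  assumes p: "p > 1" and weak: "weak_solution \<sigma> \<sigma>1 \<sigma>2 p u1 \<epsilon> T u"
    and \<phi>: "space_test \<phi>" "\<And>x. \<phi> x > 0" and \<eta>: "time_test T \<eta>" "\<And>t. \<eta> t \<ge> 0" 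
    and \<tau>: "0 < \<tau>" "\<tau> < T" "\<And>t. t \<ge> \<tau> \<Longrightarrow> \<eta> t = 0" and B: "B \<ge> 0"
    and adj: "\<And>t x. \<bar>adjoint_op \<sigma> \<sigma>1 \<sigma>2 (\<lambda>s y. \<eta> s * \<phi> y) t x\<bar> \<le> B * \<eta> t powr (1 / p) * \<phi> x"
  shows "\<epsilon> * \<eta> 0 * (\<integral>x. u1 x * \<phi> x \<partial>lborel) \<le> \<tau> * B powr (p / (p - 1)) * (\<integral>x. \<phi> x \<partial>lborel)"
proof -
  define A where "A = B powr (p / (p - 1))"
  define N where "N = (\<integral>x. \<phi> x \<partial>lborel)"
  have A0: "A \<ge> 0" by (simp add: A_def)
  have \<phi>0: "\<phi> x \<ge> 0" for x using \<phi>(2)[of x] by simp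
  have \<phi>I: "integrable lborel \<phi>" by (rule space_testD[OF \<phi>(1)])
  let ?v = "\<lambda>t x. \<bar>u t x\<bar> powr p * (\<eta> t * \<phi> x)"
  have int: "set_integrable lborel ({0..<T} \<times> UNIV) (\<lambda>(t, x). ?v t x)"
    and eq: "(LINT t:{0..<T}|lborel. LINT x|lborel. ?v t x) + \<epsilon> * (LINT x|lborel. u1 x * (\<eta> 0 * \<phi> x))
      = (LINT t:{0..<T}|lborel. LINT x|lborel. u t x * adjoint_op \<sigma> \<sigma>1 \<sigma>2 (\<lambda>s y. \<eta> s * \<phi> y) t x)"
    using weak \<phi>(1) \<eta>(1) unfolding weak_solution_def by blast+
  have "integrable (lborel \<Otimes>\<^sub>M lborel) (\<lambda>z. indicator ({0..<T} \<times> UNIV) z *\<^sub>R (case z of (t, x) \<Rightarrow> ?v t x))"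
    using int unfolding set_integrable_def lborel_prod .
  also have "(\<lambda>z. indicator ({0..<T} \<times> UNIV) z *\<^sub>R (case z of (t, x) \<Rightarrow> ?v t x))
      = (\<lambda>(t, x). indicator {0..<T} t * ?v t x)"
    by (auto simp: fun_eq_iff indicator_def)
  finally have I: "integrable (lborel \<Otimes>\<^sub>M lborel) (\<lambda>(t, x). indicator {0..<T} t * ?v t x)" .
  define w where "w t = (\<integral>x. ?v t x \<partial>lborel)" for t
  have wI: "integrable lborel (\<lambda>t. indicator {0..<T} t * w t)"
    using lborel_pair.integrable_fst'[OF I] by (simp add: w_def)
  have slice: "AE t in lborel. t \<in> {0..<T} \<longrightarrow> integrable lborel (?v t)"
    using lborel_pair.AE_integrable_fst'[OF I] by eventually_elim auto
  define g where "g t = indicator {0..<T} t * w t + indicator {0..<\<tau>} t * (A * N)" for t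
  have gI: "integrable lborel g"
    unfolding g_def using wI \<tau>(1)
    by (intro Bochner_Integration.integrable_add integrable_mult_left integrable_real_indicator) auto
  have w0: "w t \<ge> 0" for t unfolding w_def using \<eta>(2) \<phi>0 by simp
  have N0: "N \<ge> 0" unfolding N_def using \<phi>0 by simp
  \<comment> \<open>Young's inequality with a = |u| \<eta>^(1/p) and b = B. For t \<ge> \<tau> the
    cut-off vanishes, and by \<open>adj\<close> so does the operator term, because
    \<open>0 powr (1 / p) = 0\<close>; this confines the second summand to t < \<tau>.\<close>
  have pt: "u t x * adjoint_op \<sigma> \<sigma>1 \<sigma>2 (\<lambda>s y. \<eta> s * \<phi> y) t x \<le> ?v t x + (if t < \<tau> then A * \<phi> x else 0)" for t x
  proof (cases "t < \<tau>")
    case True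
    have "u t x * adjoint_op \<sigma> \<sigma>1 \<sigma>2 (\<lambda>s y. \<eta> s * \<phi> y) t x
      \<le> \<bar>u t x\<bar> * \<bar>adjoint_op \<sigma> \<sigma>1 \<sigma>2 (\<lambda>s y. \<eta> s * \<phi> y) t x\<bar>"
      unfolding abs_mult[symmetric] by (rule abs_ge_self)
    also have "\<dots> \<le> \<bar>u t x\<bar> * (B * \<eta> t powr (1 / p) * \<phi> x)" by (intro mult_left_mono adj) simp
    also have "\<dots> = (\<bar>u t x\<bar> * \<eta> t powr (1 / p)) * B * \<phi> x" by (simp only: mult_ac)
    also have "\<dots> \<le> ((\<bar>u t x\<bar> * \<eta> t powr (1 / p)) powr p + A) * \<phi> x"
      unfolding A_def using B p by (intro mult_right_mono young_crude \<phi>0) auto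
    also have "(\<bar>u t x\<bar> * \<eta> t powr (1 / p)) powr p = \<bar>u t x\<bar> powr p * \<eta> t"
      using p \<eta>(2)[of t] by (simp add: powr_mult powr_powr)
    finally show ?thesis using True by (simp add: distrib_right mult.assoc)
  next
    case False
    then have "\<eta> t = 0" by (intro \<tau>(3)) simp
    then have "adjoint_op \<sigma> \<sigma>1 \<sigma>2 (\<lambda>s y. \<eta> s * \<phi> y) t x = 0" using adj[of t x] by simp
    then show ?thesis using False \<open>\<eta> t = 0\<close> by simp
  qed
  have "(LINT t:{0..<T}|lborel. LINT x|lborel. u t x * adjoint_op \<sigma> \<sigma>1 \<sigma>2 (\<lambda>s y. \<eta> s * \<phi> y) t x) \<le> (\<integral>t. g t \<partial>lborel)"
    unfolding set_lebesgue_integral_def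
  \<comment> \<open>This comparison asks for integrability of the majorant only. Should the left
    integral diverge, its value is 0, and the inequality holds because \<open>g\<close> is
    nonnegative; the inner integral is treated in the same way.\<close>
  proof (rule integral_mono_AE'[OF gI])
    show "AE t in lborel. indicator {0..<T} t *\<^sub>R (\<integral>x. u t x * adjoint_op \<sigma> \<sigma>1 \<sigma>2 (\<lambda>s y. \<eta> s * \<phi> y) t x \<partial>lborel) \<le> g t"
      using slice
    proof eventually_elim
      fix t assume t: "t \<in> {0..<T} \<longrightarrow> integrable lborel (?v t)"
      show "indicator {0..<T} t *\<^sub>R (\<integral>x. u t x * adjoint_op \<sigma> \<sigma>1 \<sigma>2 (\<lambda>s y. \<eta> s * \<phi> y) t x \<partial>lborel) \<le> g t"
      proof (cases "t \<in> {0..<T}")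
        case True
        have J: "integrable lborel (\<lambda>x. if t < \<tau> then A * \<phi> x else 0)"
          using \<phi>I by (cases "t < \<tau>") auto
        have v: "integrable lborel (?v t)" using t True by blast
        have "(\<integral>x. u t x * adjoint_op \<sigma> \<sigma>1 \<sigma>2 (\<lambda>s y. \<eta> s * \<phi> y) t x \<partial>lborel)
            \<le> (\<integral>x. ?v t x + (if t < \<tau> then A * \<phi> x else 0) \<partial>lborel)"
          using \<phi>0 \<eta>(2) A0 by (intro integral_mono' Bochner_Integration.integrable_add v J pt) auto
        also have "\<dots> = w t + (\<integral>x. (if t < \<tau> then A * \<phi> x else 0) \<partial>lborel)"
          unfolding w_def by (rule Bochner_Integration.integral_add[OF v J])
        also have "(\<integral>x. (if t < \<tau> then A * \<phi> x else 0) \<partial>lborel) = (if t < \<tau> then A * N else 0)"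
          by (simp add: N_def)
        finally show ?thesis using True by (auto simp: g_def indicator_def)
      next
        case False
        then show ?thesis using A0 N0 by (simp add: g_def)
      qed
    qed
    show "AE t in lborel. 0 \<le> g t" using w0 A0 N0 by (intro AE_I2) (simp add: g_def)
  qed
  also have "(\<integral>t. g t \<partial>lborel) = (\<integral>t. indicator {0..<T} t * w t \<partial>lborel) + (\<integral>t. indicator {0..<\<tau>} t * (A * N) \<partial>lborel)"
    unfolding g_def using wI \<tau>(1)
    by (intro Bochner_Integration.integral_add integrable_mult_left integrable_real_indicator) auto
  also have "(\<integral>t. indicator {0..<\<tau>} t * (A * N) \<partial>lborel) = \<tau> * (A * N)"
    using \<tau>(1) by simp
  also have "(\<integral>t. indicator {0..<T} t * w t \<partial>lborel) = (LINT t:{0..<T}|lborel. LINT x|lborel. ?v t x)"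
    by (simp add: set_lebesgue_integral_def w_def)
  finally have "\<epsilon> * (LINT x|lborel. u1 x * (\<eta> 0 * \<phi> x)) \<le> \<tau> * (A * N)"
    unfolding eq[symmetric] by simp
  also have "(LINT x|lborel. u1 x * (\<eta> 0 * \<phi> x)) = \<eta> 0 * (\<integral>x. u1 x * \<phi> x \<partial>lborel)"
    unfolding integral_mult_right_zero[symmetric] by (intro Bochner_Integration.integral_cong refl) simp
  finally show ?thesis by (simp add: A_def N_def mult.assoc)
qed

text \<open>The time scale \<open>R powr (2 * (\<sigma> - \<sigma>1))\<close> balances the damping of order \<open>\<sigma>1\<close> with
  \<open>(-\<Delta>)\<^sup>\<sigma>\<close>; the remaining two terms are then of lower order because of
  \<open>\<sigma>1 < \<sigma> / 2\<close> and \<open>\<sigma>1 \<le> \<sigma>2\<close>.\<close>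

lemma weak_solution_estimate:
  fixes \<phi> :: "'a::euclidean_space \<Rightarrow> real" and p \<sigma> \<sigma>1 \<sigma>2 C :: real
  assumes p: "p > 1" and \<sigma>: "0 \<le> \<sigma>1" "\<sigma>1 < \<sigma> / 2" "\<sigma>1 \<le> \<sigma>2"
    and \<phi>: "space_test \<phi>" "\<And>x. \<phi> x > 0" and C: "C > 0"
    and fl: "\<And>a x. a \<in> {\<sigma>1, \<sigma>2, \<sigma>} \<Longrightarrow> \<bar>frac_laplacian a \<phi> x\<bar> \<le> C * \<phi> x"
  obtains K where "K > 0"
    "\<And>u1 \<epsilon> T u R. R \<ge> 1 \<Longrightarrow> R powr (2 * (\<sigma> - \<sigma>1)) < T \<Longrightarrow> weak_solution \<sigma> \<sigma>1 \<sigma>2 p u1 \<epsilon> T u \<Longrightarrow>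
      \<epsilon> * (\<integral>x. u1 x * \<phi> ((1 / R) *\<^sub>R x) \<partial>lborel)
        \<le> K * R powr (2 * (\<sigma> - \<sigma>1) + DIM('a) - 2 * \<sigma> * p / (p - 1))"
proof -
  define q where "q = p / (p - 1)"
  obtain K1 where K1: "K1 \<ge> 0" "\<And>t. \<bar>poly_bump (poly_bump_deriv 1) t\<bar> \<le> K1 * bump t powr (1 / p)"
    by (rule poly_bump_le_bump_powr[OF p], rule that)
  obtain K2 where K2: "K2 \<ge> 0" "\<And>t. \<bar>poly_bump (poly_bump_deriv (poly_bump_deriv 1)) t\<bar> \<le> K2 * bump t powr (1 / p)"
    by (rule poly_bump_le_bump_powr[OF p], rule that)
  \<comment> \<open>\<open>K2\<close> accounts for the second time derivative, \<open>K1 * C\<close>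
    for each of the two damping terms, and \<open>C\<close> for (-Laplace)^\<sigma>.\<close>
  define K4 where "K4 = K2 + 2 * K1 * C + C"
  have K4: "K4 > 0" using K1 K2 C by (simp add: K4_def add_nonneg_pos)
  define N where "N = (\<integral>x. \<phi> x \<partial>lborel)"
  have N0: "N \<ge> 0" unfolding N_def by (intro integral_nonneg_AE AE_I2 less_imp_le \<phi>(2))
  \<comment> \<open>\<open>exp 1\<close> is the reciprocal of \<eta> 0 = \<open>bump 0\<close>;
    \<open>N + 1\<close> instead of \<open>N\<close> makes K > 0 immediate.\<close>
  define K where "K = exp 1 * K4 powr q * (N + 1)"
  have K: "K > 0" using K4 N0 by (simp add: K_def)
  have \<phi>m: "\<phi> \<in> borel_measurable borel" by (rule space_testD[OF \<phi>(1)])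
  have main: "\<epsilon> * (\<integral>x. u1 x * \<phi> ((1 / R) *\<^sub>R x) \<partial>lborel) \<le> K * R powr (2 * (\<sigma> - \<sigma>1) + DIM('a) - 2 * \<sigma> * p / (p - 1))"
    if R: "R \<ge> 1" and RT: "R powr (2 * (\<sigma> - \<sigma>1)) < T" and weak: "weak_solution \<sigma> \<sigma>1 \<sigma>2 p u1 \<epsilon> T u"
    for u1 \<epsilon> T u R
  proof -
    define \<tau> where "\<tau> = R powr (2 * (\<sigma> - \<sigma>1))"
    define \<phi>R where "\<phi>R x = \<phi> ((1 / R) *\<^sub>R x)" for x
    define \<eta> where "\<eta> t = bump ((1 / \<tau>) *\<^sub>R t)" for t
    define \<eta>1 where "\<eta>1 t = (1 / \<tau>) * poly_bump (poly_bump_deriv 1) ((1 / \<tau>) *\<^sub>R t)" for t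
    define \<eta>2 where "\<eta>2 t = (1 / \<tau>)\<^sup>2 * poly_bump (poly_bump_deriv (poly_bump_deriv 1)) ((1 / \<tau>) *\<^sub>R t)" for t
    have R0: "R > 0" using R by simp
    have \<tau>: "\<tau> > 0" using R by (simp add: \<tau>_def)
    have \<tau>T: "\<tau> < T" using RT by (simp add: \<tau>_def)
    have chain: "((\<lambda>t. poly_bump r ((1 / \<tau>) *\<^sub>R t)) has_real_derivative
        (1 / \<tau>) * poly_bump (poly_bump_deriv r) ((1 / \<tau>) *\<^sub>R t)) (at t)" for r t
    proof -
      have "((\<lambda>t. (1 / \<tau>) *\<^sub>R t) has_real_derivative 1 / \<tau>) (at t)"
        using \<tau> by (auto intro!: derivative_eq_intros)
      from DERIV_chain2[OF poly_bump_has_derivative this] show ?thesis by (simp only: mult.commute)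
    qed
    have d1: "(\<eta> has_real_derivative \<eta>1 t) (at t)" for t
      unfolding \<eta>_def[abs_def] \<eta>1_def bump_def by (rule chain)
    have d2: "(\<eta>1 has_real_derivative \<eta>2 t) (at t)" for t
      unfolding \<eta>1_def[abs_def] \<eta>2_def power2_eq_square mult.assoc by (intro DERIV_cmult chain)
    have \<eta>0: "\<eta> t \<ge> 0" for t by (simp add: \<eta>_def bump_nonneg)
    have \<eta>\<tau>: "\<eta> t = 0" if "t \<ge> \<tau>" for t unfolding \<eta>_def using that \<tau> by (intro bump_zero) simp
    have tt: "time_test T \<eta>"
      unfolding time_test_def
    proof
      show "smooth \<eta>" unfolding \<eta>_def[abs_def] bump_def by (rule smooth_scale[OF poly_bump_smooth])
      show "\<exists>T'<T. \<forall>t\<ge>T'. \<eta> t = 0" using \<tau>T \<eta>\<tau> by blast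
    qed
    have st: "space_test \<phi>R" unfolding \<phi>R_def[abs_def] using R0 by (intro space_test_scale \<phi>) simp
    have \<phi>R0: "\<phi>R x > 0" for x by (simp add: \<phi>R_def \<phi>)
    have flR: "\<bar>frac_laplacian a \<phi>R x\<bar> \<le> R powr (- 2 * a) * C * \<phi>R x" if a: "a \<in> {\<sigma>1, \<sigma>2, \<sigma>}" for a x
    proof -
      have "frac_laplacian a \<phi>R x = (1 / R) powr (2 * a) * frac_laplacian a \<phi> ((1 / R) *\<^sub>R x)"
        unfolding \<phi>R_def[abs_def] using R0 by (intro frac_laplacian_scale \<phi>m) simp
      also have "(1 / R) powr (2 * a) = R powr (- 2 * a)"
        unfolding powr_divide by (simp add: powr_minus_divide)
      finally have "\<bar>frac_laplacian a \<phi>R x\<bar> = R powr (- 2 * a) * \<bar>frac_laplacian a \<phi> ((1 / R) *\<^sub>R x)\<bar>"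
        by (simp add: abs_mult)
      also have "\<dots> \<le> R powr (- 2 * a) * (C * \<phi>R x)"
        unfolding \<phi>R_def by (intro mult_left_mono fl a) simp
      finally show ?thesis by (simp only: mult.assoc)
    qed
    have e1: "(1 / \<tau>)\<^sup>2 \<le> R powr (- 2 * \<sigma>)"
    proof -
      have "(1 / \<tau>)\<^sup>2 = R powr (- 4 * (\<sigma> - \<sigma>1))"
        using R0 by (simp add: \<tau>_def power2_eq_square divide_inverse flip: powr_minus powr_add)
      also have "\<dots> \<le> R powr (- 2 * \<sigma>)" using R \<sigma> by (intro powr_mono) auto
      finally show ?thesis .
    qed
    have e2: "1 / \<tau> * R powr (- 2 * a) \<le> R powr (- 2 * \<sigma>)" if "a \<ge> \<sigma>1" for a
    proof -
      have "1 / \<tau> = R powr (- (2 * (\<sigma> - \<sigma>1)))"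
        by (simp only: \<tau>_def powr_minus_divide)
      then have "1 / \<tau> * R powr (- 2 * a) = R powr (- (2 * (\<sigma> - \<sigma>1)) + - 2 * a)"
        by (simp only: powr_add)
      also have "\<dots> \<le> R powr (- 2 * \<sigma>)" using R that by (intro powr_mono) auto
      finally show ?thesis .
    qed
    define h where "h t = \<eta> t powr (1 / p)" for t
    have h0: "h t \<ge> 0" for t by (simp add: h_def)
    have h1: "\<bar>\<eta>1 t\<bar> \<le> 1 / \<tau> * (K1 * h t)" for t
      unfolding \<eta>1_def h_def \<eta>_def abs_mult using \<tau> K1(2) by (intro mult_mono) auto
    have h2: "\<bar>\<eta>2 t\<bar> \<le> (1 / \<tau>)\<^sup>2 * (K2 * h t)" for t
      unfolding \<eta>2_def h_def \<eta>_def abs_mult using K2(2) by (intro mult_mono) auto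
    have h3: "\<eta> t \<le> h t" for t
    proof (cases "\<eta> t = 0")
      case False
      with \<eta>0[of t] have "\<eta> t > 0" by simp
      moreover have "\<eta> t \<le> 1" by (simp add: \<eta>_def bump_le_1)
      ultimately have "\<eta> t powr 1 \<le> \<eta> t powr (1 / p)" using p by (intro powr_mono') auto
      then show ?thesis using \<open>\<eta> t > 0\<close> by (simp add: h_def)
    qed (simp add: h_def)
    define B where "B = K4 * R powr (- 2 * \<sigma>)"
    have B0: "B \<ge> 0" using K4 by (simp add: B_def)
    have adj: "\<bar>adjoint_op \<sigma> \<sigma>1 \<sigma>2 (\<lambda>s y. \<eta> s * \<phi>R y) t x\<bar> \<le> B * \<eta> t powr (1 / p) * \<phi>R x" for t x
    proof -
      let ?r = "R powr (- 2 * \<sigma>)"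
      have f0: "\<phi>R x \<ge> 0" using \<phi>R0[of x] by simp
      have t1: "\<bar>\<eta>2 t * \<phi>R x\<bar> \<le> K2 * ?r * h t * \<phi>R x"
      proof -
        have "\<bar>\<eta>2 t\<bar> \<le> ?r * (K2 * h t)"
          using h2[of t] e1 K2(1) h0[of t] by (meson mult_nonneg_nonneg mult_right_mono order_trans)
        then have "\<bar>\<eta>2 t\<bar> * \<phi>R x \<le> ?r * (K2 * h t) * \<phi>R x" using f0 by (rule mult_right_mono)
        then show ?thesis using f0 by (simp add: abs_mult mult_ac)
      qed
      have t2: "\<bar>\<eta>1 t * frac_laplacian a \<phi>R x\<bar> \<le> K1 * C * ?r * h t * \<phi>R x" if a: "a \<in> {\<sigma>1, \<sigma>2}" for a
      proof -
        have "\<bar>\<eta>1 t * frac_laplacian a \<phi>R x\<bar> \<le> (1 / \<tau> * (K1 * h t)) * (R powr (- 2 * a) * C * \<phi>R x)"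
          unfolding abs_mult using h1 flR a \<tau> K1(1) h0 by (intro mult_mono) auto
        also have "\<dots> = (1 / \<tau> * R powr (- 2 * a)) * (K1 * C * h t * \<phi>R x)" by (simp only: mult_ac)
        also have "\<dots> \<le> ?r * (K1 * C * h t * \<phi>R x)"
          using a \<sigma>(3) K1(1) C h0 f0 by (intro mult_right_mono e2) auto
        finally show ?thesis by (simp only: mult_ac)
      qed
      have t3: "\<bar>\<eta> t * frac_laplacian \<sigma> \<phi>R x\<bar> \<le> C * ?r * h t * \<phi>R x"
      proof -
        have "\<bar>\<eta> t * frac_laplacian \<sigma> \<phi>R x\<bar> \<le> h t * (?r * C * \<phi>R x)"
          unfolding abs_mult using h3 flR \<eta>0 h0 by (intro mult_mono) auto
        then show ?thesis by (simp only: mult_ac)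
      qed
      have "\<bar>adjoint_op \<sigma> \<sigma>1 \<sigma>2 (\<lambda>s y. \<eta> s * \<phi>R y) t x\<bar>
        \<le> \<bar>\<eta>2 t * \<phi>R x\<bar> + \<bar>\<eta>1 t * frac_laplacian \<sigma>1 \<phi>R x\<bar> + \<bar>\<eta>1 t * frac_laplacian \<sigma>2 \<phi>R x\<bar> + \<bar>\<eta> t * frac_laplacian \<sigma> \<phi>R x\<bar>"
        unfolding adjoint_op_product[OF d1 d2] by linarith
      also have "\<dots> \<le> K2 * ?r * h t * \<phi>R x + K1 * C * ?r * h t * \<phi>R x + K1 * C * ?r * h t * \<phi>R x + C * ?r * h t * \<phi>R x"
        by (intro add_mono t1 t2 t3) auto
      also have "\<dots> = B * h t * \<phi>R x" 
      proof -
        have "K2 * r * h' * f + K1 * C * r * h' * f + K1 * C * r * h' * f + C * r * h' * f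
            = (K2 + 2 * K1 * C + C) * r * h' * f" for r h' f :: real
          by (simp add: algebra_simps)
        then show ?thesis by (simp only: B_def K4_def)
      qed
      finally show ?thesis by (simp only: h_def)
    qed
    have est: "\<epsilon> * \<eta> 0 * (\<integral>x. u1 x * \<phi>R x \<partial>lborel) \<le> \<tau> * B powr (p / (p - 1)) * (\<integral>x. \<phi>R x \<partial>lborel)"
      by (rule weak_solution_scaled_estimate[OF p weak st \<phi>R0 tt \<eta>0 \<tau> \<tau>T \<eta>\<tau> B0 adj])
    have "(\<integral>x. \<phi>R x \<partial>lborel) = R powr DIM('a) * N"
    proof -
      have "N = (\<bar>1 / R\<bar> ^ DIM('a)) *\<^sub>R (\<integral>x. \<phi> (0 + (1 / R) *\<^sub>R x) \<partial>lborel)"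
        unfolding N_def using R0 by (intro integral_euclidean_affine \<phi>m) simp
      then show ?thesis using R0 by (simp add: \<phi>R_def powr_realpow power_divide)
    qed
    moreover have "\<eta> 0 = exp (- 1)" by (simp add: \<eta>_def bump_def poly_bump_def)
    moreover have "B powr q = K4 powr q * R powr (- 2 * \<sigma> * q)"
      unfolding B_def using K4 by (simp add: powr_mult powr_powr)
    ultimately have "\<epsilon> * exp (- 1) * (\<integral>x. u1 x * \<phi>R x \<partial>lborel)
        \<le> R powr (2 * (\<sigma> - \<sigma>1)) * (K4 powr q * R powr (- 2 * \<sigma> * q)) * (R powr DIM('a) * N)"
      using est by (simp add: q_def \<tau>_def)
    also have "\<dots> = K4 powr q * N * R powr (2 * (\<sigma> - \<sigma>1) + DIM('a) + - 2 * \<sigma> * q)"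
      unfolding powr_add by (simp only: mult_ac)
    also have "2 * (\<sigma> - \<sigma>1) + DIM('a) + - 2 * \<sigma> * q = 2 * (\<sigma> - \<sigma>1) + DIM('a) - 2 * \<sigma> * p / (p - 1)"
      by (simp add: q_def)
    finally have "exp 1 * (\<epsilon> * exp (- 1) * (\<integral>x. u1 x * \<phi>R x \<partial>lborel))
        \<le> exp 1 * (K4 powr q * N * R powr (2 * (\<sigma> - \<sigma>1) + DIM('a) - 2 * \<sigma> * p / (p - 1)))"
      by (intro mult_left_mono) auto
    also have "\<dots> \<le> exp 1 * (K4 powr q * (N + 1) * R powr (2 * (\<sigma> - \<sigma>1) + DIM('a) - 2 * \<sigma> * p / (p - 1)))"
      by (intro mult_left_mono mult_right_mono) auto
    also have "exp 1 * (\<epsilon> * exp (- 1) * (\<integral>x. u1 x * \<phi>R x \<partial>lborel)) = \<epsilon> * (\<integral>x. u1 x * \<phi>R x \<partial>lborel)"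
      by (simp add: exp_minus)
    finally show ?thesis by (simp only: K_def \<phi>R_def mult.assoc)
  qed
  show thesis by (rule that[OF K main])
qed

section \<open>The lifespan\<close>

text \<open>The common end of the cases m = 1 and m > 1. The rate \<kappa> is left free so that a
  slightly smaller one can be inserted where a logarithm has to be absorbed.\<close>

lemma lifespan_le:
  fixes K R0 \<kappa> L :: real
  assumes K: "K > 0" and R0: "R0 > 0" and \<kappa>: "\<kappa> > 0"
    and est: "\<And>\<epsilon> T u R. \<epsilon> > 0 \<Longrightarrow> R \<ge> R0 \<Longrightarrow> R powr L < T \<Longrightarrow> weak_solution \<sigma> \<sigma>1 \<sigma>2 p u1 \<epsilon> T u
      \<Longrightarrow> \<epsilon> \<le> K * R powr (- \<kappa>)"
  shows "\<exists>\<epsilon>0>0. \<exists>C>0. \<forall>\<epsilon>\<in>{0<..\<epsilon>0}. lifespan \<sigma> \<sigma>1 \<sigma>2 p u1 \<epsilon> \<le> ennreal (C * \<epsilon> powr (- (L / \<kappa>)))"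
proof (intro exI conjI ballI)
  show "2 * K * R0 powr (- \<kappa>) > 0" "(2 * K) powr (L / \<kappa>) > 0" using K R0 by auto
  fix \<epsilon> assume "\<epsilon> \<in> {0<..2 * K * R0 powr (- \<kappa>)}"
  then have \<epsilon>: "\<epsilon> > 0" "\<epsilon> \<le> 2 * K * R0 powr (- \<kappa>)" by auto
  \<comment> \<open>With this choice K R^(-\<kappa>) = \<epsilon> / 2, which contradicts
    \<open>est\<close> as soon as R^L < T; hence T \<le> R^L. The threshold for \<epsilon> is the
    condition R \<ge> R0.\<close>
  define R where "R = (2 * K / \<epsilon>) powr (1 / \<kappa>)"
  have q: "2 * K / \<epsilon> > 0" using K \<epsilon> by simp
  have "R0 powr \<kappa> \<le> 2 * K / \<epsilon>"
    using \<epsilon> R0 by (simp add: powr_minus field_simps)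
  then have "(R0 powr \<kappa>) powr (1 / \<kappa>) \<le> R"
    unfolding R_def using \<kappa> by (intro powr_mono2) auto
  then have R: "R \<ge> R0" using R0 \<kappa> by (simp add: powr_powr)
  have "K * R powr (- \<kappa>) = K * (2 * K / \<epsilon>) powr (- 1)"
    using \<kappa> by (simp add: R_def powr_powr)
  also have "\<dots> = \<epsilon> / 2" using K \<epsilon> by (simp add: powr_minus)
  finally have half: "K * R powr (- \<kappa>) = \<epsilon> / 2" .
  have RL: "R powr L = (2 * K) powr (L / \<kappa>) * \<epsilon> powr (- (L / \<kappa>))"
  proof -
    have "R powr L = (2 * K / \<epsilon>) powr (L / \<kappa>)" by (simp add: R_def powr_powr)
    also have "\<dots> = (2 * K) powr (L / \<kappa>) / \<epsilon> powr (L / \<kappa>)" by (rule powr_divide)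
    finally show ?thesis by (simp only: powr_minus divide_inverse)
  qed
  show "lifespan \<sigma> \<sigma>1 \<sigma>2 p u1 \<epsilon> \<le> ennreal ((2 * K) powr (L / \<kappa>) * \<epsilon> powr (- (L / \<kappa>)))"
    unfolding lifespan_def
  proof (rule Sup_least, safe)
    fix T u assume w: "weak_solution \<sigma> \<sigma>1 \<sigma>2 p u1 \<epsilon> T u"
    have "\<not> R powr L < T" using est[OF \<epsilon>(1) R _ w] half \<epsilon>(1) by linarith
    then show "ennreal T \<le> ennreal ((2 * K) powr (L / \<kappa>) * \<epsilon> powr (- (L / \<kappa>)))"
      unfolding RL by (intro ennreal_leI) simp
  qed
qed

section \<open>Lower bounds for the tested initial data\<close>

text \<open>Where |u| \<le> 1 the product is dominated by |\<phi>|; elsewhere |u| \<le> |u|^m, and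
  the boundedness of \<phi> suffices.\<close>

lemma in_Lp_mult_integrable:
  fixes u \<phi> :: "'a::euclidean_space \<Rightarrow> real"
  assumes u: "in_Lp m u" and m: "m \<ge> 1" and \<phi>: "integrable lborel \<phi>" "bounded (range \<phi>)"
  shows "integrable lborel (\<lambda>x. u x * \<phi> x)"
proof -
  have [measurable]: "u \<in> borel_measurable borel" "\<phi> \<in> borel_measurable borel"
    using u \<phi> by (auto simp: in_Lp_def)
  obtain B where B: "\<And>x. \<bar>\<phi> x\<bar> \<le> B" using \<phi>(2) by (auto simp: bounded_iff)
  have "integrable lborel (\<lambda>x. \<bar>u x\<bar> powr m * B + \<bar>\<phi> x\<bar>)"
    using u \<phi> by (auto simp: in_Lp_def)
  then show ?thesis
  proof (rule Bochner_Integration.integrable_bound)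
    have "\<bar>u x * \<phi> x\<bar> \<le> \<bar>\<bar>u x\<bar> powr m * B + \<bar>\<phi> x\<bar>\<bar>" for x
    proof (cases "\<bar>u x\<bar> \<le> 1")
      case True
      have "\<bar>u x * \<phi> x\<bar> \<le> 1 * \<bar>\<phi> x\<bar>" unfolding abs_mult using True by (intro mult_right_mono) auto
      moreover have "0 \<le> \<bar>u x\<bar> powr m * B" using B[of x] by simp
      ultimately show ?thesis by linarith
    next
      case False
      then have "\<bar>u x\<bar> powr 1 \<le> \<bar>u x\<bar> powr m" using m by (intro powr_mono) auto
      then have "\<bar>u x * \<phi> x\<bar> \<le> \<bar>u x\<bar> powr m * B"
        unfolding abs_mult using B[of x] False by (intro mult_mono) auto
      then show ?thesis by linarith
    qed
    then show "AE x in lborel. norm (u x * \<phi> x) \<le> norm (\<bar>u x\<bar> powr m * B + \<bar>\<phi> x\<bar>)" by simp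
  qed measurable
qed

text \<open>As R grows, \<phi>(x/R) tends to \<phi> 0 boundedly, so by dominated convergence the
  integral tends to \<phi> 0 times the mean of \<open>u\<close>. Half of this limit serves as
  \<open>c\<close>.\<close>

lemma dilated_integral_lower_bound:
  fixes u \<phi> :: "'a::euclidean_space \<Rightarrow> real"
  assumes u: "integrable lborel u" "(\<integral>x. u x \<partial>lborel) > 0" and \<phi>: "space_test \<phi>" "\<And>x. \<phi> x > 0"
  obtains c R0 where "c > 0" "R0 \<ge> 1" "\<And>R. R \<ge> R0 \<Longrightarrow> (\<integral>x. u x * \<phi> ((1 / R) *\<^sub>R x) \<partial>lborel) \<ge> c"
proof -
  have [measurable]: "u \<in> borel_measurable borel" using u by auto
  note [measurable] = space_testD(4)[OF \<phi>(1)]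
  obtain B where B: "\<And>x. \<bar>\<phi> x\<bar> \<le> B" using space_testD(3)[OF \<phi>(1)] by (auto simp: bounded_iff)
  define I where "I = (\<integral>x. u x * \<phi> 0 \<partial>lborel)"
  have I: "I > 0" using u(2) \<phi>(2)[of 0] by (simp add: I_def)
  have cont: "isCont \<phi> 0"
    using smooth_continuous[OF space_testD(1)[OF \<phi>(1)]] by (simp add: continuous_on_eq_continuous_at)
  have "((\<lambda>R. \<integral>x. u x * \<phi> ((1 / R) *\<^sub>R x) \<partial>lborel) \<longlongrightarrow> I) at_top"
    unfolding I_def
  proof (rule integral_dominated_convergence_at_top[where w="\<lambda>x. \<bar>u x\<bar> * B"])
    show "AE x in lborel. ((\<lambda>R. u x * \<phi> ((1 / R) *\<^sub>R x)) \<longlongrightarrow> u x * \<phi> 0) at_top"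
    proof (intro AE_I2 tendsto_mult tendsto_const)
      fix x :: 'a
      have "((\<lambda>R::real. (1 / R) *\<^sub>R x) \<longlongrightarrow> 0 *\<^sub>R x) at_top"
        by (intro tendsto_scaleR tendsto_const tendsto_divide_0[OF tendsto_const filterlim_at_top_imp_at_infinity] filterlim_ident)
      then show "((\<lambda>R::real. \<phi> ((1 / R) *\<^sub>R x)) \<longlongrightarrow> \<phi> 0) at_top"
        using cont by (intro isCont_tendsto_compose[of 0 \<phi>]) simp_all
    qed
    show "integrable lborel (\<lambda>x. \<bar>u x\<bar> * B)" using u by (intro integrable_mult_left) simp
    show "\<forall>\<^sub>F R in at_top. AE x in lborel. norm (u x * \<phi> ((1 / R) *\<^sub>R x)) \<le> \<bar>u x\<bar> * B"
      using B by (auto simp: abs_mult intro!: always_eventually mult_left_mono)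
  qed measurable
  then have "\<forall>\<^sub>F R in at_top. (\<integral>x. u x * \<phi> ((1 / R) *\<^sub>R x) \<partial>lborel) > I / 2"
    using I by (intro order_tendstoD) auto
  then obtain R1 where R1: "\<And>R. R \<ge> R1 \<Longrightarrow> (\<integral>x. u x * \<phi> ((1 / R) *\<^sub>R x) \<partial>lborel) > I / 2"
    by (auto simp: eventually_at_top_linorder)
  show thesis
  proof (rule that[of "I / 2" "max 1 R1"])
    show "(\<integral>x. u x * \<phi> ((1 / R) *\<^sub>R x) \<partial>lborel) \<ge> I / 2" if "R \<ge> max 1 R1" for R
      using R1[of R] that by simp
  qed (use I in auto)
qed

text \<open>Since \<open>u\<close> is nonnegative almost everywhere, the integral may be restricted
  to |x| \<le> R. There the bracket is at most 2 R, the logarithm is at most its value at R, and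
  \<phi>(x/R) is at least the minimum of \<phi> over the unit ball. The volume contributes
  R^n.\<close>

lemma dilated_integral_lower_bound_log:
  fixes u \<phi> :: "'a::euclidean_space \<Rightarrow> real"
  assumes u: "in_Lp m u" "m \<ge> 1"
    "AE x in lborel. u x \<ge> japanese_bracket x powr (- real DIM('a) / m) * inverse (ln (exp 1 + norm x))"
    and \<phi>: "space_test \<phi>" "\<And>x. \<phi> x > 0"
  obtains c where "c > 0"
    "\<And>R. R \<ge> 1 \<Longrightarrow> c * R powr (real DIM('a) - real DIM('a) / m) / ln (exp 1 + R) \<le> (\<integral>x. u x * \<phi> ((1 / R) *\<^sub>R x) \<partial>lborel)"
proof -
  let ?n = "real DIM('a)"
  define v where "v = measure lborel (cball 0 1 :: 'a set)"
  have v: "v > 0" unfolding v_def by (simp add: content_cball_pos)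
  have "\<exists>z\<in>cball 0 1. \<forall>y\<in>cball 0 1. \<phi> z \<le> \<phi> y"
    using smooth_continuous[OF space_testD(1)[OF \<phi>(1)]] continuous_on_subset
    by (intro continuous_attains_inf) auto
  then obtain z where z: "\<And>y. norm y \<le> 1 \<Longrightarrow> \<phi> z \<le> \<phi> y" by (metis mem_cball_0)
  define c where "c = v * (2 powr (- ?n / m) * \<phi> z)"
  have c: "c > 0" using v \<phi>(2)[of z] by (simp add: c_def)
  have "c * R powr (?n - ?n / m) / ln (exp 1 + R) \<le> (\<integral>x. u x * \<phi> ((1 / R) *\<^sub>R x) \<partial>lborel)"
    if R: "R \<ge> 1" for R
  proof -
    have R0: "R > 0" using R by simp
    have st: "space_test (\<lambda>x. \<phi> ((1 / R) *\<^sub>R x))" using R0 by (intro space_test_scale \<phi>) simp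
    have I: "integrable lborel (\<lambda>x. u x * \<phi> ((1 / R) *\<^sub>R x))"
      by (rule in_Lp_mult_integrable[OF u(1,2)]) (rule space_testD[OF st])+
    have ln_pos: "ln (exp 1 + r) \<ge> 1" if "r \<ge> 0" for r :: real
    proof -
      have "ln (exp 1) \<le> ln (exp 1 + r)" using that by (subst ln_le_cancel_iff) (auto intro: add_pos_nonneg)
      then show ?thesis by simp
    qed
    define d where "d = (2 * R) powr (- ?n / m) * inverse (ln (exp 1 + R)) * \<phi> z"
    have d0: "d \<ge> 0" using ln_pos[of R] R \<phi>(2)[of z] by (simp add: d_def)
    have fin: "emeasure lborel (cball 0 R :: 'a set) < \<infinity>" by (rule emeasure_lborel_cball_finite)
    have vol: "measure lborel (cball 0 R :: 'a set) = R powr ?n * v"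
      using R0 by (simp add: v_def content_cball powr_realpow)
    have "c * R powr (?n - ?n / m) / ln (exp 1 + R) = measure lborel (cball 0 R :: 'a set) * d"
    proof -
      have "(2 * R) powr (- ?n / m) = 2 powr (- ?n / m) * R powr (- ?n / m)"
        using R0 by (simp add: powr_mult)
      moreover have "R powr (?n - ?n / m) = R powr ?n * R powr (- ?n / m)"
        unfolding powr_add[symmetric] by simp
      ultimately show ?thesis unfolding vol c_def d_def divide_inverse by (simp only: mult_ac)
    qed
    also have "\<dots> = (\<integral>x. indicator (cball (0::'a) R) x * d \<partial>lborel)" using fin by simp
    also have "\<dots> \<le> (\<integral>x. u x * \<phi> ((1 / R) *\<^sub>R x) \<partial>lborel)"
    proof (rule integral_mono_AE[OF _ I])
      show "integrable lborel (\<lambda>x. indicator (cball (0::'a) R) x * d)"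
        using fin by (intro integrable_mult_left integrable_real_indicator) simp_all
      show "AE x in lborel. indicator (cball 0 R) x * d \<le> u x * \<phi> ((1 / R) *\<^sub>R x)"
        using u(3)
      proof eventually_elim
        fix x :: 'a
        assume ux: "u x \<ge> japanese_bracket x powr (- ?n / m) * inverse (ln (exp 1 + norm x))"
        have u0: "u x \<ge> 0" using ux ln_pos[of "norm x"] by (intro order_trans[OF _ ux]) simp
        show "indicator (cball 0 R) x * d \<le> u x * \<phi> ((1 / R) *\<^sub>R x)"
        proof (cases "norm x \<le> R")
          case True
          have j0: "japanese_bracket x > 0" by (simp add: japanese_bracket_def add_pos_nonneg)
          have "1 + (norm x)\<^sup>2 \<le> (2 * R)\<^sup>2"
          proof -
            have "(norm x)\<^sup>2 \<le> R\<^sup>2" using True by (intro power_mono) auto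
            moreover have "1 \<le> R\<^sup>2" using R by simp
            ultimately show ?thesis unfolding power_mult_distrib by simp
          qed
          then have "japanese_bracket x \<le> 2 * R"
            unfolding japanese_bracket_def using R0 by (intro real_le_lsqrt) auto
          then have "(2 * R) powr (- ?n / m) \<le> japanese_bracket x powr (- ?n / m)"
            using j0 u(2) by (intro powr_mono2') auto
          moreover have "inverse (ln (exp 1 + R)) \<le> inverse (ln (exp 1 + norm x))"
          proof (rule le_imp_inverse_le)
            have "0 < exp 1 + norm x" by (simp add: add_pos_nonneg)
            then show "ln (exp 1 + norm x) \<le> ln (exp 1 + R)" using True by simp
            show "0 < ln (exp 1 + norm x)" using ln_pos[of "norm x"] by simp
          qed
          ultimately have "(2 * R) powr (- ?n / m) * inverse (ln (exp 1 + R)) \<le> u x"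
            using ln_pos[of R] R0 by (intro order_trans[OF mult_mono ux]) auto
          moreover have "\<phi> z \<le> \<phi> ((1 / R) *\<^sub>R x)" using True R0 by (intro z) (simp add: divide_le_eq)
          ultimately have "d \<le> u x * \<phi> ((1 / R) *\<^sub>R x)"
            unfolding d_def using u0 \<phi>(2)[of z] by (intro mult_mono) auto
          then show ?thesis using True by simp
        next
          case False
          then show ?thesis using u0 \<phi>(2)[of "(1 / R) *\<^sub>R x"] by simp
        qed
      qed
    qed
    finally show ?thesis .
  qed
  then show thesis using that c by blast
qed

section \<open>Arithmetic of the exponents\<close>

text \<open>For R \<ge> 1 one has exp 1 + R \<le> exp 2 * R, which produces the 2;
  \<open>ln_powr_bound\<close> turns the remaining ln R into the summand with 1 / \<theta>.\<close>

lemma ln_exp_1_plus_le_powr: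
  fixes \<theta> :: real
  assumes "\<theta> > 0" "R \<ge> 1"
  shows "ln (exp 1 + R) \<le> (2 + 1 / \<theta>) * R powr \<theta>"
proof -
  have "exp 1 + R \<le> exp 2 * R"
  proof -
    have "exp (2::real) \<ge> exp 1 + 1"
    proof -
      have "exp (2::real) = exp 1 * exp 1" by (simp flip: exp_add)
      moreover have "exp (1::real) \<ge> 2" using exp_ge_add_one_self[of 1] by simp
      ultimately show ?thesis using mult_right_mono[of 2 "exp (1::real)" "exp 1"] by linarith
    qed
    then have "(exp 1 + 1) * R \<le> exp 2 * R" using assms by (intro mult_right_mono) auto
    moreover have "exp 1 * 1 \<le> exp 1 * R" using assms by (intro mult_left_mono) auto
    moreover have "(exp 1 + 1) * R = exp 1 * R + R" by (simp add: distrib_right)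
    ultimately show ?thesis by linarith
  qed
  then have "ln (exp 1 + R) \<le> ln (exp 2 * R)" using assms by (subst ln_le_cancel_iff) (auto intro: add_pos_pos)
  also have "\<dots> = 2 + ln R" using assms by (simp add: ln_mult)
  also have "ln R \<le> R powr \<theta> / \<theta>" using assms by (intro ln_powr_bound) auto
  also have "2 + R powr \<theta> / \<theta> \<le> 2 * R powr \<theta> + R powr \<theta> / \<theta>"
    using ge_one_powr_ge_zero[of R \<theta>] assms by simp
  finally show ?thesis by (simp add: distrib_right)
qed

text \<open>Over the common denominator 2 m (\<sigma> - \<sigma>1) the numerator is 2 m \<sigma> -
  (p - 1)(n - 2 m \<sigma>1), whose positivity is the subcriticality of \<open>p\<close> if n > 2 m
  \<sigma>1 and automatic otherwise.\<close>

lemma gamma_exponent_pos: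
  fixes m \<sigma> \<sigma>1 p :: real
  assumes m: "m \<ge> 1" and \<sigma>: "0 \<le> \<sigma>1" "\<sigma>1 < \<sigma>" and p: "p > 1"
    and sub: "real n > 2 * m * \<sigma>1 \<Longrightarrow> p < 1 + 2 * m * \<sigma> / (real n - 2 * m * \<sigma>1)"
  shows "gamma_exponent n m \<sigma> \<sigma>1 p > 0"
proof -
  have "2 * m * \<sigma> - (p - 1) * (real n - 2 * m * \<sigma>1) > 0"
  proof (cases "real n > 2 * m * \<sigma>1")
    case True
    then have "p - 1 < 2 * m * \<sigma> / (real n - 2 * m * \<sigma>1)" using sub by simp
    then show ?thesis using True by (simp add: pos_less_divide_eq)
  next
    case False
    then have "(p - 1) * (real n - 2 * m * \<sigma>1) \<le> 0" using p by (intro mult_nonneg_nonpos) auto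
    moreover have "2 * m * \<sigma> > 0" using m \<sigma> by simp
    ultimately show ?thesis by linarith
  qed
  moreover have "gamma_exponent n m \<sigma> \<sigma>1 p
      = (2 * m * \<sigma> - (p - 1) * (real n - 2 * m * \<sigma>1)) / (2 * m * (\<sigma> - \<sigma>1))"
  proof -
    define s where "s = \<sigma> - \<sigma>1"
    have s: "s > 0" "\<sigma> = s + \<sigma>1" using \<sigma> by (auto simp: s_def)
    show ?thesis using s(1) m unfolding gamma_exponent_def s(2) by (simp add: field_simps)
  qed
  ultimately show ?thesis using m \<sigma> by simp
qed

text \<open>The left side is the decay rate in R that remains after the growth R^(n - n/m) of the
  tested data has been divided out; the factor 2 (\<sigma> - \<sigma>1) on the right disappears when
  R is converted into time.\<close>

lemma gamma_exponent_scaling: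
  fixes m \<sigma> \<sigma>1 p :: real
  assumes m: "m \<ge> 1" and \<sigma>: "\<sigma>1 < \<sigma>" and p: "p > 1"
  shows "2 * \<sigma> * p / (p - 1) - 2 * (\<sigma> - \<sigma>1) - real n / m = 2 * (\<sigma> - \<sigma>1) * (gamma_exponent n m \<sigma> \<sigma>1 p / (p - 1))"
proof -
  define s where "s = \<sigma> - \<sigma>1"
  have s: "s > 0" "\<sigma> = s + \<sigma>1" using \<sigma> by (auto simp: s_def)
  define q where "q = p - 1"
  have q: "q > 0" "p = q + 1" using p by (auto simp: q_def)
  show ?thesis
    using s(1) q(1) m unfolding gamma_exponent_def s(2) q(2) by (simp add: field_simps)
qed

theorem proposition3p2:
  fixes u1 :: "real ^ 'n \<Rightarrow> real"
    and m \<sigma> \<sigma>1 \<sigma>2 p \<delta> :: real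
  assumes "m \<ge> 1" and "\<sigma> \<ge> 1"
    and "0 \<le> \<sigma>1" and "\<sigma>1 < \<sigma> / 2" and "\<sigma> / 2 < \<sigma>2" and "\<sigma>2 \<le> \<sigma>"
    and "in_Lp m u1"
    and "m = 1 \<Longrightarrow> (LINT x|lborel. u1 x) > 0"
    and "m > 1 \<Longrightarrow> AE x in lborel.
           u1 x \<ge> japanese_bracket x powr (- real CARD('n) / m) * inverse (ln (exp 1 + norm x))"
    and "1 < p"
    and "real CARD('n) > 2 * m * \<sigma>1 \<Longrightarrow> p < 1 + 2 * m * \<sigma> / (real CARD('n) - 2 * m * \<sigma>1)"
    and "\<delta> > 0"
  shows "\<exists>\<epsilon>0>0. \<exists>C>0. \<forall>\<epsilon>\<in>{0<..\<epsilon>0}.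
           lifespan \<sigma> \<sigma>1 \<sigma>2 p u1 \<epsilon> \<le>
             ennreal (C * (if m = 1
               then \<epsilon> powr (- (p - 1) / gamma_exponent CARD('n) 1 \<sigma> \<sigma>1 p)
               else \<epsilon> powr (- (p - 1) / gamma_exponent CARD('n) m \<sigma> \<sigma>1 p - \<delta>)))"
proof -
  have \<sigma>12: "\<sigma>1 \<le> \<sigma>2" and \<sigma>1\<sigma>: "\<sigma>1 < \<sigma>" using assms by linarith+
  have fA: "finite {\<sigma>1, \<sigma>2, \<sigma>}" "\<And>a. a \<in> {\<sigma>1, \<sigma>2, \<sigma>} \<Longrightarrow> a \<ge> 0" using assms by auto
  obtain \<phi> :: "real ^ 'n \<Rightarrow> real" and C where \<phi>: "space_test \<phi>" "\<And>x. \<phi> x > 0" and C: "C > 0"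
    and fl: "\<And>a x. a \<in> {\<sigma>1, \<sigma>2, \<sigma>} \<Longrightarrow> \<bar>frac_laplacian a \<phi> x\<bar> \<le> C * \<phi> x"
    by (rule frac_laplacian_test_function[OF fA], assumption, rule that)
  let ?\<gamma> = "gamma_exponent CARD('n) m \<sigma> \<sigma>1 p"
  define L where "L = 2 * (\<sigma> - \<sigma>1)"
  have L: "L > 0" using \<sigma>1\<sigma> by (simp add: L_def)
  have \<gamma>: "?\<gamma> > 0" using assms \<sigma>1\<sigma> by (intro gamma_exponent_pos) auto
  define e where "e = L + real CARD('n) - 2 * \<sigma> * p / (p - 1)"
  have e: "e = - (L * ?\<gamma> / (p - 1)) + real CARD('n) - real CARD('n) / m"
    using gamma_exponent_scaling[of m \<sigma>1 \<sigma> p "CARD('n)"] assms \<sigma>1\<sigma> by (simp add: e_def L_def)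
  obtain K where K: "K > 0" and est:
    "\<And>u1 \<epsilon> T u R. R \<ge> 1 \<Longrightarrow> R powr (2 * (\<sigma> - \<sigma>1)) < T \<Longrightarrow> weak_solution \<sigma> \<sigma>1 \<sigma>2 p u1 \<epsilon> T u \<Longrightarrow>
      \<epsilon> * (\<integral>x. u1 x * \<phi> ((1 / R) *\<^sub>R x) \<partial>lborel)
        \<le> K * R powr (2 * (\<sigma> - \<sigma>1) + DIM(real ^ 'n) - 2 * \<sigma> * p / (p - 1))"
    by (rule weak_solution_estimate[OF assms(10,3,4) \<sigma>12 \<phi> C fl], assumption, rule that)
  have est: "\<epsilon> * (\<integral>x. u1 x * \<phi> ((1 / R) *\<^sub>R x) \<partial>lborel) \<le> K * R powr e"
    if "R \<ge> 1" "R powr L < T" "weak_solution \<sigma> \<sigma>1 \<sigma>2 p u1 \<epsilon> T u" for \<epsilon> T u R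
    using est[of R T u1 \<epsilon> u] that by (simp add: e_def L_def)
  show ?thesis
  proof (cases "m = 1")
    \<comment> \<open>For m = 1 the two dimensional terms in \<open>e\<close> cancel, and the rate
      needs no correction.\<close>
    case True
    have "integrable lborel (\<lambda>x. \<bar>u1 x\<bar>)" "u1 \<in> borel_measurable lborel"
      using assms(7) True by (auto simp: in_Lp_def)
    then have uI: "integrable lborel u1" using integrable_abs_iff by blast
    obtain c R0 where c: "c > 0" "R0 \<ge> 1"
      "\<And>R. R \<ge> R0 \<Longrightarrow> (\<integral>x. u1 x * \<phi> ((1 / R) *\<^sub>R x) \<partial>lborel) \<ge> c"
      by (rule dilated_integral_lower_bound[OF uI assms(8)[OF True] \<phi>], rule that)
    have "\<exists>\<epsilon>0>0. \<exists>C>0. \<forall>\<epsilon>\<in>{0<..\<epsilon>0}. lifespan \<sigma> \<sigma>1 \<sigma>2 p u1 \<epsilon> \<le> ennreal (C * \<epsilon> powr (- (L / (L * ?\<gamma> / (p - 1)))))"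
    proof (rule lifespan_le)
      show "K / c > 0" "R0 > 0" "L * ?\<gamma> / (p - 1) > 0" using K c L \<gamma> assms(10) by auto
      fix \<epsilon> T u R
      assume \<epsilon>: "\<epsilon> > 0" and R: "R \<ge> R0" "R powr L < T" and w: "weak_solution \<sigma> \<sigma>1 \<sigma>2 p u1 \<epsilon> T u"
      have "\<epsilon> * c \<le> \<epsilon> * (\<integral>x. u1 x * \<phi> ((1 / R) *\<^sub>R x) \<partial>lborel)"
        using \<epsilon> R c by (intro mult_left_mono) auto
      also have "\<dots> \<le> K * R powr e" using R c(2) w by (intro est) auto
      finally show "\<epsilon> \<le> K / c * R powr (- (L * ?\<gamma> / (p - 1)))"
        using c(1) True by (simp add: e pos_le_divide_eq)
    qed
    moreover have "- (L / (L * ?\<gamma> / (p - 1))) = - (p - 1) / gamma_exponent CARD('n) 1 \<sigma> \<sigma>1 p"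
      using True L by (simp add: minus_divide_left)
    ultimately show ?thesis using True by (simp only: if_True simp_thms)
  next
    case False
    with assms(1) have m: "m > 1" by simp
    obtain c where c: "c > 0"
      "\<And>R. R \<ge> 1 \<Longrightarrow> c * R powr (real DIM(real ^ 'n) - real DIM(real ^ 'n) / m) / ln (exp 1 + R)
         \<le> (\<integral>x. u1 x * \<phi> ((1 / R) *\<^sub>R x) \<partial>lborel)"
    proof (rule dilated_integral_lower_bound_log[OF assms(7,1) _ \<phi>])
      show "AE x in lborel. u1 x \<ge> japanese_bracket x powr (- real DIM(real ^ 'n) / m) * inverse (ln (exp 1 + norm x))"
        using assms(9)[OF m] by simp
    qed (rule that)
    \<comment> \<open>Solves L / \<kappa> = (p - 1) / \<gamma> + \<delta>, the exponent to be
      reached.\<close>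
    define \<kappa> where "\<kappa> = L / ((p - 1) / ?\<gamma> + \<delta>)"
    have d0: "(p - 1) / ?\<gamma> > 0" using \<gamma> assms(10) by simp
    have \<kappa>: "\<kappa> > 0" unfolding \<kappa>_def using L d0 assms(12) by (simp only: zero_less_divide_iff add_pos_pos simp_thms)
    \<comment> \<open>The distance to the sharp rate, positive because \<delta> > 0: the factor
      R^(-\<theta>) that it leaves over absorbs the logarithm.\<close>
    define \<theta> where "\<theta> = L * ?\<gamma> / (p - 1) - \<kappa>"
    have \<theta>: "\<theta> > 0"
    proof -
      have "\<kappa> < L / ((p - 1) / ?\<gamma>)"
        unfolding \<kappa>_def using L d0 assms(10,12) \<gamma> by (intro divide_strict_left_mono mult_pos_pos add_pos_pos) auto
      then show ?thesis by (simp add: \<theta>_def)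
    qed
    have "\<exists>\<epsilon>0>0. \<exists>C>0. \<forall>\<epsilon>\<in>{0<..\<epsilon>0}. lifespan \<sigma> \<sigma>1 \<sigma>2 p u1 \<epsilon> \<le> ennreal (C * \<epsilon> powr (- (L / \<kappa>)))"
    proof (rule lifespan_le)
      have "K / c > 0" "2 + 1 / \<theta> > 0" using K c(1) \<theta> by (auto intro: add_pos_pos)
      then show "K / c * (2 + 1 / \<theta>) > 0" by (rule mult_pos_pos)
      show "(1::real) > 0" "\<kappa> > 0" using \<kappa> by auto
      fix \<epsilon> T u R
      assume \<epsilon>: "\<epsilon> > 0" and R: "R \<ge> 1" "R powr L < T" and w: "weak_solution \<sigma> \<sigma>1 \<sigma>2 p u1 \<epsilon> T u"
      define l where "l = ln (exp 1 + R)"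
      define a where "a = real CARD('n) - real CARD('n) / m"
      have l: "l > 0" unfolding l_def using R(1) exp_gt_zero[of "1::real"] by (intro ln_gt_zero) linarith
      have lR: "l \<le> (2 + 1 / \<theta>) * R powr \<theta>" unfolding l_def by (rule ln_exp_1_plus_le_powr[OF \<theta> R(1)])
      have Ra: "R powr a > 0" using R by simp
      have "\<epsilon> * (c * R powr a / l) \<le> \<epsilon> * (\<integral>x. u1 x * \<phi> ((1 / R) *\<^sub>R x) \<partial>lborel)"
        using \<epsilon> R c(2)[of R] by (intro mult_left_mono) (auto simp: l_def a_def)
      also have "\<dots> \<le> K * R powr e" by (rule est[OF R w])
      also have "e = - (\<theta> + \<kappa>) + a" by (simp add: e a_def \<theta>_def)
      also have "R powr (- (\<theta> + \<kappa>) + a) = R powr (- \<theta> - \<kappa>) * R powr a" unfolding powr_add by simp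
      finally have "(\<epsilon> * c / l) * R powr a \<le> (K * R powr (- \<theta> - \<kappa>)) * R powr a" by (simp add: mult_ac)
      then have "\<epsilon> * c / l \<le> K * R powr (- \<theta> - \<kappa>)" using Ra by (rule mult_right_le_imp_le)
      then have "\<epsilon> \<le> K / c * R powr (- \<theta> - \<kappa>) * l" using c(1) l by (simp add: field_simps)
      also have "\<dots> \<le> K / c * R powr (- \<theta> - \<kappa>) * ((2 + 1 / \<theta>) * R powr \<theta>)"
        using K c(1) by (intro mult_left_mono lR) auto
      also have "\<dots> = K / c * (2 + 1 / \<theta>) * (R powr (- \<theta> - \<kappa>) * R powr \<theta>)" by (simp only: mult_ac)
      also have "R powr (- \<theta> - \<kappa>) * R powr \<theta> = R powr (- \<kappa>)" unfolding powr_add[symmetric] by simp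
      finally show "\<epsilon> \<le> K / c * (2 + 1 / \<theta>) * R powr (- \<kappa>)" .
    qed
    moreover have "- (L / \<kappa>) = - (p - 1) / ?\<gamma> - \<delta>"
      using L d0 assms(12) by (simp add: \<kappa>_def minus_divide_left)
    ultimately show ?thesis using False by (simp only: if_False simp_thms)
  qed
qed

end
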